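(* Assume $\{t_i\}_{i\ge1}$ is a long range dependent subordinated Gaussian sequence with parameters $r=1$ and $0<d<1/2$. Let $f$ be the marginal density function of $\{t_i\}$, and assume $f$ is increasing on $(-\infty,0]$ with $f'(t_0)>0$ and $t_0<0$, and that $\eta_1$ is differentiable at $t_0$ with $\eta_1'(t_0)\ne0$. Then, with $F_n(t)=\frac1n\sum_{i=1}^n\mathbf 1_{\{t_i\le t\}}$ the empirical distribution function and $\hat f_n(t)=T_{(-\infty,0]}(F_n)'(t)$, $$|\eta_1'(t_0)|^{-1}\,l_1(n)^{-1/2}\,n^{d/2}\,(\hat f_n(t_0)-f(t_0))\xrightarrow{\mathcal L}N(0,1)$$ as $n\to\infty$, where $l_1(n)=\frac{2}{(1-d)(2-d)}l_0(n)$ is slowly varying at infinity.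
   Context: For an interval $O$ and a function $x$ on $O$, $T_O(x)$ is the greatest convex minorant of $x$ on $O$ (pointwise supremum of convex $z:O\to\mathbb R$ with $z\le x$), $T_O(x)'$ its right-hand derivative. Long range dependent subordinated Gaussian sequence: $\{\xi_i\}_{i\ge1}$ is a stationary Gaussian process with mean zero, variance one and $E(\xi_i\xi_{i+k})=k^{-d}l_0(k)$, where $l_0$ is slowly varying at infinity and $0<d<1$; $g:\mathbb R\to\mathbb R$ is measurable and $t_i=g(\xi_i)$, with marginal distribution function $F$ and density $f$ (supported on $(-\infty,0]$). For fixed $t$, $\mathbf 1_{\{t_1\le t\}}-F(t)=\sum_{k\ge r(t)}\frac1{k!}\eta_k(t)h_k(\xi_1)$ is the expansion in Hermite polynomials $h_k$, $\eta_k(t)=E[(\mathbf 1_{\{t_1\le t\}}-F(t))h_k(\xi_1)]$, $r(t)$ is the index of the first nonzero coefficient, and $r=\inf_tr(t)$ is the Hermite rank; it is assumed that $0<d<1/r$. Then $\{t_i\}$ is called long range dependent subordinated Gaussian with parameters $d$ and $r$. *)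

theory Defs
  imports "HOL-Probability.Probability"
begin

section \<open>Greatest convex minorant and its right-hand slope\<close>

text \<open>The supremum is taken in the reals, so the value is meaningful only for \<open>t \<in> S\<close> and
  only if \<open>x\<close> has at least one convex minorant on \<open>S\<close>.\<close>

definition gcm :: "real set \<Rightarrow> (real \<Rightarrow> real) \<Rightarrow> real \<Rightarrow> real" where
  "gcm S x t = (SUP z \<in> {z. convex_on S z \<and> (\<forall>s\<in>S. z s \<le> x s)}. z t)"

definition right_deriv :: "(real \<Rightarrow> real) \<Rightarrow> real \<Rightarrow> real" where
  "right_deriv x t = Lim (at_right t) (\<lambda>s. (x s - x t) / (s - t))"


section \<open>Slow variation at infinity\<close>

definition slowly_varying :: "(real \<Rightarrow> real) \<Rightarrow> bool" where
  "slowly_varying l \<longleftrightarrow>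
     (\<exists>a. l \<in> borel_measurable (restrict_space borel {a..}) \<and> (\<forall>x\<ge>a. l x > 0)) \<and>
     (\<forall>c>0. ((\<lambda>x. l (c * x) / l x) \<longlongrightarrow> 1) at_top)"


section \<open>Stationary Gaussian processes\<close>

text \<open>Degenerate (almost surely constant) variables count as Gaussian.\<close>

definition gaussian_rv :: "'a measure \<Rightarrow> ('a \<Rightarrow> real) \<Rightarrow> bool" where
  "gaussian_rv M X \<longleftrightarrow> X \<in> borel_measurable M \<and>
     (\<exists>\<mu>. (AE \<omega> in M. X \<omega> = \<mu>) \<or> (\<exists>\<sigma>>0. distributed M lborel X (normal_density \<mu> \<sigma>)))"

definition gaussian_process :: "'a measure \<Rightarrow> nat set \<Rightarrow> (nat \<Rightarrow> 'a \<Rightarrow> real) \<Rightarrow> bool" where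
  "gaussian_process M I X \<longleftrightarrow>
     (\<forall>J c. finite J \<and> J \<subseteq> I \<longrightarrow> gaussian_rv M (\<lambda>\<omega>. \<Sum>j\<in>J. c j * X j \<omega>))"

text \<open>Strict stationarity of a sequence indexed by \<open>i \<ge> 1\<close>.\<close>

definition stationary :: "'a measure \<Rightarrow> (nat \<Rightarrow> 'a \<Rightarrow> real) \<Rightarrow> bool" where
  "stationary M X \<longleftrightarrow> (\<forall>i\<ge>1. X i \<in> borel_measurable M) \<and>
     (\<forall>J k. finite J \<and> J \<subseteq> {1..} \<longrightarrow>
        distr M (\<Pi>\<^sub>M j\<in>J. borel) (\<lambda>\<omega>. \<lambda>j\<in>J. X (j + k) \<omega>) =
        distr M (\<Pi>\<^sub>M j\<in>J. borel) (\<lambda>\<omega>. \<lambda>j\<in>J. X j \<omega>))"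


section \<open>Hermite rank\<close>

text \<open>Probabilists' Hermite polynomials: monic, orthogonal under the standard normal law, with
  \<open>E (h\<^sub>k(N)\<^sup>2) = k!\<close>.\<close>

fun hermite :: "nat \<Rightarrow> real \<Rightarrow> real" where
  "hermite 0 x = 1"
| "hermite (Suc 0) x = x"
| "hermite (Suc (Suc k)) x = x * hermite (Suc k) x - real (Suc k) * hermite k x"

text \<open>Below, \<open>Z\<close> is the underlying Gaussian variable and \<open>g(Z)\<close> the subordinated one.\<close>

definition hermite_coeff ::
  "'a measure \<Rightarrow> ('a \<Rightarrow> real) \<Rightarrow> (real \<Rightarrow> real) \<Rightarrow> nat \<Rightarrow> real \<Rightarrow> real" where
  "hermite_coeff M Z g k t =
     (LINT \<omega>|M. (indicator {..t} (g (Z \<omega>)) - cdf (distr M borel (\<lambda>\<omega>. g (Z \<omega>))) t)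
                 * hermite k (Z \<omega>))"

text \<open>The index of the first non-zero coefficient at level \<open>t\<close> is \<open>\<infinity>\<close> if all of them vanish,
  which happens when the distribution function takes the value 0 or 1 at \<open>t\<close>.\<close>

definition hermite_rank_at ::
  "'a measure \<Rightarrow> ('a \<Rightarrow> real) \<Rightarrow> (real \<Rightarrow> real) \<Rightarrow> real \<Rightarrow> enat" where
  "hermite_rank_at M Z g t = (INF k \<in> {k. hermite_coeff M Z g k t \<noteq> 0}. enat k)"

definition hermite_rank :: "'a measure \<Rightarrow> ('a \<Rightarrow> real) \<Rightarrow> (real \<Rightarrow> real) \<Rightarrow> enat" where
  "hermite_rank M Z g = (INF t. hermite_rank_at M Z g t)"


section \<open>Long range dependent subordinated Gaussian sequences\<close>

text \<open>All sequences are indexed by \<open>i \<ge> 1\<close>; \<open>\<xi> 0\<close> is irrelevant. Since \<open>1 / 0 = 0\<close>, the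
  condition \<open>d < 1 / r\<close> also excludes \<open>r = 0\<close>.\<close>

definition lrd_subordinated_gaussian ::
  "'a measure \<Rightarrow> (nat \<Rightarrow> 'a \<Rightarrow> real) \<Rightarrow> (real \<Rightarrow> real) \<Rightarrow> (nat \<Rightarrow> 'a \<Rightarrow> real) \<Rightarrow>
   (real \<Rightarrow> real) \<Rightarrow> real \<Rightarrow> nat \<Rightarrow> bool" where
  "lrd_subordinated_gaussian M \<xi> g X l\<^sub>0 d r \<longleftrightarrow>
     prob_space M \<and>
     stationary M \<xi> \<and> gaussian_process M {1..} \<xi> \<and>
     (\<forall>i\<ge>1. prob_space.expectation M (\<xi> i) = 0 \<and> prob_space.variance M (\<xi> i) = 1) \<and>
     (\<forall>i\<ge>1. \<forall>k\<ge>1. prob_space.expectation M (\<lambda>\<omega>. \<xi> i \<omega> * \<xi> (i + k) \<omega>)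
                      = real k powr (- d) * l\<^sub>0 (real k)) \<and>
     slowly_varying l\<^sub>0 \<and> 0 < d \<and> d < 1 \<and>
     g \<in> borel_measurable borel \<and> (\<forall>i\<ge>1. X i = (\<lambda>\<omega>. g (\<xi> i \<omega>))) \<and>
     hermite_rank M (\<xi> 1) g = enat r \<and> d < 1 / real r"


section \<open>The density estimator\<close>

definition empirical_cdf :: "(nat \<Rightarrow> 'a \<Rightarrow> real) \<Rightarrow> nat \<Rightarrow> 'a \<Rightarrow> real \<Rightarrow> real" where
  "empirical_cdf X n \<omega> t = (\<Sum>i=1..n. indicator {..t} (X i \<omega>)) / real n"

definition density_estimator :: "(nat \<Rightarrow> 'a \<Rightarrow> real) \<Rightarrow> nat \<Rightarrow> real \<Rightarrow> 'a \<Rightarrow> real" where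
  "density_estimator X n t \<omega> = right_deriv (gcm {..0} (empirical_cdf X n \<omega>)) t"

end

theory Submission
  imports Defs
begin

text \<open>Write \<open>F\<^sub>n = F + \<eta>\<^sub>1 \<cdot> m\<^sub>n + R\<^sub>n\<close>, where \<open>m\<^sub>n\<close> is the mean of \<open>\<xi>\<^sub>1, \<dots>, \<xi>\<^sub>n\<close>. By Karamata's theorem the
  variance of \<open>m\<^sub>n\<close> is asymptotic to \<open>l\<^sub>1(n) n\<^sup>-\<^sup>d =: B\<^sub>n\<close>. The summands of an increment of \<open>R\<^sub>n\<close> are functions of
  the \<open>\<xi>\<^sub>i\<close> orthogonal to \<open>1\<close> and \<open>x\<close>, so their covariances are of order \<open>\<rho>\<^sup>2\<close>, and dyadic chaining makes
  \<open>R\<^sub>n(t) - R\<^sub>n(t\<^sub>0)\<close> smaller than \<open>c (t - t\<^sub>0)\<^sup>2 + \<epsilon> B\<^sub>n\<close> uniformly in \<open>t\<close>, with high probability. The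
  curvature \<open>f'(t\<^sub>0) > 0\<close> of \<open>F\<close> absorbs the quadratic term, so a slightly lowered line of slope
  \<open>f(t\<^sub>0) + \<eta>\<^sub>1'(t\<^sub>0) m\<^sub>n\<close> is a minorant of \<open>F\<^sub>n\<close>. Comparing it with \<open>F\<^sub>n\<close> at the points \<open>t\<^sub>0 \<plusminus> \<delta>\<close>, where \<open>\<delta>\<close> is a small
  multiple of \<open>\<surd>B\<^sub>n\<close>, shows that the estimation error is \<open>\<eta>\<^sub>1'(t\<^sub>0) m\<^sub>n + o(\<surd>B\<^sub>n)\<close>, and \<open>m\<^sub>n\<close> is exactly Gaussian.\<close>

section \<open>Convex minorants\<close>

text \<open>Slopes read off at distance \<delta> divide every error in the distribution function by
  \<delta>. With \<delta> of order sqrt(B n), the remainder must therefore be controlled at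
  precision \<open>B n\<close>, not sqrt(B n). This is exactly critical: the part of Hermite order 2
  has variance of order n^(-2d) up to slowly varying factors, the same as (B n)^2, so a variance
  bound over a fixed interval does not suffice. The missing power comes from locality: the second
  moment of an increment of the remainder carries the factor \<open>F t - F s\<close>, so a window
  shrinking like a small power of n gains that power, which pays for the logarithms of the chaining
  and for the slowly varying factors. Away from the point the required precision relaxes to the
  squared distance. The condition d < 1/2 keeps the double sum of squared covariances within
  n^(2-2d) up to small powers. Since the sample mean is exactly Gaussian, only its variance has to
  converge. The half-line is unbounded, but a line of slope at least half the density value is
  negative far to the left, where the empirical distribution function is non-negative.\<close>

lemma gcm_upper:
  assumes "convex_on S z" "\<And>s. s \<in> S \<Longrightarrow> z s \<le> x s" "t \<in> S"
  shows "z t \<le> gcm S x t"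
  unfolding gcm_def using assms by (intro cSUP_upper bdd_aboveI2[where M="x t"]) auto

lemma gcm_least:
  assumes "convex_on S z" "\<And>s. s \<in> S \<Longrightarrow> z s \<le> x s"
    and "\<And>w. convex_on S w \<Longrightarrow> (\<And>s. s \<in> S \<Longrightarrow> w s \<le> x s) \<Longrightarrow> w t \<le> B"
  shows "gcm S x t \<le> B"
  unfolding gcm_def using assms by (intro cSUP_least) auto

lemma gcm_le:
  assumes "convex_on S z" "\<And>s. s \<in> S \<Longrightarrow> z s \<le> x s" "t \<in> S"
  shows "gcm S x t \<le> x t"
  using assms by (intro gcm_least[OF assms(1,2)]) auto

lemma convex_on_gcm:
  assumes "convex_on S z" "\<And>s. s \<in> S \<Longrightarrow> z s \<le> x s"
  shows "convex_on S (gcm S x)"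
proof (rule convex_onI)
  show "convex S" using assms(1) by (rule convex_on_imp_convex)
  fix \<alpha> :: real and u v assume \<alpha>: "0 < \<alpha>" "\<alpha> < 1" and uv: "u \<in> S" "v \<in> S"
  show "gcm S x ((1 - \<alpha>) *\<^sub>R u + \<alpha> *\<^sub>R v) \<le> (1 - \<alpha>) * gcm S x u + \<alpha> * gcm S x v"
  proof (rule gcm_least[OF assms])
    fix w assume w: "convex_on S w" "\<And>s. s \<in> S \<Longrightarrow> w s \<le> x s"
    have "w ((1 - \<alpha>) *\<^sub>R u + \<alpha> *\<^sub>R v) \<le> (1 - \<alpha>) * w u + \<alpha> * w v"
      using convex_onD[OF w(1)] \<alpha> uv by auto
    also have "\<dots> \<le> (1 - \<alpha>) * gcm S x u + \<alpha> * gcm S x v"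
      using gcm_upper[OF w] uv \<alpha> by (intro add_mono mult_left_mono) auto
    finally show "w ((1 - \<alpha>) *\<^sub>R u + \<alpha> *\<^sub>R v) \<le> (1 - \<alpha>) * gcm S x u + \<alpha> * gcm S x v" .
  qed
qed

lemma convex_on_slope_mono:
  fixes G :: "real \<Rightarrow> real"
  assumes "convex_on S G" "s \<in> S" "t \<in> S" "u \<in> S" "s < t" "t < u"
  shows "(G t - G s) / (t - s) \<le> (G u - G t) / (u - t)"
    and "(G t - G s) / (t - s) \<le> (G u - G s) / (u - s)"
    and "(G u - G s) / (u - s) \<le> (G u - G t) / (u - t)"
proof -
  define \<alpha> where "\<alpha> = (t - s) / (u - s)"
  have \<alpha>: "0 < \<alpha>" "\<alpha> < 1" using assms by (auto simp: \<alpha>_def field_simps)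
  have "(1 - \<alpha>) * s + \<alpha> * u = s + \<alpha> * (u - s)" by (simp add: algebra_simps)
  also have "\<dots> = t" using assms by (simp add: \<alpha>_def)
  finally have t: "(1 - \<alpha>) *\<^sub>R s + \<alpha> *\<^sub>R u = t" by simp
  have "G t \<le> (1 - \<alpha>) * G s + \<alpha> * G u"
    using convex_onD[OF assms(1), of \<alpha> s u] \<alpha> assms t by auto
  then have "G t - G s \<le> (t - s) / (u - s) * (G u - G s)"
    by (simp add: \<alpha>_def[symmetric] algebra_simps)
  then have *: "(G t - G s) * (u - s) \<le> (t - s) * (G u - G s)"
    using assms by (simp add: field_simps)
  show "(G t - G s) / (t - s) \<le> (G u - G s) / (u - s)"
       "(G t - G s) / (t - s) \<le> (G u - G t) / (u - t)"
       "(G u - G s) / (u - s) \<le> (G u - G t) / (u - t)"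
    using * assms by (auto simp: divide_le_eq le_divide_eq frac_le_eq field_simps)
qed

text \<open>\<open>right_deriv\<close> is a \<open>Lim\<close> and says nothing unless the limit
  exists. For a convex function the difference quotients decrease as the right end approaches
  \<open>t\<close>, so at an interior point they tend to their infimum; points of \<open>S\<close>
  to the left of \<open>t\<close> supply the lower bound that keeps the infimum finite.\<close>

lemma right_deriv_convex:
  fixes G :: "real \<Rightarrow> real"
  assumes G: "convex_on S G" and t: "t \<in> interior S"
  shows tendsto_right_deriv_convex:
      "((\<lambda>s. (G s - G t) / (s - t)) \<longlongrightarrow> right_deriv G t) (at_right t)"
    and right_deriv_convex_le: "\<And>u. u \<in> S \<Longrightarrow> t < u \<Longrightarrow> right_deriv G t \<le> (G u - G t) / (u - t)"
    and right_deriv_convex_ge: "\<And>s. s \<in> S \<Longrightarrow> s < t \<Longrightarrow> (G t - G s) / (t - s) \<le> right_deriv G t"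
proof -
  let ?q = "\<lambda>s. (G s - G t) / (s - t)"
  have tS: "t \<in> S" using t interior_subset by auto
  obtain e where e: "e > 0" "cball t e \<subseteq> S"
    using t by (auto simp: mem_interior_cball)
  have inS: "s \<in> S" if "\<bar>s - t\<bar> \<le> e" for s
    using e that by (auto simp: subset_eq dist_real_def abs_minus_commute)
  define L where "L = Inf (?q ` {t<..t+e})"
  have lower: "(G t - G s) / (t - s) \<le> ?q u" if "s \<in> S" "s < t" "u \<in> S" "t < u" for s u
    using convex_on_slope_mono(1)[OF G that(1) tS that(3)] that by auto
  have bdd: "bdd_below (?q ` {t<..t+e})"
    using lower[of "t-e"] inS e by (intro bdd_belowI2[where m="(G t - G (t-e)) / (t - (t - e))"]) auto
  have le: "L \<le> ?q u" if "u \<in> S" "t < u" for u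
  proof -
    \<comment> \<open>\<open>L\<close> is an infimum over \<open>{t<..t+e}\<close> only; a farther
      \<open>u\<close> is compared through the shorter chord ending at \<open>v\<close>.\<close>
    define v where "v = min u (t+e)"
    have v: "v \<in> S" "t < v" "v \<le> u" "v \<le> t+e"
      using that e inS[of "t+e"] by (auto simp: v_def min_def)
    have "L \<le> ?q v" unfolding L_def using v bdd by (intro cINF_lower) auto
    also have "\<dots> \<le> ?q u"
      using convex_on_slope_mono(2)[OF G tS v(1) that(1)] v by (cases "v = u") auto
    finally show ?thesis .
  qed
  have lim: "(?q \<longlongrightarrow> L) (at_right t)"
  proof (rule order_tendstoI)
    fix a assume "a < L"
    moreover have "eventually (\<lambda>u. u \<in> {t<..<t+e}) (at_right t)"
      using e by (intro eventually_at_rightI[of _ "t+e"]) auto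
    ultimately show "\<forall>\<^sub>F u in at_right t. a < ?q u"
      using le inS by (auto elim!: eventually_mono simp: less_le_trans)
  next
    fix a assume "L < a"
    then obtain u where u: "t < u" "u \<le> t+e" "?q u < a"
      unfolding L_def using cINF_less_iff[OF _ bdd, of a] e by auto
    have uS: "u \<in> S" using u inS by auto
    have "eventually (\<lambda>v. v \<in> {t<..<u}) (at_right t)"
      using u by (intro eventually_at_rightI[of _ "u"]) auto
    then show "\<forall>\<^sub>F v in at_right t. ?q v < a"
    proof eventually_elim
      case (elim v)
      have "?q v \<le> ?q u"
        using elim convex_on_slope_mono(2)[OF G tS _ uS, of v] inS[of v] u by auto
      then show ?case using u by simp
    qed
  qed
  then have L: "right_deriv G t = L"
    unfolding right_deriv_def by (intro tendsto_Lim) auto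
  show "(?q \<longlongrightarrow> right_deriv G t) (at_right t)" using lim L by simp
  show "\<And>u. u \<in> S \<Longrightarrow> t < u \<Longrightarrow> right_deriv G t \<le> ?q u" using le L by simp
  show "\<And>s. s \<in> S \<Longrightarrow> s < t \<Longrightarrow> (G t - G s) / (t - s) \<le> right_deriv G t"
    unfolding L L_def using lower inS e by (intro cINF_greatest) auto
qed

text \<open>A line below \<open>x\<close> is itself a convex minorant, so it bounds the greatest one
  from below at \<open>t\<close>, while \<open>x\<close> bounds it from above at
  \<open>t + \<delta>\<close> and \<open>t - \<delta>\<close>. Convexity turns these pointwise facts
  into slope bounds. All later estimates of the density estimator pass through these two
  inequalities.\<close>

lemma right_deriv_gcm_bounds:
  fixes x :: "real \<Rightarrow> real"
  assumes line: "\<And>u. u \<le> 0 \<Longrightarrow> A + s * (u - t) \<le> x u"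
    and t: "t < 0" and \<delta>: "0 < \<delta>" "t + \<delta> \<le> 0"
  shows "right_deriv (gcm {..0} x) t \<le> (x (t + \<delta>) - A) / \<delta>"
    and "(A - x (t - \<delta>)) / \<delta> \<le> right_deriv (gcm {..0} x) t"
proof -
  let ?G = "gcm {..0} x"
  have c: "convex_on {..0} (\<lambda>u. A + s * (u - t))"
    by (rule convex_on_linorderI) (auto simp: algebra_simps)
  have G: "convex_on {..0} ?G" by (rule convex_on_gcm[OF c]) (auto simp: line)
  have up: "?G u \<le> x u" if "u \<le> 0" for u by (rule gcm_le[OF c]) (auto simp: line that)
  have lo: "A \<le> ?G t" using gcm_upper[OF c, of x t] line t by auto
  have int: "t \<in> interior {..0}" using t by simp
  have "right_deriv ?G t \<le> (?G (t + \<delta>) - ?G t) / (t + \<delta> - t)"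
    using \<delta> by (intro right_deriv_convex_le[OF G int]) auto
  also have "\<dots> \<le> (x (t + \<delta>) - A) / \<delta>"
    using up[of "t+\<delta>"] lo \<delta> by (auto intro!: divide_right_mono)
  finally show "right_deriv ?G t \<le> (x (t + \<delta>) - A) / \<delta>" .
  have "(A - x (t - \<delta>)) / \<delta> \<le> (?G t - ?G (t - \<delta>)) / (t - (t - \<delta>))"
    using up[of "t-\<delta>"] lo \<delta> by (auto intro!: divide_right_mono)
  also have "\<dots> \<le> right_deriv ?G t"
    using \<delta> by (intro right_deriv_convex_ge[OF G int]) auto
  finally show "(A - x (t - \<delta>)) / \<delta> \<le> right_deriv ?G t" .
qed

section \<open>Measurability of the density estimator\<close>

text \<open>The supremum over all convex minorants is uncountable, which hides measurability in the
  sample point. A convex minorant lies above its own supporting line at \<open>s\<close>, so lines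
  suffice, and the best line of slope \<open>a\<close> below \<open>x\<close> has the inner infimum
  as its value at \<open>s\<close>. Rational points suffice by right continuity, and rational slopes
  because raising a slope slightly costs little to the right of \<open>s\<close>.\<close>

lemma gcm_eq_SUP_INF:
  fixes x :: "real \<Rightarrow> real"
  assumes x: "\<And>u. u \<le> 0 \<Longrightarrow> 0 \<le> x u" "\<And>u. u \<le> 0 \<Longrightarrow> x u \<le> 1"
    and rc: "\<And>u. u < 0 \<Longrightarrow> continuous (at_right u) x"
    and s: "s < 0"
  shows "gcm {..0} x s = (SUP a\<in>\<rat>\<inter>{0..}. INF u\<in>\<rat>\<inter>{..0}. x u - a * (u - s))"
proof -
  let ?I = "\<lambda>a. INF u\<in>\<rat>\<inter>{..0}. x u - a * (u - s)"
  have c: "convex_on {..0} (\<lambda>u::real. A + a * (u - s))" for A a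
    by (rule convex_on_linorderI) (auto simp: algebra_simps)
  have bdd: "bdd_below ((\<lambda>u. x u - a * (u - s)) ` (\<rat>\<inter>{..0}))" if "a \<ge> 0" for a
  proof (rule bdd_belowI2)
    fix u :: real assume "u \<in> \<rat> \<inter> {..0}"
    then have "a * u \<le> 0" "0 \<le> x u" using that x by (auto simp: mult_le_0_iff)
    then show "a * s \<le> x u - a * (u - s)" by (simp add: algebra_simps)
  qed
  have Ile: "?I a \<le> x u - a * (u - s)" if a: "a \<ge> 0" and u: "u \<le> 0" for a u
  \<comment> \<open>The end point 0 is rational and is covered directly; any \<open>u < 0\<close> is
    approached by rationals in \<open>(u, 0)\<close>, using right continuity.\<close>
  proof (cases "u = 0")
    case True
    then show ?thesis by (intro cINF_lower bdd a) auto
  next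
    case False
    with u have u: "u < 0" by simp
    have "((\<lambda>v. x v - a * (v - s)) \<longlongrightarrow> x u - a * (u - s)) (at_right u)"
      using rc[OF u] by (auto intro!: tendsto_intros simp: continuous_within)
    show ?thesis
    proof (rule ccontr)
      assume "\<not> ?thesis"
      then have "\<forall>\<^sub>F v in at_right u. x v - a * (v - s) < ?I a"
        using \<open>(_ \<longlongrightarrow> _) (at_right u)\<close> by (intro order_tendstoD) auto
      then obtain b where b: "b > u" "\<And>v. u < v \<Longrightarrow> v < b \<Longrightarrow> x v - a * (v - s) < ?I a"
        by (auto simp: eventually_at_right_field)
      obtain q where q: "q \<in> \<rat>" "u < q" "q < min b 0"
        using Rats_dense_in_real[of u "min b 0"] b u by auto
      have "?I a \<le> x q - a * (q - s)" using q by (intro cINF_lower bdd a) auto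
      with b(2)[of q] q show False by auto
    qed
  qed
  have ne: "(0::real) \<in> \<rat>\<inter>{..0}" "(0::real) \<in> \<rat> \<inter> {0..}" by auto
  have bdd2: "bdd_above (?I ` (\<rat>\<inter>{0..}))"
    using Ile[of _ s] s by (intro bdd_aboveI2[where M="x s"]) auto
  show ?thesis
  proof (rule antisym)
    show "(SUP a\<in>\<rat>\<inter>{0..}. ?I a) \<le> gcm {..0} x s"
    proof (rule cSUP_least)
      fix a :: real assume a: "a \<in> \<rat> \<inter> {0..}"
      have "?I a + a * (s - s) \<le> gcm {..0} x s"
        using Ile[of a] a s by (intro gcm_upper[OF c[of "?I a" a]]) (auto simp: algebra_simps)
      then show "?I a \<le> gcm {..0} x s" by simp
    qed (use ne in blast)
    show "gcm {..0} x s \<le> (SUP a\<in>\<rat>\<inter>{0..}. ?I a)"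
    proof (rule gcm_least[OF c[of 0 0]])
      fix w assume w: "convex_on {..0} w" "\<And>u. u \<in> {..0} \<Longrightarrow> w u \<le> x u"
      define a where "a = right_deriv w s"
      have int: "s \<in> interior {..0}" using s by simp
      have sup: "w s + a * (u - s) \<le> x u" if u: "u \<le> 0" for u
      proof -
        consider "u = s" | "u < s" | "s < u" by linarith
        then have "w s + a * (u - s) \<le> w u"
        proof cases
          case 2
          then have "(w s - w u) / (s - u) \<le> a"
            unfolding a_def using u s by (intro right_deriv_convex_ge[OF w(1) int]) auto
          with 2 show ?thesis by (simp add: field_simps)
        next
          case 3
          then have "a \<le> (w u - w s) / (u - s)"
            unfolding a_def using u s by (intro right_deriv_convex_le[OF w(1) int]) auto
          with 3 show ?thesis by (simp add: field_simps)
        qed auto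
        with w(2)[of u] u show ?thesis by auto
      qed
      have a0: "a \<ge> 0"
      proof (rule ccontr)
        assume "\<not> a \<ge> 0"
        \<comment> \<open>At this point, to the left of \<open>s\<close> when the slope is negative,
          the line takes the value \<open>w s + 2 + \<bar>w s\<bar>\<close>, at least 2, against the
          bound 1 for \<open>x\<close>.\<close>
        define u where "u = s + (2 + \<bar>w s\<bar>) / a"
        have "u \<le> 0" using s \<open>\<not> a \<ge> 0\<close> unfolding u_def
          by (intro add_nonpos_nonpos divide_nonneg_nonpos) auto
        then have "w s + a * (u - s) \<le> 1" using sup[of u] x(2)[of u] by auto
        moreover have "a * (u - s) = 2 + \<bar>w s\<bar>" using \<open>\<not> a \<ge> 0\<close> by (simp add: u_def)
        ultimately show False by auto
      qed
      show "w s \<le> (SUP a\<in>\<rat>\<inter>{0..}. ?I a)"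
      proof (rule field_le_epsilon)
        fix e :: real assume e: "e > 0"
        \<comment> \<open>The slope is raised, never lowered: on \<open>u \<le> 0\<close> the line
          then rises by at most \<open>(q - a) * (- s)\<close>, whereas a smaller slope would lift
          it without bound as \<open>u\<close> goes to minus infinity.\<close>
        obtain q where q: "q \<in> \<rat>" "a < q" "q < a + e / (-s)"
          using Rats_dense_in_real[of a "a + e / (-s)"] e s by (auto simp: divide_pos_neg)
        have qe: "(q - a) * (- s) < e" using q s by (simp add: field_simps)
        have "w s - e \<le> ?I q"
        proof (rule cINF_greatest)
          fix u :: real assume u: "u \<in> \<rat>\<inter>{..0}"
          have "(q - a) * (u - s) \<le> (q - a) * (- s)"
            using u q by (intro mult_left_mono) auto
          then have "(q - a) * (u - s) \<le> e" using qe by linarith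
          with sup[of u] u show "w s - e \<le> x u - q * (u - s)" by (auto simp: algebra_simps)
        qed (use ne in blast)
        also have "\<dots> \<le> (SUP a\<in>\<rat>\<inter>{0..}. ?I a)"
          using q a0 by (intro cSUP_upper bdd2) auto
        finally show "w s \<le> (SUP a\<in>\<rat>\<inter>{0..}. ?I a) + e" by simp
      qed
    qed (auto simp: x)
  qed
qed

lemma empirical_cdf_nonneg: "0 \<le> empirical_cdf X n \<omega> t"
  by (auto simp: empirical_cdf_def intro!: divide_nonneg_nonneg sum_nonneg)

lemma empirical_cdf_le_1: "empirical_cdf X n \<omega> t \<le> 1"
proof -
  have "(\<Sum>i=1..n. indicator {..t} (X i \<omega>)) \<le> (\<Sum>i=1..n. 1 :: real)"
    by (intro sum_mono) (auto simp: indicator_def)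
  then show ?thesis by (cases "n = 0") (auto simp: empirical_cdf_def field_simps)
qed

lemma empirical_cdf_mono: "s \<le> t \<Longrightarrow> empirical_cdf X n \<omega> s \<le> empirical_cdf X n \<omega> t"
  unfolding empirical_cdf_def
  by (intro divide_right_mono sum_mono) (auto simp: indicator_def)

lemma empirical_cdf_right_continuous: "continuous (at_right u) (empirical_cdf X n \<omega>)"
proof -
  have "((\<lambda>t. indicator {..t} y :: real) \<longlongrightarrow> indicator {..u} y) (at_right u)" for y :: real
  proof (rule tendsto_eventually, cases "y \<le> u")
    case True
    have "\<forall>\<^sub>F t in at_right u. t \<in> {u<..<u+1}"
      by (intro eventually_at_rightI[of _ "u+1"]) auto
    then show "\<forall>\<^sub>F t in at_right u. (indicator {..t} y :: real) = indicator {..u} y"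
      by eventually_elim (use True in \<open>auto simp: indicator_def\<close>)
  next
    case False
    have "\<forall>\<^sub>F t in at_right u. t \<in> {u<..<y}"
      using False by (intro eventually_at_rightI[of _ y]) auto
    then show "\<forall>\<^sub>F t in at_right u. (indicator {..t} y :: real) = indicator {..u} y"
      by eventually_elim (use False in \<open>auto simp: indicator_def\<close>)
  qed
  then show ?thesis
    unfolding continuous_within empirical_cdf_def divide_inverse
    by (intro tendsto_intros)
qed

lemma borel_measurable_empirical_cdf:
  assumes X: "\<And>i. 1 \<le> i \<Longrightarrow> X i \<in> borel_measurable M"
  shows "(\<lambda>\<omega>. empirical_cdf X n \<omega> u) \<in> borel_measurable M"
  unfolding empirical_cdf_def
  by (intro borel_measurable_divide borel_measurable_sum borel_measurable_const)
     (auto intro!: measurable_compose[OF X] simp: indicator_def)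

text \<open>Convergence in distribution refers to \<open>distr M borel\<close> of the estimator,
  which is informative only for a measurable map. The right derivative is a pointwise limit of
  difference quotients along a fixed sequence, and each value of the minorant in them is a countable
  supremum of countable infima.\<close>

lemma borel_measurable_density_estimator:
  assumes X: "\<And>i. 1 \<le> i \<Longrightarrow> X i \<in> borel_measurable M" and t: "t < 0"
  shows "density_estimator X n t \<in> borel_measurable M"
proof -
  let ?G = "\<lambda>\<omega>. gcm {..0} (empirical_cdf X n \<omega>)"
  have [measurable]: "(\<lambda>\<omega>. empirical_cdf X n \<omega> u) \<in> borel_measurable M" for u
    by (rule borel_measurable_empirical_cdf[OF X])
  have G: "(\<lambda>\<omega>. ?G \<omega> s) \<in> borel_measurable M" if s: "s < 0" for s
  proof -
    have eq: "?G \<omega> s = (SUP a\<in>\<rat>\<inter>{0..}. INF u\<in>\<rat>\<inter>{..0}. empirical_cdf X n \<omega> u - a * (u - s))" for \<omega>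
      by (intro gcm_eq_SUP_INF empirical_cdf_nonneg empirical_cdf_le_1
          empirical_cdf_right_continuous s)
    have cnt: "countable (\<rat> \<inter> A :: real set)" for A
      by (intro countable_subset[OF _ countable_rat]) auto
    have bb: "bdd_below ((\<lambda>u. empirical_cdf X n \<omega> u - a * (u - s)) ` (\<rat>\<inter>{..0}))"
      if "a \<ge> 0" for a \<omega>
    proof (rule bdd_belowI2)
      fix u :: real assume "u \<in> \<rat> \<inter> {..0}"
      then have "a * u \<le> 0" "0 \<le> empirical_cdf X n \<omega> u"
        using that by (auto simp: mult_le_0_iff empirical_cdf_nonneg)
      then show "a * s \<le> empirical_cdf X n \<omega> u - a * (u - s)" by (simp add: algebra_simps)
    qed
    have up: "(INF u\<in>\<rat>\<inter>{..0}. empirical_cdf X n \<omega> u - a * (u - s)) \<le> 1 + a * s" 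
      if "a \<ge> 0" for a \<omega>
      using cINF_lower[OF bb[OF that, of \<omega>], of 0] empirical_cdf_le_1[of X n \<omega> 0] by auto
    have as: "a * s \<le> 0" if "a \<ge> 0" for a using that s by (simp add: mult_le_0_iff)
    show ?thesis unfolding eq
    proof (rule borel_measurable_cSUP[OF cnt])
      fix \<omega> assume "\<omega> \<in> space M"
      show "bdd_above ((\<lambda>a. INF u\<in>\<rat>\<inter>{..0}. empirical_cdf X n \<omega> u - a * (u - s)) ` (\<rat>\<inter>{0..}))"
      proof (rule bdd_aboveI2)
        fix a :: real assume "a \<in> \<rat>\<inter>{0..}"
        then show "(INF u\<in>\<rat>\<inter>{..0}. empirical_cdf X n \<omega> u - a * (u - s)) \<le> 1"
          using up[of a \<omega>] as[of a] by auto
      qed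
    next
      fix a :: real assume a: "a \<in> \<rat>\<inter>{0..}"
      show "(\<lambda>\<omega>. INF u\<in>\<rat>\<inter>{..0}. empirical_cdf X n \<omega> u - a * (u - s)) \<in> borel_measurable M"
        by (rule borel_measurable_cINF[OF cnt]) (use a bb in auto)
    qed
  qed
  \<comment> \<open>\<open>Suc (Suc k)\<close> keeps \<open>t + h k\<close> strictly negative even
    at \<open>k = 0\<close>, as the countable formula for the minorant requires.\<close>
  define h where "h k = - t / real (Suc (Suc k))" for k
  have h: "h k > 0" "t + h k < 0" for k
    using t by (auto simp: h_def field_simps intro!: add_neg_nonpos mult_nonpos_nonneg)
  have hl: "filterlim (\<lambda>k. t + h k) (at_right t) sequentially"
  proof (rule tendsto_imp_filterlim_at_right)
    have "(\<lambda>k. t + (-t) * inverse (real (Suc (Suc k)))) \<longlonglongrightarrow> t + (-t) * 0"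
      by (intro tendsto_intros LIMSEQ_Suc[OF LIMSEQ_inverse_real_of_nat])
    then show "(\<lambda>k. t + h k) \<longlonglongrightarrow> t" by (simp add: h_def divide_inverse)
  qed (use h in auto)
  show ?thesis
  proof (rule borel_measurable_LIMSEQ_real)
    fix \<omega>
    have c: "convex_on {..0} (\<lambda>u::real. 0::real)" by (auto simp: convex_on_const)
    have Gc: "convex_on {..0} (?G \<omega>)"
      by (rule convex_on_gcm[OF c]) (auto simp: empirical_cdf_nonneg)
    show "(\<lambda>k. (?G \<omega> (t + h k) - ?G \<omega> t) / (t + h k - t)) \<longlonglongrightarrow> density_estimator X n t \<omega>"
      unfolding density_estimator_def
      using t by (intro filterlim_compose[OF tendsto_right_deriv_convex[OF Gc] hl]) auto
  qed (use G h t in auto)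
qed


section \<open>Slowly varying functions\<close>

text \<open>Uniform convergence theorem for slowly varying functions, in additive form. Pointwise
  convergence and measurability send the measure of the bad set \<open>B x\<close> to 0 by dominated
  convergence; the points \<open>x\<close> and \<open>x + u\<close> are then linked through a common
  point \<open>x + v\<close> that is good for both.\<close>

lemma slowly_varying_uniform_unit:
  fixes h :: "real \<Rightarrow> real"
  assumes [measurable]: "h \<in> borel_measurable borel"
    and lim: "\<And>u. ((\<lambda>x. h (x + u) - h x) \<longlongrightarrow> 0) at_top"
    and e: "e > 0"
  shows "\<exists>x0. \<forall>x\<ge>x0. \<forall>u\<in>{0..1}. \<bar>h (x + u) - h x\<bar> \<le> e"
proof -
  \<comment> \<open>The range \<open>{0..3}\<close> contains both \<open>v\<close> and
    \<open>v - u\<close> for \<open>v\<close> in \<open>{1..3}\<close> and \<open>u\<close> in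
    \<open>{0..1}\<close>; the tolerance is halved because two increments are added.\<close>
  define B where "B x = {u\<in>{0..3}. e/2 \<le> \<bar>h (x + u) - h x\<bar>}" for x
  have Bm[measurable]: "B x \<in> sets borel" for x unfolding B_def by measurable
  have Bl: "B x \<in> lmeasurable" for x
  proof (rule bounded_set_imp_lmeasurable)
    show "bounded (B x)" by (rule bounded_subset[of "{0..3}"]) (auto simp: B_def)
    show "B x \<in> sets lebesgue" using Bm[of x] by simp
  qed
  have "((\<lambda>x. integral\<^sup>L lborel (\<lambda>u. indicator (B x) u :: real)) \<longlongrightarrow> integral\<^sup>L (lborel :: real measure) (\<lambda>u. 0 :: real)) at_top"
  proof (rule integral_dominated_convergence_at_top[where w="indicator {0..3}"])
    show "AE u in lborel. ((\<lambda>x. indicator (B x) u :: real) \<longlongrightarrow> 0) at_top"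
    proof (rule AE_I2)
      fix u :: real
      have "\<forall>\<^sub>F x in at_top. \<bar>h (x + u) - h x\<bar> < e/2"
        using tendstoD[OF lim[of u], of "e/2"] e by (simp add: dist_real_def)
      then have "\<forall>\<^sub>F x in at_top. (indicator (B x) u :: real) = 0"
        by eventually_elim (auto simp: B_def)
      then show "((\<lambda>x. indicator (B x) u :: real) \<longlongrightarrow> 0) at_top"
        by (rule tendsto_eventually)
    qed
    show "\<forall>\<^sub>F x in at_top. AE u in lborel. norm (indicator (B x) u :: real) \<le> indicator {0..3} u"
      by (intro always_eventually allI AE_I2) (auto simp: B_def indicator_def)
  qed auto
  then have "((\<lambda>x. measure lborel (B x)) \<longlongrightarrow> 0) at_top" by simp
  then have "\<forall>\<^sub>F x in at_top. measure lborel (B x) < 1" by (rule order_tendstoD) simp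
  then obtain x0 where x0: "\<And>x. x \<ge> x0 \<Longrightarrow> measure lebesgue (B x) < 1"
    by (auto simp: eventually_at_top_linorder)
  show ?thesis
  proof (intro exI[of _ x0] allI impI ballI)
    fix x u :: real assume x: "x \<ge> x0" and u: "u \<in> {0..1}"
    have tl: "(+) u ` B (x + u) \<in> lmeasurable" by (intro measurable_translation Bl)
    \<comment> \<open>Two exceptional sets of measure less than 1 cannot cover an interval of length 2.\<close>
    have "\<not> {1..3} \<subseteq> B x \<union> (+) u ` B (x + u)"
    proof
      assume "{1..3} \<subseteq> B x \<union> (+) u ` B (x + u)"
      then have "measure lebesgue {1..3::real} \<le> measure lebesgue (B x \<union> (+) u ` B (x + u))"
        using Bl tl by (intro measure_mono_fmeasurable) auto
      also have "\<dots> \<le> measure lebesgue (B x) + measure lebesgue ((+) u ` B (x + u))"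
        using Bl tl by (intro measure_Un_le) auto
      also have "\<dots> < 1 + 1"
        using x0[of x] x0[of "x+u"] x u by (simp add: measure_translation)
      finally show False by simp
    qed
    then obtain v where v: "v \<in> {1..3}" "v \<notin> B x" "v \<notin> (+) u ` B (x + u)" by blast
    have "v - u \<notin> B (x + u)"
    proof
      assume "v - u \<in> B (x + u)"
      then have "u + (v - u) \<in> (+) u ` B (x + u)" by blast
      with v show False by simp
    qed
    with v u have "\<bar>h (x + v) - h x\<bar> < e/2" "\<bar>h (x + u + (v - u)) - h (x + u)\<bar> < e/2"
      by (auto simp: B_def not_le)
    moreover have "x + u + (v - u) = x + v" by simp
    ultimately show "\<bar>h (x + u) - h x\<bar> \<le> e" by (simp only:)
  qed
qed

text \<open>Potter's bounds in logarithmic form. In the variable \<open>ln x\<close> a distance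
  \<open>ln (y / x)\<close> is covered by at most \<open>1 + ln (y / x)\<close> steps of length at
  most 1, and the uniform convergence theorem bounds each of them by \<open>e\<close>.\<close>

lemma slowly_varying_Potter:
  assumes l: "slowly_varying l" and e: "e > 0"
  obtains x0 where "x0 \<ge> 1"
    "\<And>x. x \<ge> x0 \<Longrightarrow> 0 < l x"
    "\<And>x y. x \<ge> x0 \<Longrightarrow> y \<ge> x \<Longrightarrow> \<bar>ln (l y) - ln (l x)\<bar> \<le> e * (1 + ln (y / x))"
proof -
  from l obtain a where a: "l \<in> borel_measurable (restrict_space borel {a..})"
      "\<And>x. x \<ge> a \<Longrightarrow> l x > 0"
    and sv: "\<And>c. c > 0 \<Longrightarrow> ((\<lambda>x. l (c * x) / l x) \<longlongrightarrow> 1) at_top"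
    unfolding slowly_varying_def by blast
  \<comment> \<open>\<open>l\<close> is measurable only on a half-line; cutting it off makes
    \<open>h\<close> measurable on the whole line without changing the behaviour at
    infinity.\<close>
  define l' where "l' x = (if x \<ge> a then l x else 0)" for x
  have l'eq: "l' = (\<lambda>x. indicator {a..} x *\<^sub>R l x)" by (auto simp: l'_def indicator_def)
  have [measurable]: "l' \<in> borel_measurable borel"
    using a(1) unfolding l'eq by (subst (asm) borel_measurable_restrict_space_iff) auto
  define h where "h y = ln (l' (exp y))" for y
  have hm: "h \<in> borel_measurable borel" unfolding h_def by measurable
  have lim: "((\<lambda>x. h (x + u) - h x) \<longlongrightarrow> 0) at_top" for u
  proof -
    have "((\<lambda>x. l (exp u * exp x) / l (exp x)) \<longlongrightarrow> 1) at_top"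
      by (rule filterlim_compose[OF sv exp_at_top]) simp
    then have "((\<lambda>x. ln (l (exp u * exp x) / l (exp x))) \<longlongrightarrow> ln 1) at_top"
      by (intro tendsto_ln) auto
    moreover have "\<forall>\<^sub>F x in at_top. exp u * exp x \<ge> a"
      by (rule eventually_compose_filterlim[OF eventually_ge_at_top])
         (intro filterlim_tendsto_pos_mult_at_top[OF tendsto_const] exp_at_top, auto)
    moreover have "\<forall>\<^sub>F x in at_top. exp x \<ge> a"
      by (rule eventually_compose_filterlim[OF eventually_ge_at_top exp_at_top])
    then have "\<forall>\<^sub>F x in at_top. ln (l (exp u * exp x) / l (exp x)) = h (x + u) - h x"
      using calculation(2)
    proof eventually_elim
      case (elim x)
      then show ?case using a(2)[of "exp x"] a(2)[of "exp u * exp x"]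
        by (simp add: h_def l'_def ln_div exp_add mult.commute)
    qed
    ultimately show ?thesis by (simp add: Lim_transform_eventually)
  qed
  obtain y0 where y0: "\<And>x u. x \<ge> y0 \<Longrightarrow> u \<in> {0..1} \<Longrightarrow> \<bar>h (x + u) - h x\<bar> \<le> e"
    using slowly_varying_uniform_unit[OF hm lim e] by blast
  have step: "\<bar>h (x + u) - h x\<bar> \<le> e * (real n + 1)" if "x \<ge> y0" "0 \<le> u" "u \<le> real n + 1" for x u n
    using that(2,3)
  proof (induction n arbitrary: u)
    case 0
    then show ?case using y0[of x u] that by auto
  next
    case (Suc n)
    show ?case
    proof (cases "u \<le> real n + 1")
      case True
      with Suc.IH[of u] Suc.prems e show ?thesis by (auto simp: algebra_simps)
    next
      case False
      have "\<bar>h (x + (u - 1)) - h x\<bar> \<le> e * (real n + 1)"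
        using Suc False by (intro Suc.IH) auto
      moreover have "\<bar>h (x + (u - 1) + 1) - h (x + (u - 1))\<bar> \<le> e"
        using False that by (intro y0) auto
      ultimately show ?thesis by (simp add: algebra_simps)
    qed
  qed
  define x0 where "x0 = max (exp y0) (max a 1)"
  show ?thesis
  proof (rule that[of x0])
    show "x0 \<ge> 1" by (simp add: x0_def)
    show pos: "0 < l x" if "x \<ge> x0" for x using that a(2) by (simp add: x0_def)
    fix x y assume x: "x0 \<le> x" and y: "x \<le> y"
    have xp: "x \<ge> 1" "y \<ge> 1" "x \<ge> a" "y \<ge> a" using x y by (auto simp: x0_def)
    define u where "u = ln (y / x)"
    have u: "u \<ge> 0" using xp y by (simp add: u_def)
    have "exp y0 \<le> x" using x by (simp add: x0_def)
    then have "ln x \<ge> y0" using xp by (simp add: ln_ge_iff)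
    then have "\<bar>h (ln x + u) - h (ln x)\<bar> \<le> e * (real (nat \<lfloor>u\<rfloor>) + 1)"
      using u by (intro step) linarith+
    also have "\<dots> \<le> e * (1 + u)"
      using u e by (intro mult_left_mono) linarith+
    also have "h (ln x) = ln (l x)" using xp by (simp add: h_def l'_def)
    also have "ln x + u = ln y" using xp by (simp add: u_def ln_div)
    also have "h (ln y) = ln (l y)" using xp by (simp add: h_def l'_def)
    finally show "\<bar>ln (l y) - ln (l x)\<bar> \<le> e * (1 + ln (y / x))" by (simp add: u_def)
  qed
qed

lemma slowly_varying_Potter_powr:
  assumes l: "slowly_varying l" and e: "e > 0"
  obtains x0 where "x0 \<ge> 1"
    "\<And>x. x \<ge> x0 \<Longrightarrow> 0 < l x"
    "\<And>x y. x \<ge> x0 \<Longrightarrow> y \<ge> x \<Longrightarrow> l x \<le> exp e * (y / x) powr e * l y"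
    "\<And>x y. x \<ge> x0 \<Longrightarrow> y \<ge> x \<Longrightarrow> l y \<le> exp e * (y / x) powr e * l x"
proof -
  obtain x0 where x0: "x0 \<ge> 1" "\<And>x. x \<ge> x0 \<Longrightarrow> 0 < l x"
    "\<And>x y. x \<ge> x0 \<Longrightarrow> y \<ge> x \<Longrightarrow> \<bar>ln (l y) - ln (l x)\<bar> \<le> e * (1 + ln (y / x))"
    using slowly_varying_Potter[OF l e] by blast
  have key: "A \<le> exp e * (y / x) powr e * B"
    if "0 < A" "0 < B" "\<bar>ln A - ln B\<bar> \<le> e * (1 + ln (y / x))" "0 < x" "0 < y" for A B x y :: real
  proof -
    have "exp (ln A) \<le> exp (e * (1 + ln (y / x)) + ln B)" using that(3) by (subst exp_le_cancel_iff) linarith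
    then show ?thesis using that by (simp add: powr_def exp_add algebra_simps)
  qed
  show ?thesis
  proof (rule that[OF x0(1,2)])
    fix x y assume xy: "x \<ge> x0" "y \<ge> x"
    have p: "0 < l x" "0 < l y" "0 < x" "0 < y" using x0(1) xy by (auto intro!: x0(2))
    show "l x \<le> exp e * (y / x) powr e * l y" 
      by (rule key) (use x0(3)[OF xy] p in \<open>auto simp: abs_minus_commute\<close>)
    show "l y \<le> exp e * (y / x) powr e * l x"
      by (rule key) (use x0(3)[OF xy] p in auto)
  qed
qed

text \<open>Potter's bounds anchored at a fixed \<open>N\<close>. The finitely many
  \<open>k < N\<close>, where the sign of \<open>l\<close> is unknown, are absorbed into
  \<open>C\<close>; hence the absolute value in the upper bound, and hence a lower bound that is
  stated only eventually.\<close>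

lemma slowly_varying_nat_bounds:
  assumes l: "slowly_varying l" and e: "e > 0"
  obtains C where "C > 0" "\<And>k::nat. k \<ge> 1 \<Longrightarrow> \<bar>l (real k)\<bar> \<le> C * real k powr e"
    "\<forall>\<^sub>F n in sequentially. real n powr (- e) / C \<le> l (real n)"
proof -
  obtain x0 where x0: "x0 \<ge> 1"
    "\<And>x. x \<ge> x0 \<Longrightarrow> 0 < l x"
    "\<And>x y. x \<ge> x0 \<Longrightarrow> y \<ge> x \<Longrightarrow> l x \<le> exp e * (y / x) powr e * l y"
    "\<And>x y. x \<ge> x0 \<Longrightarrow> y \<ge> x \<Longrightarrow> l y \<le> exp e * (y / x) powr e * l x"
    using slowly_varying_Potter_powr[OF l e] by blast
  define N where "N = nat \<lceil>x0\<rceil>"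
  have N: "real N \<ge> x0" "N \<ge> 1" using x0(1) by (auto simp: N_def) linarith+
  define A where "A = exp e * l (real N)"
  define B where "B = (\<Sum>k\<le>N. \<bar>l (real k)\<bar>)"
  have lN: "l (real N) > 0" using N x0 by auto
  define C where "C = A + B + exp e * real N powr e / l (real N)"
  have pos: "A > 0" "B \<ge> 0" "exp e / l (real N) > 0" "C > 0" using lN N by (auto simp: A_def B_def C_def
     intro!: sum_nonneg add_pos_pos add_pos_nonneg divide_pos_pos)
  have Npow: "0 < exp e * real N powr e / l (real N)" using lN N by (auto intro!: divide_pos_pos)
  show ?thesis
  proof (rule that[OF pos(4)])
    fix k :: nat assume k: "k \<ge> 1"
    have k1: "real k powr e \<ge> 1" using k e by (simp add: ge_one_powr_ge_zero)
    show "\<bar>l (real k)\<bar> \<le> C * real k powr e"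
    proof (cases "k \<le> N")
      case True
      then have "\<bar>l (real k)\<bar> \<le> B" unfolding B_def by (intro member_le_sum) auto
      also have "\<dots> \<le> C * 1" using pos Npow by (simp add: C_def)
      also have "\<dots> \<le> C * real k powr e" using pos k1 by (intro mult_left_mono) auto
      finally show ?thesis .
    next
      case False
      then have "l (real k) \<le> exp e * (real k / real N) powr e * l (real N)" using N by (intro x0) auto
      also have "\<dots> = A * (real k / real N) powr e" by (simp add: A_def)
      also have "\<dots> \<le> C * real k powr e"
        using False N pos Npow e
        by (intro mult_mono powr_mono2) (auto simp: C_def divide_le_eq)
      finally show ?thesis using x0(2)[of "real k"] False N by auto
    qed
  next
    show "\<forall>\<^sub>F n in sequentially. real n powr (- e) / C \<le> l (real n)"
      using eventually_ge_at_top[of N]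
    proof eventually_elim
      case (elim n)
      have n: "real n \<ge> 1" "real n \<ge> x0" using elim N by auto
      have "l (real N) \<le> exp e * (real n / real N) powr e * l (real n)" using N elim by (intro x0) auto
      also have "\<dots> \<le> exp e * (real n) powr e * l (real n)"
        using N elim e x0(2)[OF n(2)]
        by (intro mult_right_mono mult_left_mono powr_mono2) (auto simp: divide_le_eq)
      finally have 1: "real n powr (- e) \<le> exp e / l (real N) * l (real n)"
        using lN n by (simp add: powr_minus field_simps)
      have "real N powr e \<ge> 1" using N e by (simp add: ge_one_powr_ge_zero)
      then have "exp e / l (real N) \<le> exp e * real N powr e / l (real N)"
        using lN by (intro divide_right_mono) auto
      also have "\<dots> \<le> C" using pos by (simp add: C_def)
      finally have "exp e / l (real N) * l (real n) \<le> C * l (real n)"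
        using x0(2)[OF n(2)] by (intro mult_right_mono) auto
      with 1 have "real n powr (- e) \<le> C * l (real n)" by (rule order_trans)
      then show ?case using pos by (simp add: pos_divide_le_eq mult.commute)
    qed
  qed
qed

text \<open>The definition of slow variation treats a fixed factor. Here the factor
  \<open>y n / z n\<close> varies with \<open>n\<close> inside a bounded range, which is where the
  uniformity of Potter's bounds is used.\<close>

lemma slowly_varying_ratio:
  assumes l: "slowly_varying l"
    and z: "filterlim z at_top F" and zy: "\<forall>\<^sub>F n in F. z n \<le> y n \<and> y n \<le> C * z n"
  shows "((\<lambda>n. l (y n) / l (z n)) \<longlongrightarrow> 1) F"
proof -
  define D where "D = ln (max C 1)"
  have D: "D \<ge> 0" by (simp add: D_def)
  have "((\<lambda>n. ln (l (y n)) - ln (l (z n))) \<longlongrightarrow> 0) F"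
  proof (rule tendstoI)
    fix e :: real assume e: "e > 0"
    \<comment> \<open>Scaled so that the Potter error stays at most \<open>e / 2\<close> over the
      whole range of ratios.\<close>
    define e' where "e' = e / 2 / (1 + D)"
    have e': "e' > 0" using e D by (simp add: e'_def)
    have "1 + D \<noteq> 0" using D by simp
    then have "e' * (1 + D) = e / 2" by (metis e'_def nonzero_eq_divide_eq)
    then have e'D: "e' * (1 + D) < e" using e by simp
    obtain x0 where x0: "x0 \<ge> 1" "\<And>x. x \<ge> x0 \<Longrightarrow> 0 < l x"
      "\<And>x y. x \<ge> x0 \<Longrightarrow> y \<ge> x \<Longrightarrow> \<bar>ln (l y) - ln (l x)\<bar> \<le> e' * (1 + ln (y / x))"
      using slowly_varying_Potter[OF l e'] by blast
    have "\<forall>\<^sub>F n in F. z n \<ge> x0" using z by (auto simp: filterlim_at_top)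
    with zy show "\<forall>\<^sub>F n in F. dist (ln (l (y n)) - ln (l (z n))) 0 < e"
    proof eventually_elim
      case (elim n)
      have "y n \<le> C * z n" "z n > 0" using elim x0(1) by auto
      moreover have "C * z n \<le> max C 1 * z n" using \<open>z n > 0\<close> by (intro mult_right_mono) auto
      ultimately have "y n \<le> max C 1 * z n" by linarith
      with \<open>z n > 0\<close> have "y n / z n \<le> max C 1" by (simp only: pos_divide_le_eq)
      moreover have "0 < y n / z n" using elim x0(1) by (intro divide_pos_pos) auto
      ultimately have "ln (y n / z n) \<le> D" unfolding D_def by (intro ln_mono)
      then have "e' * (1 + ln (y n / z n)) \<le> e' * (1 + D)" using e' by (intro mult_left_mono) auto
      moreover have "\<bar>ln (l (y n)) - ln (l (z n))\<bar> \<le> e' * (1 + ln (y n / z n))"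
        using elim by (intro x0(3)) auto
      ultimately have "\<bar>ln (l (y n)) - ln (l (z n))\<bar> < e" using e'D by linarith
      then show ?case by (simp only: dist_real_def diff_0_right)
    qed
  qed
  from tendsto_exp[OF this] have "((\<lambda>n. exp (ln (l (y n)) - ln (l (z n)))) \<longlongrightarrow> 1) F" by simp
  moreover obtain a where a: "\<And>x. x \<ge> a \<Longrightarrow> 0 < l x"
    using l unfolding slowly_varying_def by blast
  have "\<forall>\<^sub>F n in F. z n \<ge> a" using z by (auto simp: filterlim_at_top)
  with zy have "\<forall>\<^sub>F n in F. exp (ln (l (y n)) - ln (l (z n))) = l (y n) / l (z n)"
  proof eventually_elim
    case (elim n)
    then have "0 < l (y n)" "0 < l (z n)" by (auto intro!: a)
    then show ?case by (simp add: exp_diff)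
  qed
  ultimately show ?thesis by (rule Lim_transform_eventually)
qed

section \<open>Sums of regularly varying covariances\<close>

text \<open>The normalised sum is the integral over \<open>{0..1}\<close> of a step function
  \<open>\<phi> n\<close> that converges pointwise to \<open>(1 - x) * x powr (- d)\<close>.
  Potter's bounds give an integrable majorant, so dominated convergence applies, and the limit is
  the Beta integral \<open>1 / (1 - d) - 1 / (2 - d)\<close>.\<close>

lemma karamata_triangular_sum:
  assumes l: "slowly_varying l" and d: "0 < d" "d < 1"
  shows "(\<lambda>n. (\<Sum>k=1..n. (1 - real k / real n) * (real k / real n) powr (- d) * (l (real k) / l (real n))) / real n)
           \<longlonglongrightarrow> 1 / ((1 - d) * (2 - d))"
proof -
  define a where "a n k = (1 - real k / real n) * (real k / real n) powr (- d) * (l (real k) / l (real n))" for n k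
  \<comment> \<open>Cells open on the left assign to \<open>x > 0\<close> the index
    \<open>\<lceil>n x\<rceil> \<ge> 1\<close>, so index 0 never occurs, and
    \<open>x \<le> k / n\<close> bounds the decreasing power of \<open>k / n\<close> by that of
    \<open>x\<close>.\<close>
  define \<phi> where "\<phi> n x = (\<Sum>k=1..n. a n k * (if x \<in> {(real k - 1) / real n <.. real k / real n} then 1 else 0))" for n x
  \<comment> \<open>Half of the room below exponent 1: the majorant
    \<open>x powr (- (d + e))\<close> stays integrable at 0.\<close>
  define e where "e = (1 - d) / 2"
  have e: "e > 0" "d + e < 1" using d by (auto simp: e_def field_simps)
  obtain x0 where x0: "x0 \<ge> 1"
    "\<And>x. x \<ge> x0 \<Longrightarrow> 0 < l x"
    "\<And>x y. x \<ge> x0 \<Longrightarrow> y \<ge> x \<Longrightarrow> l x \<le> exp e * (y / x) powr e * l y"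
    "\<And>x y. x \<ge> x0 \<Longrightarrow> y \<ge> x \<Longrightarrow> l y \<le> exp e * (y / x) powr e * l x"
    using slowly_varying_Potter_powr[OF l e(1)] by blast
  define N where "N = nat \<lceil>x0\<rceil>"
  have N: "real N \<ge> x0" "N \<ge> 1" using x0(1) by (auto simp: N_def) linarith+
  have lN: "l (real N) > 0" using N x0 by auto
  define B where "B = (\<Sum>k\<le>N. \<bar>l (real k)\<bar>)"
  define C where "C = exp e * max 1 (B / l (real N))"
  have C: "C > 0" by (simp add: C_def)
  have val: "\<phi> n x = a n (nat \<lceil>real n * x\<rceil>)" and kb: "1 \<le> nat \<lceil>real n * x\<rceil>" "nat \<lceil>real n * x\<rceil> \<le> n"
    "x \<le> real (nat \<lceil>real n * x\<rceil>) / real n" if x: "0 < x" "x \<le> 1" and n: "n \<ge> 1" for n x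
  proof -
    let ?k = "nat \<lceil>real n * x\<rceil>"
    have pos: "real n * x > 0" "real n * x \<le> real n" using x n by auto
    show kb: "1 \<le> ?k" "?k \<le> n" using pos by linarith+
    show "x \<le> real ?k / real n" using pos n by (simp add: field_simps) 
    have iff: "x \<in> {(real k - 1) / real n <.. real k / real n} \<longleftrightarrow> k = ?k" for k
    proof -
      have "x \<in> {(real k - 1) / real n <.. real k / real n} \<longleftrightarrow> real k - 1 < real n * x \<and> real n * x \<le> real k"
        using n by (auto simp: field_simps)
      also have "\<dots> \<longleftrightarrow> \<lceil>real n * x\<rceil> = int k" by (simp add: ceiling_eq_iff)
      also have "\<dots> \<longleftrightarrow> k = ?k" using pos by auto
      finally show ?thesis .
    qed
    have "\<phi> n x = (\<Sum>k=1..n. if k = ?k then a n k else 0)"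
      unfolding \<phi>_def iff by (intro sum.cong) auto
    also have "\<dots> = a n ?k" using kb by (subst sum.delta) auto
    finally show "\<phi> n x = a n ?k" .
  qed
  have int: "(\<phi> n has_integral (\<Sum>k=1..n. a n k) / real n) {0..1}" if "n \<ge> 1" for n
  proof -
    have "(\<phi> n has_integral (\<Sum>k=1..n. a n k * (1 / real n))) {0..1}"
      unfolding \<phi>_def
    proof (intro has_integral_sum has_integral_mult_right)
      fix k assume k: "k \<in> {1..n}"
      let ?A = "{(real k - 1) / real n <.. real k / real n}"
      have "0 \<le> (real k - 1) / real n" "real k / real n \<le> 1" using k by auto
      then have sub: "?A \<subseteq> {0..1}" by (auto simp del: zero_le_divide_iff divide_le_eq_1_pos)
      have "((\<lambda>x. 1::real) has_integral measure lborel ?A) ?A"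
        by (intro has_integral_measure_lborel) (auto simp: emeasure_lborel_Ioc divide_right_mono)
      moreover have "measure lborel ?A = 1 / real n" using that by (simp add: field_simps)
      ultimately show "((\<lambda>x. if x \<in> ?A then 1 else 0 :: real) has_integral 1 / real n) {0..1}"
        by (subst has_integral_restrict[OF sub]) (simp only:)
    qed auto
    then show ?thesis by (simp add: sum_divide_distrib)
  qed
  have dom: "norm (\<phi> n x) \<le> C * x powr (- (d + e))" if x: "0 < x" "x \<le> 1" and n: "n \<ge> N" for n x
  proof -
    let ?k = "nat \<lceil>real n * x\<rceil>"
    have n1: "n \<ge> 1" using n N by simp
    note kb = kb[OF x n1]
    have ln: "l (real n) > 0" using n N by (intro x0) auto
    have xe: "x powr (- (d + e)) = x powr (- d) * x powr (- e)" by (simp add: powr_add[symmetric])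
    have p1: "(real ?k / real n) powr (- d) \<le> x powr (- d)" using kb x d by (intro powr_mono2') auto
    have p2: "\<bar>l (real ?k) / l (real n)\<bar> \<le> C * x powr (- e)"
    proof (cases "?k \<ge> N")
      case True
      then have "l (real ?k) \<le> exp e * (real n / real ?k) powr e * l (real n)"
        using N kb by (intro x0) auto
      then have "l (real ?k) / l (real n) \<le> exp e * (real n / real ?k) powr e"
        using ln by (simp add: divide_le_eq)
      also have "(real n / real ?k) powr e \<le> (1 / x) powr e"
        using kb x e n1 by (intro powr_mono2) (auto simp: field_simps)
      also have "(1 / x) powr e = x powr (- e)" using x by (simp add: powr_divide powr_minus field_simps)
      also have "exp e * x powr (- e) \<le> C * x powr (- e)"
        unfolding C_def by (intro mult_right_mono) auto
      finally have "l (real ?k) / l (real n) \<le> C * x powr (- e)" by simp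
      moreover have "l (real ?k) / l (real n) > 0" using True N(1) by (intro divide_pos_pos ln x0(2)) linarith
      ultimately show ?thesis by (simp only: abs_of_pos)
    next
      \<comment> \<open>Below \<open>N\<close> Potter's bounds say nothing about \<open>l\<close> at
        \<open>?k\<close>, but only finitely many values occur there, and
        \<open>real n * x \<le> real N\<close> bounds \<open>n / N\<close> by
        \<open>1 / x\<close>.\<close>
      case False
      then have kN: "?k \<le> N" by linarith
      then have "\<bar>l (real ?k)\<bar> \<le> B" unfolding B_def by (intro member_le_sum) auto
      then have "\<bar>l (real ?k)\<bar> / l (real n) \<le> B / l (real n)" using ln by (intro divide_right_mono) auto
      moreover have "l (real N) \<le> exp e * (real n / real N) powr e * l (real n)"
        using N n by (intro x0) auto
      then have "1 / l (real n) \<le> exp e * (real n / real N) powr e / l (real N)"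
        using ln lN by (simp add: field_simps)
      moreover have "B \<ge> 0" by (auto simp: B_def intro: sum_nonneg)
      ultimately have "\<bar>l (real ?k)\<bar> / l (real n) \<le> B * (exp e * (real n / real N) powr e / l (real N))"
        using mult_left_mono[of "1 / l (real n)" "exp e * (real n / real N) powr e / l (real N)" B]
        by simp
      also have "\<dots> = exp e * (B / l (real N)) * (real n / real N) powr e" by (simp add: field_simps)
      also have "\<dots> \<le> exp e * (B / l (real N)) * (1 / x) powr e"
      proof (intro mult_left_mono powr_mono2)
        have "real n * x \<le> real ?k" using kb(3) n1 by (simp add: field_simps)
        also have "\<dots> \<le> real N" using kN by (rule of_nat_mono)
        finally show "real n / real N \<le> 1 / x" using x N by (simp add: field_simps)
      qed (use e lN \<open>B \<ge> 0\<close> in auto)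
      also have "(1 / x) powr e = x powr (- e)" using x by (simp add: powr_divide powr_minus field_simps)
      also have "exp e * (B / l (real N)) * x powr (- e) \<le> C * x powr (- e)"
        unfolding C_def by (intro mult_right_mono mult_left_mono) auto
      finally show ?thesis using ln \<open>B \<ge> 0\<close> lN by (simp add: abs_divide mult_left_mono)
    qed
    have p0: "\<bar>1 - real ?k / real n\<bar> \<le> 1" using kb n1 by (auto simp: field_simps)
    have "norm (\<phi> n x) = \<bar>1 - real ?k / real n\<bar> * (real ?k / real n) powr (- d) * \<bar>l (real ?k) / l (real n)\<bar>"
      by (simp add: val[OF x n1] a_def abs_mult)
    also have "\<dots> \<le> 1 * x powr (- d) * (C * x powr (- e))"
      using p0 p1 p2 by (intro mult_mono) auto
    finally show ?thesis unfolding xe by (simp add: mult_ac)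
  qed
  have ptw: "(\<lambda>n. \<phi> n x) \<longlonglongrightarrow> (1 - x) * x powr (- d)" if x: "0 < x" "x \<le> 1" for x
  proof -
    let ?k = "\<lambda>n. nat \<lceil>real n * x\<rceil>"
    have kn: "(\<lambda>n. real (?k n) / real n) \<longlonglongrightarrow> x"
    proof (rule tendsto_sandwich)
      show "\<forall>\<^sub>F n in sequentially. x \<le> real (?k n) / real n"
        using eventually_ge_at_top[of 1] by eventually_elim (use kb(3) x in auto)
      show "\<forall>\<^sub>F n in sequentially. real (?k n) / real n \<le> x + 1 / real n"
        using eventually_ge_at_top[of 1]
      proof eventually_elim
        case (elim n)
        have "real n * x > 0" using elim x by simp
        then have "real (?k n) \<le> real n * x + 1" by linarith
        then show ?case using elim by (simp add: field_simps)
      qed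
      have "(\<lambda>n. x + 1 / real n) \<longlonglongrightarrow> x + 0" by (intro tendsto_intros lim_1_over_n)
      then show "(\<lambda>n. x + 1 / real n) \<longlonglongrightarrow> x" by simp
    qed auto
    have "filterlim (\<lambda>n. real n * x) at_top sequentially"
      using x by (intro filterlim_at_top_mult_tendsto_pos[OF tendsto_const] filterlim_real_sequentially)
    then have kinf: "filterlim (\<lambda>n. real (?k n)) at_top sequentially"
      by (rule filterlim_at_top_mono) (intro always_eventually allI, linarith)
    have "(\<lambda>n. l (real n) / l (real (?k n))) \<longlonglongrightarrow> 1"
    proof (rule slowly_varying_ratio[OF l kinf, where C="1/x"])
      show "\<forall>\<^sub>F n in sequentially. real (?k n) \<le> real n \<and> real n \<le> 1 / x * real (?k n)"
        using eventually_ge_at_top[of 1]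
      proof eventually_elim
        case (elim n)
        have "x * real n \<le> real (?k n)" using kb(3)[OF x elim] elim by (simp add: pos_le_divide_eq)
        then have "real n \<le> 1 / x * real (?k n)" using x by (simp add: field_simps)
        moreover have "real (?k n) \<le> real n" using kb(2)[OF x elim] by (rule of_nat_mono)
        ultimately show ?case by blast
      qed
    qed
    then have "(\<lambda>n. inverse (l (real n) / l (real (?k n)))) \<longlonglongrightarrow> inverse 1"
      by (intro tendsto_inverse) auto
    then have lr: "(\<lambda>n. l (real (?k n)) / l (real n)) \<longlonglongrightarrow> 1" by simp
    have "(\<lambda>n. a n (?k n)) \<longlonglongrightarrow> (1 - x) * x powr (- d) * 1"
      unfolding a_def using x by (intro tendsto_intros kn lr) auto
    moreover have "\<forall>\<^sub>F n in sequentially. a n (?k n) = \<phi> n x"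
      using eventually_ge_at_top[of 1] by eventually_elim (use val x in auto)
    ultimately have "(\<lambda>n. \<phi> n x) \<longlonglongrightarrow> (1 - x) * x powr (- d) * 1"
      by (rule Lim_transform_eventually)
    then show ?thesis by simp
  qed
  have zero: "\<phi> n 0 = 0" for n
    unfolding \<phi>_def by (intro sum.neutral) (auto simp: divide_less_0_iff)
  have powr_int: "((\<lambda>x. x powr b) has_integral 1 / (b + 1)) {0..1::real}" if "b > -1" for b
    using has_integral_powr_from_0[OF that, of 1] by simp
  have "((\<lambda>x. x powr (- d) - x powr (1 - d)) has_integral (1 / (- d + 1) - 1 / (1 - d + 1))) {0..1::real}"
    using d by (intro has_integral_diff powr_int) auto
  moreover have "(1 - x) * x powr (- d) = x powr (- d) - x powr (1 - d)" if "x \<in> {0..1::real}" for x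
    using that powr_mult_base[of x "-d"] by (auto simp: algebra_simps)
  moreover have "1 / (- d + 1) - 1 / (1 - d + 1) = 1 / ((1 - d) * (2 - d))" using d by (simp add: field_simps)
  ultimately have limint: "((\<lambda>x. (1 - x) * x powr (- d)) has_integral 1 / ((1 - d) * (2 - d))) {0..1::real}"
    by (metis (no_types, lifting) has_integral_cong)
  \<comment> \<open>The majorant is valid from \<open>N\<close> on, hence the shift of the
    sequence.\<close>
  have "(\<lambda>n. integral {0..1} (\<phi> (n + N))) \<longlonglongrightarrow> integral {0..1} (\<lambda>x. (1 - x) * x powr (- d))"
  proof (rule dominated_convergence)
    show "\<phi> (k + N) integrable_on {0..1}" for k using int[of "k+N"] N by auto
    show "(\<lambda>x. C * x powr (- (d + e))) integrable_on {0..1}"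
      using powr_int[of "- (d + e)"] e by (intro integrable_on_mult_right) auto
    show "norm (\<phi> (k + N) x) \<le> C * x powr (- (d + e))" if "x \<in> {0..1}" for k x
      using that dom[of x "k+N"] zero by (cases "x = 0") auto
    show "(\<lambda>k. \<phi> (k + N) x) \<longlonglongrightarrow> (1 - x) * x powr (- d)" if "x \<in> {0..1}" for x
      using that zero by (cases "x = 0") (auto intro!: LIMSEQ_ignore_initial_segment ptw)
  qed
  then have "(\<lambda>n. integral {0..1} (\<phi> n)) \<longlonglongrightarrow> 1 / ((1 - d) * (2 - d))"
    using limint by (simp add: LIMSEQ_offset integral_unique)
  moreover have "\<forall>\<^sub>F n in sequentially. integral {0..1} (\<phi> n) = (\<Sum>k=1..n. a n k) / real n"
    using eventually_ge_at_top[of 1] by eventually_elim (use int in \<open>auto simp: integral_unique\<close>)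
  ultimately show ?thesis unfolding a_def by (rule Lim_transform_eventually)
qed

definition nat_dist :: "nat \<Rightarrow> nat \<Rightarrow> nat" where
  "nat_dist i j = (if i \<le> j then j - i else i - j)"

text \<open>Each lag \<open>k \<ge> 1\<close> occurs \<open>n - k\<close> times on either side of
  the diagonal; the induction adds the last row and column.\<close>

lemma double_sum_nat_dist:
  fixes p :: "nat \<Rightarrow> real"
  shows "(\<Sum>i=1..n. \<Sum>j=1..n. p (nat_dist i j)) = real n * p 0 + 2 * (\<Sum>k=1..n. (real n - real k) * p k)"
proof (induction n)
  case (Suc n)
  have 1: "(\<Sum>i=1..n. p (nat_dist i (Suc n))) = (\<Sum>k=1..n. p k)"
    by (rule sum.reindex_bij_witness[of _ "\<lambda>k. Suc n - k" "\<lambda>i. Suc n - i"]) (auto simp: nat_dist_def)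
  have 2: "(\<Sum>i=1..n. p (nat_dist (Suc n) i)) = (\<Sum>k=1..n. p k)"
    by (rule sum.reindex_bij_witness[of _ "\<lambda>k. Suc n - k" "\<lambda>i. Suc n - i"]) (auto simp: nat_dist_def)
  have 3: "(\<Sum>k=1..n. (real (Suc n) - real k) * p k) = (\<Sum>k=1..n. (real n - real k) * p k) + (\<Sum>k=1..n. p k)"
    by (simp add: sum.distrib[symmetric] algebra_simps)
  have "(\<Sum>i=1..Suc n. \<Sum>j=1..Suc n. p (nat_dist i j)) =
     (\<Sum>i=1..n. \<Sum>j=1..n. p (nat_dist i j)) + (\<Sum>i=1..n. p (nat_dist i (Suc n)))
       + (\<Sum>i=1..n. p (nat_dist (Suc n) i)) + p 0"
    by (simp add: sum.distrib nat_dist_def)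
  also have "\<dots> = real n * p 0 + 2 * (\<Sum>k=1..n. (real n - real k) * p k) + 2 * (\<Sum>k=1..n. p k) + p 0"
    unfolding 1 2 Suc.IH by simp
  also have "\<dots> = real (Suc n) * p 0 + 2 * (\<Sum>k=1..Suc n. (real (Suc n) - real k) * p k)"
    using 3 by (simp add: algebra_simps)
  finally show ?case .
qed simp

text \<open>Off the diagonal the sum is, after rescaling, twice the triangular Karamata sum. The
  diagonal contributes only \<open>n\<close>, which is of smaller order because
  \<open>d < 1\<close>; this is the term that \<open>z\<close> sends to 0.\<close>

lemma lrd_covariance_sum:
  fixes \<rho> :: "nat \<Rightarrow> real"
  assumes l: "slowly_varying l" and d: "0 < d" "d < 1"
    and \<rho>: "\<rho> 0 = 1" "\<And>k. k \<ge> 1 \<Longrightarrow> \<rho> k = real k powr (- d) * l (real k)"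
  shows "(\<lambda>n. (\<Sum>i=1..n. \<Sum>j=1..n. \<rho> (nat_dist i j)) / (real n powr (2 - d) * l (real n)))
            \<longlonglongrightarrow> 2 / ((1 - d) * (2 - d))"
proof -
  define S where "S n = (\<Sum>k=1..n. (1 - real k / real n) * (real k / real n) powr (- d) * (l (real k) / l (real n))) / real n" for n
  define e where "e = (1 - d) / 2"
  have e: "e > 0" "d - 1 + e < 0" using d by (auto simp: e_def field_simps)
  obtain C where C: "C > 0" "\<forall>\<^sub>F n in sequentially. real n powr (- e) / C \<le> l (real n)"
    using slowly_varying_nat_bounds[OF l e(1)] by blast
  have z: "(\<lambda>n. real n powr (d - 1) / l (real n)) \<longlonglongrightarrow> 0"
  proof (rule Lim_null_comparison)
    show "\<forall>\<^sub>F n in sequentially. norm (real n powr (d - 1) / l (real n)) \<le> C * real n powr (d - 1 + e)"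
      using C(2) eventually_ge_at_top[of 1]
    proof eventually_elim
      case (elim n)
      have p: "real n powr (- e) / C > 0" using elim C by auto
      have lp: "l (real n) > 0" using p elim by linarith
      have "real n powr (d - 1) / l (real n) \<le> real n powr (d - 1) / (real n powr (- e) / C)"
        by (rule divide_left_mono[OF elim(1) _ mult_pos_pos[OF lp p]]) simp
      with lp have "norm (real n powr (d - 1) / l (real n)) \<le> real n powr (d - 1) / (real n powr (- e) / C)"
        by simp
      also have "\<dots> = C * real n powr (d - 1 + e)"
        using elim C(1) powr_add[of "real n" "d - 1" e] by (simp add: powr_minus field_simps)
      finally show ?case .
    qed
    have "(\<lambda>n. C * real n powr (d - 1 + e)) \<longlonglongrightarrow> C * 0"
      by (intro tendsto_intros tendsto_neg_powr e filterlim_real_sequentially)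
    then show "(\<lambda>n. C * real n powr (d - 1 + e)) \<longlonglongrightarrow> 0" by simp
  qed
  have "(\<lambda>n. real n powr (d - 1) / l (real n) + 2 * S n) \<longlonglongrightarrow> 0 + 2 * (1 / ((1 - d) * (2 - d)))"
    unfolding S_def by (intro tendsto_intros z karamata_triangular_sum l d)
  moreover have "\<forall>\<^sub>F n in sequentially. real n powr (d - 1) / l (real n) + 2 * S n =
      (\<Sum>i=1..n. \<Sum>j=1..n. \<rho> (nat_dist i j)) / (real n powr (2 - d) * l (real n))"
    using eventually_ge_at_top[of 1]
  proof eventually_elim
    case (elim n)
    have n2: "real n powr (2 - d) = real n * real n * real n powr (- d)"
      using elim powr_add[of "real n" 2 "-d"] by (simp add: power2_eq_square)
    have n1: "real n powr (d - 1) = 1 / (real n * real n powr (- d))"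
      using elim powr_add[of "real n" "-1" "d"] by (simp add: powr_minus field_simps)
    have "S n = (\<Sum>k=1..n. (real n - real k) * \<rho> k / (real n powr (2 - d) * l (real n)))"
      unfolding S_def sum_divide_distrib
    proof (rule sum.cong[OF refl])
      fix k assume k: "k \<in> {1..n}"
      have "real n powr (- d) > 0" using elim by simp
      then show "(1 - real k / real n) * (real k / real n) powr (- d) * (l (real k) / l (real n)) / real n =
         (real n - real k) * \<rho> k / (real n powr (2 - d) * l (real n))"
        using k elim by (simp add: \<rho> n2 powr_divide field_simps)
    qed
    then have S: "2 * S n = 2 * (\<Sum>k=1..n. (real n - real k) * \<rho> k) / (real n powr (2 - d) * l (real n))"
      by (simp only: sum_divide_distrib[symmetric] times_divide_eq_right)
    have "real n powr (d - 1) / l (real n) = real n * \<rho> 0 / (real n powr (2 - d) * l (real n))"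
      using elim unfolding n1 n2 \<rho> by simp
    then show ?case unfolding S double_sum_nat_dist by (simp add: add_divide_distrib)
  qed
  ultimately have "(\<lambda>n. (\<Sum>i=1..n. \<Sum>j=1..n. \<rho> (nat_dist i j)) / (real n powr (2 - d) * l (real n)))
      \<longlonglongrightarrow> 0 + 2 * (1 / ((1 - d) * (2 - d)))" by (rule Lim_transform_eventually)
  then show ?thesis by simp
qed

lemma sum_powr_le:
  assumes b: "0 < b" "b < 1"
  shows "(\<Sum>k=1..n. real k powr (- b)) \<le> real n powr (1 - b) / (1 - b)"
proof (induction n)
  case (Suc n)
  have "(1 - b) * real (Suc n) powr (- b) \<le> real (Suc n) powr (1 - b) - real n powr (1 - b)"
  proof (cases "n = 0")
    case True
    then show ?thesis using b by simp
  next
    case False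
    obtain z where z: "real n < z" "z < real (Suc n)"
      "real (Suc n) powr (1 - b) - real n powr (1 - b) = (real (Suc n) - real n) * ((1 - b) * z powr (1 - b - 1))"
    proof -
      have "\<exists>z>real n. z < real (Suc n) \<and>
         real (Suc n) powr (1 - b) - real n powr (1 - b) = (real (Suc n) - real n) * ((1 - b) * z powr (1 - b - 1))"
        using False by (intro MVT2) (auto intro!: derivative_eq_intros)
      then show ?thesis using that by blast
    qed
    have "real (Suc n) powr (- b) \<le> z powr (- b)" using z b False by (intro powr_mono2') auto
    then show ?thesis using z(3) b by (simp add: mult_left_mono)
  qed
  then have "real (Suc n) powr (- b) \<le> real (Suc n) powr (1 - b) / (1 - b) - real n powr (1 - b) / (1 - b)"
    using b by (simp add: diff_divide_distrib[symmetric] pos_le_divide_eq mult.commute)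
  then show ?case using Suc by simp
qed simp

text \<open>Squaring doubles the decay exponent, and \<open>d < 1 / 2\<close> keeps it below 1, so
  the squared covariances still sum to a power of \<open>n\<close> and the diagonal term
  \<open>n\<close> is dominated. The loss \<open>2 * e\<close> pays for the square of the slowly
  varying factor.\<close>

lemma lrd_covariance_square_sum:
  fixes \<rho> :: "nat \<Rightarrow> real"
  assumes l: "slowly_varying l" and d: "d < 1 / 2" and e: "0 < e" "e < d"
    and \<rho>: "\<rho> 0 = 1" "\<And>k. k \<ge> 1 \<Longrightarrow> \<rho> k = real k powr (- d) * l (real k)"
  obtains C where "C > 0" 
    "\<And>n. n \<ge> 1 \<Longrightarrow> (\<Sum>i=1..n. \<Sum>j=1..n. (\<rho> (nat_dist i j))\<^sup>2) \<le> C * real n powr (2 - 2 * d + 2 * e)"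
proof -
  obtain C where C: "C > 0" "\<And>k::nat. k \<ge> 1 \<Longrightarrow> \<bar>l (real k)\<bar> \<le> C * real k powr e"
    using slowly_varying_nat_bounds[OF l e(1)] by blast
  define b where "b = 2 * d - 2 * e"
  have b: "0 < b" "b < 1" using e d by (auto simp: b_def)
  show ?thesis
  proof (rule that[of "1 + 2 * C\<^sup>2 / (1 - b)"])
    show "1 + 2 * C\<^sup>2 / (1 - b) > 0" using b by (intro add_pos_nonneg) auto
    fix n :: nat assume n: "n \<ge> 1"
    have r: "(\<rho> k)\<^sup>2 \<le> C\<^sup>2 * real k powr (- b)" if k: "k \<ge> 1" for k
    proof -
      have "\<bar>\<rho> k\<bar> \<le> real k powr (- d) * (C * real k powr e)"
        using k C(2)[OF k] by (simp add: \<rho> abs_mult mult_left_mono)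
      also have "\<dots> = C * real k powr (e - d)" using k by (simp add: powr_diff powr_minus field_simps)
      finally have "(\<rho> k)\<^sup>2 \<le> (C * real k powr (e - d))\<^sup>2" by (rule abs_le_square_iff[THEN iffD1, OF order_trans[OF _ abs_ge_self]])
      also have "\<dots> = C\<^sup>2 * real k powr (- b)"
        using k by (simp add: power_mult_distrib powr_power b_def algebra_simps)
      finally show ?thesis .
    qed
    have "(\<Sum>i=1..n. \<Sum>j=1..n. (\<rho> (nat_dist i j))\<^sup>2) = real n + 2 * (\<Sum>k=1..n. (real n - real k) * (\<rho> k)\<^sup>2)"
      using double_sum_nat_dist[of "\<lambda>k. (\<rho> k)\<^sup>2" n] \<rho> by simp
    also have "(\<Sum>k=1..n. (real n - real k) * (\<rho> k)\<^sup>2) \<le> (\<Sum>k=1..n. real n * (C\<^sup>2 * real k powr (- b)))"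
      by (intro sum_mono mult_mono r) auto
    also have "\<dots> = real n * C\<^sup>2 * (\<Sum>k=1..n. real k powr (- b))" by (simp add: sum_distrib_left mult_ac)
    also have "\<dots> \<le> real n * C\<^sup>2 * (real n powr (1 - b) / (1 - b))"
      by (intro mult_left_mono sum_powr_le b) auto
    finally have 1: "(\<Sum>i=1..n. \<Sum>j=1..n. (\<rho> (nat_dist i j))\<^sup>2) \<le> real n + 2 * (real n * C\<^sup>2 * (real n powr (1 - b) / (1 - b)))"
      by simp
    have nb: "real n * real n powr (1 - b) = real n powr (2 - b)"
      using n powr_mult_base[of "real n" "1 - b"] by simp
    have "real n = real n powr 1" using n by simp
    also have "\<dots> \<le> real n powr (2 - b)" using n b by (intro powr_mono) auto
    finally have "real n \<le> real n powr (2 - b)" .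
    with 1 have "(\<Sum>i=1..n. \<Sum>j=1..n. (\<rho> (nat_dist i j))\<^sup>2) \<le> real n powr (2 - b) + 2 * C\<^sup>2 / (1 - b) * (real n * real n powr (1 - b))"
      by (simp add: mult_ac)
    also have "\<dots> = (1 + 2 * C\<^sup>2 / (1 - b)) * real n powr (2 - b)" unfolding nb by (simp add: algebra_simps)
    also have "2 - b = 2 - 2 * d + 2 * e" by (simp add: b_def)
    finally show "(\<Sum>i=1..n. \<Sum>j=1..n. (\<rho> (nat_dist i j))\<^sup>2) \<le> (1 + 2 * C\<^sup>2 / (1 - b)) * real n powr (2 - 2 * d + 2 * e)" .
  qed
qed

lemma slowly_varying_cmult:
  assumes "slowly_varying l" "c > 0"
  shows "slowly_varying (\<lambda>x. c * l x)"
proof -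
  obtain a where a: "l \<in> borel_measurable (restrict_space borel {a..})" "\<forall>x\<ge>a. l x > 0"
    using assms(1) by (auto simp: slowly_varying_def)
  then have "(\<lambda>x. c * l x) \<in> borel_measurable (restrict_space borel {a..})" "\<forall>x\<ge>a. c * l x > 0"
    using assms(2) by auto
  moreover have "(\<lambda>x. c * l (b * x) / (c * l x)) = (\<lambda>x. l (b * x) / l x)" for b using assms(2) by auto
  ultimately show ?thesis using assms(1) unfolding slowly_varying_def by metis
qed


section \<open>Gaussian pairs\<close>

lemma integrable_mult_square:
  fixes f g :: "'a \<Rightarrow> real"
  assumes [measurable]: "f \<in> borel_measurable M" "g \<in> borel_measurable M"
    and "integrable M (\<lambda>x. (f x)\<^sup>2)" "integrable M (\<lambda>x. (g x)\<^sup>2)"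
  shows "integrable M (\<lambda>x. f x * g x)"
proof (rule Bochner_Integration.integrable_bound)
  show "integrable M (\<lambda>x. (f x)\<^sup>2 + (g x)\<^sup>2)" using assms by simp
  have "\<bar>a * b\<bar> \<le> a\<^sup>2 + b\<^sup>2" for a b :: real
  proof -
    have "2 * (\<bar>a\<bar> * \<bar>b\<bar>) \<le> a\<^sup>2 + b\<^sup>2"
      using sum_squares_bound[of "\<bar>a\<bar>" "\<bar>b\<bar>"] by (simp add: mult.assoc)
    moreover have "0 \<le> \<bar>a\<bar> * \<bar>b\<bar>" by simp
    ultimately show ?thesis unfolding abs_mult by linarith
  qed
  then show "AE x in M. norm (f x * g x) \<le> norm ((f x)\<^sup>2 + (g x)\<^sup>2)"
    by (intro AE_I2) (auto intro: order_trans[OF _ abs_ge_self])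
qed simp

lemma Cauchy_Schwarz_integral:
  fixes f g :: "'a \<Rightarrow> real"
  assumes [measurable]: "f \<in> borel_measurable M" "g \<in> borel_measurable M"
    and f: "integrable M (\<lambda>x. (f x)\<^sup>2)" and g: "integrable M (\<lambda>x. (g x)\<^sup>2)"
  shows "(\<integral>x. f x * g x \<partial>M)\<^sup>2 \<le> (\<integral>x. (f x)\<^sup>2 \<partial>M) * (\<integral>x. (g x)\<^sup>2 \<partial>M)"
proof -
  define A B C where "A = (\<integral>x. (f x)\<^sup>2 \<partial>M)" and "B = (\<integral>x. f x * g x \<partial>M)" and "C = (\<integral>x. (g x)\<^sup>2 \<partial>M)"
  note fg = integrable_mult_square[OF assms]
  have quad: "0 \<le> A + 2 * t * B + t\<^sup>2 * C" for t
  proof -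
    have "0 \<le> (\<integral>x. (f x + t * g x)\<^sup>2 \<partial>M)" by simp
    also have "\<dots> = (\<integral>x. (f x)\<^sup>2 + 2 * t * (f x * g x) + t\<^sup>2 * (g x)\<^sup>2 \<partial>M)"
      by (intro Bochner_Integration.integral_cong) (auto simp: power2_eq_square algebra_simps)
    also have "\<dots> = A + 2 * t * B + t\<^sup>2 * C" using f g fg by (simp add: A_def B_def C_def)
    finally show ?thesis .
  qed
  have AC: "A \<ge> 0" "C \<ge> 0" by (auto simp: A_def C_def)
  have "B\<^sup>2 \<le> A * C"
  proof (cases "C = 0")
    case True
    have "B = 0"
    proof (rule ccontr)
      assume "B \<noteq> 0"
      then have "2 * (- (A + 1) / (2 * B)) * B = - (A + 1)" by simp
      with quad[of "- (A + 1) / (2 * B)"] True have "0 \<le> A + - (A + 1)" by (simp only: mult_zero_right add_0_right)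
      then show False by simp
    qed
    then show ?thesis using True by simp
  next
    case False
    then show ?thesis using quad[of "- B / C"] AC by (simp add: power2_eq_square field_simps)
  qed
  then show ?thesis by (simp add: A_def B_def C_def)
qed

lemma
  fixes f :: "'a \<Rightarrow> real" and g :: "'b \<Rightarrow> real"
  assumes "sigma_finite_measure N" "sigma_finite_measure L" and f: "integrable N f" and g: "integrable L g"
  shows integrable_pair_mult: "integrable (N \<Otimes>\<^sub>M L) (\<lambda>z. f (fst z) * g (snd z))"
    and integral_pair_mult: "(\<integral>z. f (fst z) * g (snd z) \<partial>(N \<Otimes>\<^sub>M L)) = integral\<^sup>L N f * integral\<^sup>L L g"
proof -
  interpret P: pair_sigma_finite N L using assms by (simp add: pair_sigma_finite_def)
  have [measurable]: "f \<in> borel_measurable N" "g \<in> borel_measurable L" using f g by auto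
  show i: "integrable (N \<Otimes>\<^sub>M L) (\<lambda>z. f (fst z) * g (snd z))"
    by (rule P.Fubini_integrable) (use f g in \<open>auto simp: abs_mult\<close>)
  show "(\<integral>z. f (fst z) * g (snd z) \<partial>(N \<Otimes>\<^sub>M L)) = integral\<^sup>L N f * integral\<^sup>L L g"
    using P.integral_fst'[OF i] by simp
qed

section \<open>Laws determined by characteristic functions\<close>

lemma (in prob_space) distributed_normal_char:
  assumes "\<sigma> > 0" and D: "distributed M lborel Y (normal_density 0 \<sigma>)"
  shows "(CLINT \<omega>|M. iexp (t * Y \<omega>)) = complex_of_real (exp (- (t\<^sup>2 * \<sigma>\<^sup>2) / 2))"
proof -
  have [measurable]: "Y \<in> borel_measurable M" using D by (auto simp: distributed_def)
  have Z: "distributed M lborel (\<lambda>\<omega>. Y \<omega> / \<sigma>) std_normal_density"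
    using normal_standard_normal_convert[OF assms(1), of Y 0] D by simp
  have "distr M borel (\<lambda>\<omega>. Y \<omega> / \<sigma>) = std_normal_distribution"
    using Z by (auto simp: distributed_def cong: distr_cong)
  then have "char (distr M borel (\<lambda>\<omega>. Y \<omega> / \<sigma>)) (t * \<sigma>) = complex_of_real (exp (- ((t * \<sigma>)\<^sup>2) / 2))"
    by (simp add: char_std_normal_distribution)
  moreover have "char (distr M borel (\<lambda>\<omega>. Y \<omega> / \<sigma>)) (t * \<sigma>) = (CLINT \<omega>|M. iexp (t * Y \<omega>))"
    unfolding char_def using assms(1) by (subst integral_distr) auto
  ultimately show ?thesis by (simp add: power_mult_distrib)
qed

text \<open>\<open>gaussian_rv\<close> admits constants, which have no density. The characteristic
  function covers both cases at once, variance 0 included, so arguments through it need not exclude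
  degenerate combinations.\<close>

lemma (in prob_space) gaussian_rv_centered_cases:
  assumes Y: "gaussian_rv M Y" and mean: "expectation Y = 0"
  shows "integrable M (\<lambda>\<omega>. (Y \<omega>)\<^sup>2)"
    and "0 < variance Y \<Longrightarrow> distributed M lborel Y (normal_density 0 (sqrt (variance Y)))"
    and "(CLINT \<omega>|M. iexp (t * Y \<omega>)) = complex_of_real (exp (- (t\<^sup>2 * variance Y) / 2))"
proof -
  have m[measurable]: "Y \<in> borel_measurable M" using Y by (simp add: gaussian_rv_def)
  from Y obtain \<mu> where "(AE \<omega> in M. Y \<omega> = \<mu>) \<or> (\<exists>\<sigma>>0. distributed M lborel Y (normal_density \<mu> \<sigma>))"
    by (auto simp: gaussian_rv_def)
  then have "integrable M (\<lambda>\<omega>. (Y \<omega>)\<^sup>2) \<and> (0 < variance Y \<longrightarrow> distributed M lborel Y (normal_density 0 (sqrt (variance Y))))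
    \<and> (CLINT \<omega>|M. iexp (t * Y \<omega>)) = complex_of_real (exp (- (t\<^sup>2 * variance Y) / 2))"
  proof
    assume ae: "AE \<omega> in M. Y \<omega> = \<mu>"
    have "expectation Y = expectation (\<lambda>_. \<mu>)" using ae by (intro integral_cong_AE) auto
    then have "\<mu> = 0" using mean by (simp add: prob_space)
    with ae have ae: "AE \<omega> in M. Y \<omega> = 0" by simp
    have i: "integrable M (\<lambda>\<omega>. (Y \<omega>)\<^sup>2) \<longleftrightarrow> integrable M (\<lambda>\<omega>. 0::real)"
      using ae by (intro integrable_cong_AE) auto
    have v: "variance Y = expectation (\<lambda>\<omega>. 0)" unfolding mean using ae by (intro integral_cong_AE) auto
    have "(CLINT \<omega>|M. iexp (t * Y \<omega>)) = (CLINT \<omega>|M. 1)" using ae by (intro integral_cong_AE) auto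
    then show ?thesis using i v by (simp add: prob_space)
  next
    assume "\<exists>\<sigma>>0. distributed M lborel Y (normal_density \<mu> \<sigma>)"
    then obtain \<sigma> where \<sigma>: "\<sigma> > 0" and D: "distributed M lborel Y (normal_density \<mu> \<sigma>)" by blast
    have \<mu>: "\<mu> = 0" using normal_distributed_expectation[OF \<sigma> D] mean by simp
    have v: "variance Y = \<sigma>\<^sup>2" by (rule normal_distributed_variance[OF \<sigma> D])
    have "integrable M (\<lambda>\<omega>. (Y \<omega>)\<^sup>2)"
      using distributed_integrable[OF D, of "\<lambda>x. x\<^sup>2"] integrable_normal_moment[OF \<sigma>, of 0 2] \<mu> by simp
    with D \<sigma> \<mu> v distributed_normal_char[OF \<sigma>, of Y t] show ?thesis by simp
  qed
  then show "integrable M (\<lambda>\<omega>. (Y \<omega>)\<^sup>2)"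
    "0 < variance Y \<Longrightarrow> distributed M lborel Y (normal_density 0 (sqrt (variance Y)))"
    "(CLINT \<omega>|M. iexp (t * Y \<omega>)) = complex_of_real (exp (- (t\<^sup>2 * variance Y) / 2))" by auto
qed

text \<open>Weighting by \<open>q\<close> and normalising yields a new probability measure. The
  hypothesis says that \<open>U\<close> has the characteristic function of \<open>N\<close> under
  it, and Levy's uniqueness theorem identifies the law. If \<open>q\<close> has mean 0, it vanishes
  almost everywhere and both sides are 0.\<close>

lemma (in prob_space) distr_eqI_char:
  assumes [measurable]: "U \<in> borel_measurable M" and q[measurable]: "q \<in> borel_measurable M"
    and q0: "AE \<omega> in M. 0 \<le> q \<omega>" and qi: "integrable M q" and N: "real_distribution N"
    and eq: "\<And>t. (CLINT \<omega>|M. complex_of_real (q \<omega>) * iexp (t * U \<omega>)) = complex_of_real (expectation q) * char N t"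
    and A: "A \<in> sets borel"
  shows "expectation (\<lambda>\<omega>. q \<omega> * indicator A (U \<omega>)) = expectation q * measure N A"
proof (cases "expectation q = 0")
  case True
  then have "AE \<omega> in M. q \<omega> = 0" using integral_nonneg_eq_0_iff_AE[OF qi q0] by simp
  then have "expectation (\<lambda>\<omega>. q \<omega> * indicator A (U \<omega>)) = expectation (\<lambda>\<omega>. 0)"
    using A by (intro integral_cong_AE) auto
  then show ?thesis using True by simp
next
  case False
  define m where "m = expectation q"
  have "m \<ge> 0" unfolding m_def using q0 by (rule integral_nonneg_AE)
  with False have m: "m > 0" by (simp add: m_def)
  define D where "D = density M (\<lambda>\<omega>. q \<omega> / m)"
  have qm: "AE \<omega> in M. 0 \<le> q \<omega> / m" using q0 m by auto
  have [measurable_cong]: "sets D = sets M" by (simp add: D_def)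
  have "emeasure D (space D) = (\<integral>\<^sup>+\<omega>. q \<omega> / m \<partial>M)"
    by (simp add: D_def emeasure_density cong: nn_integral_cong)
  also have "\<dots> = ennreal (expectation (\<lambda>\<omega>. q \<omega> / m))"
    using qi qm by (intro nn_integral_eq_integral) auto
  also have "expectation (\<lambda>\<omega>. q \<omega> / m) = 1" using m by (simp add: m_def)
  finally have "prob_space D" by (intro prob_spaceI) simp
  then interpret D: prob_space D .
  have rd: "real_distribution (distr D borel U)" by (intro D.real_distribution_distr) simp
  have "char (distr D borel U) = char N"
  proof
    fix t
    have "char (distr D borel U) t = (CLINT \<omega>|D. iexp (t * U \<omega>))"
      unfolding char_def by (subst integral_distr) auto
    also have "\<dots> = (CLINT \<omega>|M. (q \<omega> / m) *\<^sub>R iexp (t * U \<omega>))"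
      unfolding D_def using qm by (subst integral_density) auto
    also have "\<dots> = (CLINT \<omega>|M. (complex_of_real (q \<omega>) * iexp (t * U \<omega>)) / complex_of_real m)"
      by (intro Bochner_Integration.integral_cong) (auto simp: scaleR_conv_of_real)
    also have "\<dots> = (CLINT \<omega>|M. (complex_of_real (q \<omega>) * iexp (t * U \<omega>))) / complex_of_real m" by simp
    also have "\<dots> = char N t" using m unfolding eq by (simp add: m_def)
    finally show "char (distr D borel U) t = char N t" .
  qed
  then have "distr D borel U = N" by (rule Levy_uniqueness[OF rd N])
  then have "measure N A = measure (distr D borel U) A" by simp
  also have "\<dots> = measure D (U -` A \<inter> space D)" using A by (subst measure_distr) auto
  also have "\<dots> = (\<integral>\<omega>. indicator (U -` A \<inter> space D) \<omega> \<partial>D)" using A by simp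
  also have "\<dots> = (\<integral>\<omega>. indicator A (U \<omega>) \<partial>D)"
    by (intro Bochner_Integration.integral_cong) (auto simp: indicator_def)
  also have "\<dots> = expectation (\<lambda>\<omega>. (q \<omega> / m) *\<^sub>R indicator A (U \<omega>))"
    unfolding D_def using qm A by (subst integral_density) auto
  also have "\<dots> = expectation (\<lambda>\<omega>. q \<omega> * indicator A (U \<omega>)) / m" by simp
  finally show ?thesis using m by (simp add: m_def)
qed

text \<open>Kac's criterion. The bounded weights \<open>2 + cos (s * W + c)\<close> are positive, and the hypothesis
  gives the law of \<open>U\<close> under each of them; letting \<open>s\<close> and \<open>c\<close> vary determines the
  conditional law of \<open>W\<close>.\<close>

lemma (in prob_space) distr_pair_eq_of_char:
  assumes U[measurable]: "U \<in> borel_measurable M" and W[measurable]: "W \<in> borel_measurable M"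
    and N: "real_distribution N" and L: "real_distribution L"
    and eq: "\<And>a b. (CLINT \<omega>|M. iexp (a * U \<omega> + b * W \<omega>)) = char N a * char L b"
  shows "distr M (borel \<Otimes>\<^sub>M borel) (\<lambda>\<omega>. (U \<omega>, W \<omega>)) = N \<Otimes>\<^sub>M L"
proof -
  interpret N: real_distribution N by (rule N)
  interpret L: real_distribution L by (rule L)
  have int: "integrable M (\<lambda>\<omega>. iexp (h \<omega>))" if "h \<in> borel_measurable M" for h
    using that by (intro integrable_const_bound[where B=1]) auto
  have cos_eq: "complex_of_real (cos y) = (iexp y + iexp (- y)) / 2" for y
    by (simp add: cos_of_real[symmetric] cos_exp_eq)
  have chL: "(CLINT \<omega>|M. iexp (b * W \<omega>)) = char L b" for b
    using eq[of 0 b] by (simp add: N.char_zero)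
  have chU: "(CLINT \<omega>|M. iexp (a * U \<omega>)) = char N a" for a
    using eq[of a 0] by (simp add: L.char_zero)
  have trig: "expectation (\<lambda>\<omega>. cos (s * W \<omega> + c) * indicator A (U \<omega>)) =
      expectation (\<lambda>\<omega>. cos (s * W \<omega> + c)) * measure N A" if A[measurable]: "A \<in> sets borel" for s c A
  proof -
    define q where "q \<omega> = 2 + cos (s * W \<omega> + c)" for \<omega>
    have q[measurable]: "q \<in> borel_measurable M" unfolding q_def by measurable
    have ic: "integrable M (\<lambda>\<omega>. cos (s * W \<omega> + c))"
      by (intro integrable_const_bound[where B=1]) auto
    have iA: "integrable M (\<lambda>\<omega>. indicator A (U \<omega>) :: real)"
      by (intro integrable_const_bound[where B=1]) (auto simp: indicator_def)
    have icA: "integrable M (\<lambda>\<omega>. cos (s * W \<omega> + c) * indicator A (U \<omega>))"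
      by (intro integrable_const_bound[where B=1]) (auto simp: indicator_def)
    have Eq: "expectation q = 2 + expectation (\<lambda>\<omega>. cos (s * W \<omega> + c))"
      unfolding q_def using ic by (simp add: prob_space)
    \<comment> \<open>Writing the cosine as two exponentials reduces the weighted characteristic
      function of \<open>U\<close> to the joint one at the frequencies \<open>(t, 0)\<close>,
      \<open>(t, s)\<close> and \<open>(t, - s)\<close>, where it factorises.\<close>
    have exq: "complex_of_real (q \<omega>) * iexp (t * U \<omega>) =
      2 * iexp (t * U \<omega>) + (iexp c / 2) * iexp (t * U \<omega> + s * W \<omega>) + (iexp (-c) / 2) * iexp (t * U \<omega> + (-s) * W \<omega>)" for t \<omega>
    proof -
      have e1: "iexp (s * W \<omega> + c) * iexp (t * U \<omega>) = iexp c * iexp (t * U \<omega> + s * W \<omega>)"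
        by (simp add: exp_add[symmetric] algebra_simps)
      have e2: "iexp (- (s * W \<omega> + c)) * iexp (t * U \<omega>) = iexp (-c) * iexp (t * U \<omega> + (-s) * W \<omega>)"
        by (simp add: exp_add[symmetric] algebra_simps)
      have "complex_of_real (q \<omega>) * iexp (t * U \<omega>) =
        2 * iexp (t * U \<omega>) + (iexp (s * W \<omega> + c) * iexp (t * U \<omega>) + iexp (- (s * W \<omega> + c)) * iexp (t * U \<omega>)) / 2"
        unfolding q_def of_real_add cos_eq by (simp add: algebra_simps add_divide_distrib)
      also have "\<dots> = 2 * iexp (t * U \<omega>) + (iexp c / 2) * iexp (t * U \<omega> + s * W \<omega>) + (iexp (-c) / 2) * iexp (t * U \<omega> + (-s) * W \<omega>)"
        unfolding e1 e2 by (simp add: add_divide_distrib)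
      finally show ?thesis .
    qed
    have Cq: "(CLINT \<omega>|M. complex_of_real (q \<omega>) * iexp (t * U \<omega>)) =
       2 * char N t + (iexp c / 2) * (char N t * char L s) + (iexp (-c) / 2) * (char N t * char L (-s))" for t
    proof -
      have i1: "integrable M (\<lambda>\<omega>. 2 * iexp (t * U \<omega>))"
        by (intro integrable_mult_right int) measurable
      have i2: "integrable M (\<lambda>\<omega>. (iexp c / 2) * iexp (t * U \<omega> + s * W \<omega>))"
        by (intro integrable_mult_right int) measurable
      have i3: "integrable M (\<lambda>\<omega>. (iexp (-c) / 2) * iexp (t * U \<omega> + (-s) * W \<omega>))"
        by (intro integrable_mult_right int) measurable
      show ?thesis unfolding exq
        by (subst Bochner_Integration.integral_add[OF Bochner_Integration.integrable_add[OF i1 i2] i3],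
            subst Bochner_Integration.integral_add[OF i1 i2])
           (simp only: integral_mult_right_zero eq chU)
    qed
    have "complex_of_real (expectation q) = (CLINT \<omega>|M. complex_of_real (q \<omega>) * iexp (0 * U \<omega>))"
      by simp
    then have Eq': "complex_of_real (expectation q) = 2 + (iexp c / 2) * char L s + (iexp (-c) / 2) * char L (-s)"
      unfolding Cq by (simp add: N.char_zero)
    have iq: "integrable M q" unfolding q_def using ic by simp
    have "expectation (\<lambda>\<omega>. q \<omega> * indicator A (U \<omega>)) = expectation q * measure N A"
    proof (rule distr_eqI_char[OF U q _ iq N _ A])
      show "AE \<omega> in M. 0 \<le> q \<omega>"
      proof (rule AE_I2)
        fix \<omega>
        show "0 \<le> q \<omega>" using cos_ge_minus_one[of "s * W \<omega> + c"] unfolding q_def by linarith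
      qed
      show "(CLINT \<omega>|M. complex_of_real (q \<omega>) * iexp (t * U \<omega>)) = complex_of_real (expectation q) * char N t" for t
        unfolding Cq Eq' by (simp add: algebra_simps)
    qed
    moreover have "expectation (\<lambda>\<omega>. q \<omega> * indicator A (U \<omega>)) =
        2 * expectation (\<lambda>\<omega>. indicator A (U \<omega>)) + expectation (\<lambda>\<omega>. cos (s * W \<omega> + c) * indicator A (U \<omega>))"
      unfolding q_def using iA icA by (simp add: distrib_right)
    moreover have "expectation (\<lambda>\<omega>. indicator A (U \<omega>)) = measure N A"
      using distr_eqI_char[OF U _ _ _ N _ A, of "\<lambda>_. 1"] chU by (simp add: prob_space)
    ultimately show ?thesis unfolding Eq by (simp add: algebra_simps)
  qed
  have U_law: "expectation (\<lambda>\<omega>. indicator A (U \<omega>)) = measure N A" if "A \<in> sets borel" for A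
    using trig[OF that, of 0 0] by (simp add: prob_space)
  have joint: "expectation (\<lambda>\<omega>. indicator A (U \<omega>) * indicator B (W \<omega>)) = measure N A * measure L B"
    if A[measurable]: "A \<in> sets borel" and B: "B \<in> sets borel" for A B
  proof -
    have iA: "integrable M (\<lambda>\<omega>. indicator A (U \<omega>) :: real)"
      by (intro integrable_const_bound[where B=1]) (auto simp: indicator_def)
    \<comment> \<open>The sine is a shifted cosine, so the phases 0 and \<open>- pi / 2\<close> in
      \<open>trig\<close> recover the real and imaginary parts of the exponential.\<close>
    have iexp_split: "complex_of_real r * iexp y = complex_of_real (r * cos y) + \<i> * complex_of_real (r * cos (y - pi / 2))" for r y
      by (simp add: cis_conv_exp[symmetric] complex_eq_iff cos_diff)
    have ch: "(CLINT \<omega>|M. complex_of_real (r \<omega>) * iexp (s * W \<omega>)) =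
       complex_of_real (expectation (\<lambda>\<omega>. r \<omega> * cos (s * W \<omega> + 0))) + 
       \<i> * complex_of_real (expectation (\<lambda>\<omega>. r \<omega> * cos (s * W \<omega> + (- pi / 2))))"
      if [measurable]: "r \<in> borel_measurable M" and r: "\<And>\<omega>. \<bar>r \<omega>\<bar> \<le> 1" for s r
    proof -
      have b: "\<bar>r \<omega> * cos y\<bar> \<le> 1" for \<omega> y
        using mult_mono[OF r[of \<omega>] abs_cos_le_one[of y]] by (simp add: abs_mult)
      have i: "integrable M (\<lambda>\<omega>. complex_of_real (r \<omega> * cos (s * W \<omega> + c)))" for c
        by (intro integrable_const_bound[where B=1] AE_I2) (auto simp: b simp del: of_real_mult)
      have "(CLINT \<omega>|M. complex_of_real (r \<omega>) * iexp (s * W \<omega>)) =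
        (CLINT \<omega>|M. complex_of_real (r \<omega> * cos (s * W \<omega> + 0)) + \<i> * complex_of_real (r \<omega> * cos (s * W \<omega> + (- pi / 2))))"
        unfolding iexp_split by simp
      also have "\<dots> = (CLINT \<omega>|M. complex_of_real (r \<omega> * cos (s * W \<omega> + 0))) 
          + \<i> * (CLINT \<omega>|M. complex_of_real (r \<omega> * cos (s * W \<omega> + (- pi / 2))))"
        by (subst Bochner_Integration.integral_add[OF i integrable_mult_right[OF i]]) (simp only: integral_mult_right_zero)
      finally show ?thesis by (simp only: integral_complex_of_real)
    qed
    \<comment> \<open>The roles are now exchanged: the indicator of \<open>U\<close> is the weight,
      and the law of \<open>W\<close> under it is identified.\<close>
    have "expectation (\<lambda>\<omega>. indicator A (U \<omega>) * indicator B (W \<omega>)) = 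
        expectation (\<lambda>\<omega>. indicator A (U \<omega>)) * measure L B"
    proof (rule distr_eqI_char[OF W _ _ iA L _ B])
      fix t
      have "(CLINT \<omega>|M. complex_of_real (indicator A (U \<omega>)) * iexp (t * W \<omega>)) =
        measure N A * (CLINT \<omega>|M. complex_of_real 1 * iexp (t * W \<omega>))"
      proof -
        have trig': "expectation (\<lambda>\<omega>. indicator A (U \<omega>) * cos (t * W \<omega> + c)) =
            measure N A * expectation (\<lambda>\<omega>. 1 * cos (t * W \<omega> + c))" for c
          using trig[OF A, of t c] by (simp add: mult.commute)
        have c1: "(CLINT \<omega>|M. complex_of_real (indicator A (U \<omega>)) * iexp (t * W \<omega>)) =
          complex_of_real (expectation (\<lambda>\<omega>. indicator A (U \<omega>) * cos (t * W \<omega> + 0))) + 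
          \<i> * complex_of_real (expectation (\<lambda>\<omega>. indicator A (U \<omega>) * cos (t * W \<omega> + (- pi / 2))))"
          by (rule ch) (auto simp: indicator_def)
        have c2: "(CLINT \<omega>|M. complex_of_real 1 * iexp (t * W \<omega>)) =
          complex_of_real (expectation (\<lambda>\<omega>. 1 * cos (t * W \<omega> + 0))) + 
          \<i> * complex_of_real (expectation (\<lambda>\<omega>. 1 * cos (t * W \<omega> + (- pi / 2))))"
          by (rule ch) auto
        show ?thesis unfolding c1 c2 trig' by (simp add: algebra_simps)
      qed
      then show "(CLINT \<omega>|M. complex_of_real (indicator A (U \<omega>)) * iexp (t * W \<omega>)) =
         complex_of_real (expectation (\<lambda>\<omega>. indicator A (U \<omega>))) * char L t"
        unfolding U_law[OF A] by (simp only: of_real_1 mult_1 chL)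
    qed auto
    then show ?thesis unfolding U_law[OF A] .
  qed
  have "N \<Otimes>\<^sub>M L = distr M (borel \<Otimes>\<^sub>M borel) (\<lambda>\<omega>. (U \<omega>, W \<omega>))"
  proof (rule pair_measure_eqI)
    show "sigma_finite_measure N" "sigma_finite_measure L" by unfold_locales
    show "sets (N \<Otimes>\<^sub>M L) = sets (distr M (borel \<Otimes>\<^sub>M borel) (\<lambda>\<omega>. (U \<omega>, W \<omega>)))"
      by (simp cong: sets_pair_measure_cong)
    fix A B assume "A \<in> sets N" "B \<in> sets L"
    then have AB[measurable]: "A \<in> sets borel" "B \<in> sets borel" by auto
    have "emeasure (distr M (borel \<Otimes>\<^sub>M borel) (\<lambda>\<omega>. (U \<omega>, W \<omega>))) (A \<times> B) =
        emeasure M ((\<lambda>\<omega>. (U \<omega>, W \<omega>)) -` (A \<times> B) \<inter> space M)"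
      by (intro emeasure_distr) auto
    also have "\<dots> = ennreal (prob ((\<lambda>\<omega>. (U \<omega>, W \<omega>)) -` (A \<times> B) \<inter> space M))"
      by (rule emeasure_eq_measure)
    also have "prob ((\<lambda>\<omega>. (U \<omega>, W \<omega>)) -` (A \<times> B) \<inter> space M) =
       expectation (indicator ((\<lambda>\<omega>. (U \<omega>, W \<omega>)) -` (A \<times> B) \<inter> space M))"
      by (simp add: Int_absorb2)
    also have "\<dots> = expectation (\<lambda>\<omega>. indicator A (U \<omega>) * indicator B (W \<omega>))"
      by (intro Bochner_Integration.integral_cong) (auto simp: indicator_def)
    also have "\<dots> = measure N A * measure L B" by (rule joint[OF AB])
    finally show "emeasure N A * emeasure L B =
        emeasure (distr M (borel \<Otimes>\<^sub>M borel) (\<lambda>\<omega>. (U \<omega>, W \<omega>))) (A \<times> B)"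
      by (simp add: N.emeasure_eq_measure L.emeasure_eq_measure ennreal_mult')
  qed
  then show ?thesis ..
qed

section \<open>The density of a correlated Gaussian pair\<close>

text \<open>The density of a standard Gaussian pair with correlation \<rho> relative to the product
  of its marginals: given the first coordinate \<open>u\<close>, the second is normal with mean
  \<open>\<rho> * u\<close> and variance \<open>1 - \<rho>\<^sup>2\<close>. Its expansion in Hermite
  polynomials is Mehler's formula.\<close>

abbreviation (input) "mehler_kernel \<rho> \<equiv>
  (\<lambda>z. normal_density (\<rho> * fst z) (sqrt (1 - \<rho>\<^sup>2)) (snd z) / std_normal_density (snd z))"

lemma borel_measurable_normal_density_mean[measurable (raw)]:
  assumes [measurable]: "m \<in> borel_measurable M" "x \<in> borel_measurable M"
  shows "(\<lambda>z. normal_density (m z) \<sigma> (x z)) \<in> borel_measurable M"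
  unfolding normal_density_def by measurable

lemma char_normal_density:
  assumes "\<sigma> > 0"
  shows "char (density lborel (normal_density 0 \<sigma>)) t = complex_of_real (exp (- (t\<^sup>2 * \<sigma>\<^sup>2) / 2))"
proof -
  interpret prob_space "density lborel (normal_density 0 \<sigma>)"
    by (rule prob_space_normal_density[OF assms])
  have "distr (density lborel (normal_density 0 \<sigma>)) lborel (\<lambda>x. x) = density lborel (normal_density 0 \<sigma>)"
    by (rule distr_id2) simp
  then have "distributed (density lborel (normal_density 0 \<sigma>)) lborel (\<lambda>x. x) (normal_density 0 \<sigma>)"
    by (simp add: distributed_def)
  from distributed_normal_char[OF assms this, of t] show ?thesis by (simp add: char_def)
qed

lemma real_distribution_normal_density:
  assumes "\<sigma> > 0"
  shows "real_distribution (density lborel (normal_density 0 \<sigma>))"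
  using prob_space_normal_density[OF assms] 
  by (auto simp: real_distribution_def real_distribution_axioms_def)

text \<open>\<open>W = V - \<rho> * U\<close> is uncorrelated with \<open>U\<close>, so the joint
  characteristic function of \<open>(U, W)\<close> factorises and the two are independent. The shear
  back to \<open>(U, V)\<close> is, for fixed \<open>u\<close>, a translation of the second variable
  and leaves Lebesgue measure unchanged.\<close>

lemma (in prob_space) gaussian_pair_density:
  assumes U[measurable]: "U \<in> borel_measurable M" and V[measurable]: "V \<in> borel_measurable M"
    and \<rho>: "\<rho>\<^sup>2 < 1"
    and ch: "\<And>a b. (CLINT \<omega>|M. iexp (a * U \<omega> + b * V \<omega>)) =
        complex_of_real (exp (- (a\<^sup>2 + b\<^sup>2 + 2 * \<rho> * a * b) / 2))"
  shows "distr M (borel \<Otimes>\<^sub>M borel) (\<lambda>\<omega>. (U \<omega>, V \<omega>)) =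
     density (std_normal_distribution \<Otimes>\<^sub>M std_normal_distribution) (mehler_kernel \<rho>)"
proof -
  define \<tau> where "\<tau> = sqrt (1 - \<rho>\<^sup>2)"
  have \<tau>: "\<tau> > 0" "\<tau>\<^sup>2 = 1 - \<rho>\<^sup>2" using \<rho> by (auto simp: \<tau>_def)
  let ?N = "std_normal_distribution"
  define L where "L = density lborel (normal_density 0 \<tau>)"
  define W where "W \<omega> = V \<omega> - \<rho> * U \<omega>" for \<omega>
  have [measurable]: "W \<in> borel_measurable M" unfolding W_def by measurable
  have rN: "real_distribution ?N" by (rule real_dist_normal_dist)
  have rL: "real_distribution L" unfolding L_def by (rule real_distribution_normal_density[OF \<tau>(1)])
  interpret N: real_distribution ?N by (rule rN)
  interpret L: real_distribution L by (rule rL)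
  have [measurable_cong]: "sets L = sets borel" by simp
  have joint: "distr M (borel \<Otimes>\<^sub>M borel) (\<lambda>\<omega>. (U \<omega>, W \<omega>)) = ?N \<Otimes>\<^sub>M L"
  proof (rule distr_pair_eq_of_char[OF _ _ rN rL])
    fix a b
    have "(CLINT \<omega>|M. iexp (a * U \<omega> + b * W \<omega>)) = (CLINT \<omega>|M. iexp ((a - b * \<rho>) * U \<omega> + b * V \<omega>))"
      unfolding W_def by (intro Bochner_Integration.integral_cong) (auto simp: algebra_simps)
    also have "\<dots> = complex_of_real (exp (- ((a - b * \<rho>)\<^sup>2 + b\<^sup>2 + 2 * \<rho> * (a - b * \<rho>) * b) / 2))" by (rule ch)
    also have "- ((a - b * \<rho>)\<^sup>2 + b\<^sup>2 + 2 * \<rho> * (a - b * \<rho>) * b) / 2 = - (a\<^sup>2) / 2 + - (b\<^sup>2 * \<tau>\<^sup>2) / 2"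
      unfolding \<tau>(2) by (simp add: power2_eq_square algebra_simps add_divide_distrib diff_divide_distrib)
    also have "complex_of_real (exp (- (a\<^sup>2) / 2 + - (b\<^sup>2 * \<tau>\<^sup>2) / 2)) = char ?N a * char L b"
      unfolding L_def char_normal_density[OF \<tau>(1)] char_std_normal_distribution exp_add of_real_mult ..
    finally show "(CLINT \<omega>|M. iexp (a * U \<omega> + b * W \<omega>)) = char ?N a * char L b" .
  qed auto
  show ?thesis
  proof (rule measure_eqI)
    show "sets (distr M (borel \<Otimes>\<^sub>M borel) (\<lambda>\<omega>. (U \<omega>, V \<omega>))) = sets (density (?N \<Otimes>\<^sub>M ?N) (mehler_kernel \<rho>))"
      by (simp cong: sets_pair_measure_cong)
    fix S assume "S \<in> sets (distr M (borel \<Otimes>\<^sub>M borel) (\<lambda>\<omega>. (U \<omega>, V \<omega>)))"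
    then have S[measurable]: "S \<in> sets (borel \<Otimes>\<^sub>M borel)" by simp
    then have S'[measurable]: "S \<in> sets (?N \<Otimes>\<^sub>M ?N)" by (simp cong: sets_pair_measure_cong)
    have UV: "(\<lambda>\<omega>. (U \<omega>, V \<omega>)) = (\<lambda>z. (fst z, \<rho> * fst z + snd z)) \<circ> (\<lambda>\<omega>. (U \<omega>, W \<omega>))"
      by (auto simp: W_def)
    have "distr M (borel \<Otimes>\<^sub>M borel) (\<lambda>\<omega>. (U \<omega>, V \<omega>)) =
       distr (distr M (borel \<Otimes>\<^sub>M borel) (\<lambda>\<omega>. (U \<omega>, W \<omega>))) (borel \<Otimes>\<^sub>M borel) (\<lambda>z. (fst z, \<rho> * fst z + snd z))"
      unfolding UV by (rule distr_distr[symmetric]) measurable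
    then have "emeasure (distr M (borel \<Otimes>\<^sub>M borel) (\<lambda>\<omega>. (U \<omega>, V \<omega>))) S =
       (\<integral>\<^sup>+z. indicator S z \<partial>(distr (?N \<Otimes>\<^sub>M L) (borel \<Otimes>\<^sub>M borel) (\<lambda>z. (fst z, \<rho> * fst z + snd z))))"
      unfolding joint by (simp add: S)
    also have "\<dots> = (\<integral>\<^sup>+z. indicator S (fst z, \<rho> * fst z + snd z) \<partial>(?N \<Otimes>\<^sub>M L))"
      by (rule nn_integral_distr) measurable
    also have "\<dots> = (\<integral>\<^sup>+u. \<integral>\<^sup>+w. indicator S (u, \<rho> * u + w) \<partial>L \<partial>?N)"
      by (subst L.nn_integral_fst[symmetric]) simp_all
    also have "\<dots> = (\<integral>\<^sup>+u. \<integral>\<^sup>+v. ennreal (normal_density (\<rho> * u) \<tau> v / std_normal_density v) * indicator S (u, v) \<partial>?N \<partial>?N)"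
    proof (rule nn_integral_cong)
      fix u :: real
      have "(\<integral>\<^sup>+w. indicator S (u, \<rho> * u + w) \<partial>L) = (\<integral>\<^sup>+w. ennreal (normal_density 0 \<tau> w) * indicator S (u, \<rho> * u + w) \<partial>lborel)"
        unfolding L_def by (rule nn_integral_density) measurable
      also have "\<dots> = (\<integral>\<^sup>+v. ennreal (normal_density 0 \<tau> (- \<rho> * u + 1 * v)) * indicator S (u, \<rho> * u + (- \<rho> * u + 1 * v)) \<partial>lborel)"
        by (subst nn_integral_real_affine[where c=1 and t="- \<rho> * u"]) auto
      also have "\<dots> = (\<integral>\<^sup>+v. ennreal (std_normal_density v) * (ennreal (normal_density (\<rho> * u) \<tau> v / std_normal_density v) * indicator S (u, v)) \<partial>lborel)"
      proof (rule nn_integral_cong)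
        fix v :: real
        have "std_normal_density v > 0" by (rule normal_density_pos) simp
        then have "ennreal (std_normal_density v) * ennreal (normal_density (\<rho> * u) \<tau> v / std_normal_density v) = ennreal (normal_density (\<rho> * u) \<tau> v)"
          by (subst ennreal_mult[symmetric]) (auto simp: less_imp_le)
        moreover have "normal_density 0 \<tau> (- \<rho> * u + 1 * v) = normal_density (\<rho> * u) \<tau> v"
          by (simp add: normal_density_def power2_commute algebra_simps)
        ultimately show "ennreal (normal_density 0 \<tau> (- \<rho> * u + 1 * v)) * indicator S (u, \<rho> * u + (- \<rho> * u + 1 * v)) =
          ennreal (std_normal_density v) * (ennreal (normal_density (\<rho> * u) \<tau> v / std_normal_density v) * indicator S (u, v))"
          by (simp add: mult.assoc[symmetric])
      qed
      also have "\<dots> = (\<integral>\<^sup>+v. ennreal (normal_density (\<rho> * u) \<tau> v / std_normal_density v) * indicator S (u, v) \<partial>?N)"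
        by (rule nn_integral_density[symmetric]) measurable
      finally show "(\<integral>\<^sup>+w. indicator S (u, \<rho> * u + w) \<partial>L) = \<dots>" .
    qed
    also have "\<dots> = (\<integral>\<^sup>+z. ennreal (mehler_kernel \<rho> z) * indicator S z \<partial>(?N \<Otimes>\<^sub>M ?N))"
      unfolding \<tau>_def by (subst N.nn_integral_fst[symmetric]) simp_all
    also have "\<dots> = emeasure (density (?N \<Otimes>\<^sub>M ?N) (mehler_kernel \<rho>)) S"
      by (rule emeasure_density[symmetric]) measurable
    finally show "emeasure (distr M (borel \<Otimes>\<^sub>M borel) (\<lambda>\<omega>. (U \<omega>, V \<omega>))) S =
        emeasure (density (?N \<Otimes>\<^sub>M ?N) (mehler_kernel \<rho>)) S" .
  qed
qed

lemma nn_integral_normal_density: "\<sigma> > 0 \<Longrightarrow> (\<integral>\<^sup>+x. ennreal (normal_density \<mu> \<sigma> x) \<partial>lborel) = 1"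
  by (subst nn_integral_eq_integral) auto

text \<open>Integrating one variable at a time, each integrand becomes a multiple of a normal
  density after completing the square. In Mehler's expansion the value is the sum of the squared
  coefficients \<open>\<rho> ^ k\<close>.\<close>

lemma nn_integral_mehler_kernel_sq:
  assumes \<rho>: "\<rho>\<^sup>2 < 1"
  shows "(\<integral>\<^sup>+z. ennreal ((mehler_kernel \<rho> z)\<^sup>2) \<partial>(std_normal_distribution \<Otimes>\<^sub>M std_normal_distribution)) =
    ennreal (1 / (1 - \<rho>\<^sup>2))"
proof -
  define \<tau> s where "\<tau> = sqrt (1 - \<rho>\<^sup>2)" and "s = sqrt (1 + \<rho>\<^sup>2)"
  have \<tau>: "\<tau> > 0" "\<tau>\<^sup>2 = 1 - \<rho>\<^sup>2" using \<rho> by (auto simp: \<tau>_def)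
  have s: "s > 0" "s\<^sup>2 = 1 + \<rho>\<^sup>2" by (auto simp: s_def add_pos_nonneg)
  let ?N = "std_normal_distribution"
  interpret N: real_distribution ?N by (rule real_dist_normal_dist)
  have pt: "std_normal_density v * (normal_density (\<rho> * u) \<tau> v / std_normal_density v)\<^sup>2 =
     exp (\<rho>\<^sup>2 * u\<^sup>2 / s\<^sup>2) / (\<tau> * s) * normal_density (2 * \<rho> * u / s\<^sup>2) (\<tau> / s) v" for u v
  proof -
    have "std_normal_density v > 0" by (rule normal_density_pos) simp
    then have "std_normal_density v * (normal_density (\<rho> * u) \<tau> v / std_normal_density v)\<^sup>2
      = (normal_density (\<rho> * u) \<tau> v)\<^sup>2 / std_normal_density v"
      by (simp add: power2_eq_square field_simps)
    also have "\<dots> = (1 / (\<tau>\<^sup>2 * sqrt (2 * pi))) * (exp (- (v - \<rho> * u)\<^sup>2 / (2 * \<tau>\<^sup>2)) * exp (- (v - \<rho> * u)\<^sup>2 / (2 * \<tau>\<^sup>2)) / exp (- v\<^sup>2 / 2))"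
      using \<tau>(1) unfolding normal_density_def
      by (simp add: power_mult_distrib power_divide real_sqrt_mult power2_eq_square field_simps)
    also have "exp (- (v - \<rho> * u)\<^sup>2 / (2 * \<tau>\<^sup>2)) * exp (- (v - \<rho> * u)\<^sup>2 / (2 * \<tau>\<^sup>2)) / exp (- v\<^sup>2 / 2)
       = exp (- (v - \<rho> * u)\<^sup>2 / (2 * \<tau>\<^sup>2) + - (v - \<rho> * u)\<^sup>2 / (2 * \<tau>\<^sup>2) - - v\<^sup>2 / 2)"
      by (simp only: exp_add exp_diff)
    also have "- (v - \<rho> * u)\<^sup>2 / (2 * \<tau>\<^sup>2) + - (v - \<rho> * u)\<^sup>2 / (2 * \<tau>\<^sup>2) - - v\<^sup>2 / 2 =
       \<rho>\<^sup>2 * u\<^sup>2 / s\<^sup>2 + - (v - 2 * \<rho> * u / s\<^sup>2)\<^sup>2 / (2 * (\<tau> / s)\<^sup>2)"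
    proof -
      have nz: "1 - \<rho>\<^sup>2 \<noteq> 0" "1 + \<rho>\<^sup>2 \<noteq> 0" using \<tau> s by auto
      \<comment> \<open>With \<open>a\<close> for the square, the identity is one of rational
        functions with denominators \<open>1 - a\<close> and \<open>1 + a\<close>, and \<rho> itself
        remains only in the cross terms.\<close>
      define a where "a = \<rho>\<^sup>2"
      have a: "1 - a \<noteq> 0" "1 + a \<noteq> 0" using nz by (auto simp: a_def)
      have "- (v - \<rho> * u)\<^sup>2 / (2 * (1 - a)) + - (v - \<rho> * u)\<^sup>2 / (2 * (1 - a)) - - v\<^sup>2 / 2
          = (- 2 * (v\<^sup>2 - 2 * v * \<rho> * u + a * u\<^sup>2) + (1 - a) * v\<^sup>2) / (2 * (1 - a))"
        using a by (simp add: divide_simps a_def) (simp add: power2_eq_square algebra_simps)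
      also have "\<dots> = a * u\<^sup>2 / (1 + a) + - ((1 + a)\<^sup>2 * v\<^sup>2 - 4 * v * \<rho> * u * (1 + a) + 4 * a * u\<^sup>2) / (2 * (1 - a) * (1 + a))"
        using a by (simp add: divide_simps) (simp add: power2_eq_square algebra_simps)
      also have "- ((1 + a)\<^sup>2 * v\<^sup>2 - 4 * v * \<rho> * u * (1 + a) + 4 * a * u\<^sup>2) / (2 * (1 - a) * (1 + a)) =
         - (v - 2 * \<rho> * u / (1 + a))\<^sup>2 / (2 * ((1 - a) / (1 + a)))"
      proof -
        have "(v - 2 * \<rho> * u / (1 + a)) = ((1 + a) * v - 2 * \<rho> * u) / (1 + a)" using a by (simp add: field_simps)
        moreover have "(1 + a)\<^sup>2 * v\<^sup>2 - 4 * v * \<rho> * u * (1 + a) + 4 * a * u\<^sup>2 = ((1 + a) * v - 2 * \<rho> * u)\<^sup>2"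
          by (simp add: a_def power2_eq_square algebra_simps)
        ultimately show ?thesis using a by (simp add: power_divide power2_eq_square)
      qed
      finally show ?thesis unfolding power_divide \<tau> s a_def .
    qed
    also have "exp (\<rho>\<^sup>2 * u\<^sup>2 / s\<^sup>2 + - (v - 2 * \<rho> * u / s\<^sup>2)\<^sup>2 / (2 * (\<tau> / s)\<^sup>2)) =
        exp (\<rho>\<^sup>2 * u\<^sup>2 / s\<^sup>2) * exp (- (v - 2 * \<rho> * u / s\<^sup>2)\<^sup>2 / (2 * (\<tau> / s)\<^sup>2))" by (rule exp_add)
    also have "1 / (\<tau>\<^sup>2 * sqrt (2 * pi)) * (exp (\<rho>\<^sup>2 * u\<^sup>2 / s\<^sup>2) * exp (- (v - 2 * \<rho> * u / s\<^sup>2)\<^sup>2 / (2 * (\<tau> / s)\<^sup>2))) =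
       exp (\<rho>\<^sup>2 * u\<^sup>2 / s\<^sup>2) / (\<tau> * s) * normal_density (2 * \<rho> * u / s\<^sup>2) (\<tau> / s) v"
    proof -
      have "sqrt (2 * pi * (\<tau> / s)\<^sup>2) = sqrt (2 * pi) * (\<tau> / s)"
        using \<tau> s by (simp add: real_sqrt_mult)
      then show ?thesis unfolding normal_density_def using \<tau>(1) s(1)
        by (simp add: power2_eq_square field_simps)
    qed
    finally show ?thesis .
  qed
  \<comment> \<open>The standard density outweighs the growing exponential because
    \<open>\<rho>\<^sup>2 / (1 + \<rho>\<^sup>2) < 1 / 2\<close>, which is equivalent to
    \<open>\<rho>\<^sup>2 < 1\<close>.\<close>
  have pu: "ennreal (std_normal_density u) * ennreal (exp (\<rho>\<^sup>2 * u\<^sup>2 / s\<^sup>2) / (\<tau> * s)) = ennreal (1 / \<tau>\<^sup>2) * ennreal (normal_density 0 (s / \<tau>) u)" for u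
  proof -
    have "- u\<^sup>2 / 2 + \<rho>\<^sup>2 * u\<^sup>2 / s\<^sup>2 = - (u\<^sup>2 * \<tau>\<^sup>2) / (2 * s\<^sup>2)"
    proof -
      define a where "a = \<rho>\<^sup>2"
      have "1 + a > 0" by (simp add: a_def add_pos_nonneg)
      then show ?thesis unfolding \<tau> s unfolding a_def[symmetric] by (simp add: field_simps)
    qed
    then have e: "exp (- u\<^sup>2 / 2) * exp (\<rho>\<^sup>2 * u\<^sup>2 / s\<^sup>2) = exp (- (u\<^sup>2 * \<tau>\<^sup>2) / (2 * s\<^sup>2))"
      by (simp only: exp_add[symmetric])
    have "sqrt (2 * pi * (s / \<tau>)\<^sup>2) = sqrt (2 * pi) * (s / \<tau>)" using \<tau> s by (simp add: real_sqrt_mult)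
    then have "1 / \<tau>\<^sup>2 * normal_density 0 (s / \<tau>) u = 1 / (sqrt (2 * pi) * \<tau> * s) * exp (- (u\<^sup>2 * \<tau>\<^sup>2) / (2 * s\<^sup>2))"
      unfolding normal_density_def using \<tau>(1) s(1) by (simp add: power2_eq_square field_simps)
    also have "\<dots> = std_normal_density u * (exp (\<rho>\<^sup>2 * u\<^sup>2 / s\<^sup>2) / (\<tau> * s))"
      unfolding e[symmetric] std_normal_density_def by (simp add: field_simps)
    finally show ?thesis using \<tau>(1) s(1) by (subst (1 2) ennreal_mult[symmetric]) auto
  qed
  have "(\<integral>\<^sup>+z. ennreal ((mehler_kernel \<rho> z)\<^sup>2) \<partial>(?N \<Otimes>\<^sub>M ?N)) =
     (\<integral>\<^sup>+u. \<integral>\<^sup>+v. ennreal ((normal_density (\<rho> * u) \<tau> v / std_normal_density v)\<^sup>2) \<partial>?N \<partial>?N)"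
    unfolding \<tau>_def by (subst N.nn_integral_fst[symmetric]) simp_all
  also have "\<dots> = (\<integral>\<^sup>+u. ennreal (exp (\<rho>\<^sup>2 * u\<^sup>2 / s\<^sup>2) / (\<tau> * s)) \<partial>?N)"
  proof (rule nn_integral_cong)
    fix u :: real
    have "(\<integral>\<^sup>+v. ennreal ((normal_density (\<rho> * u) \<tau> v / std_normal_density v)\<^sup>2) \<partial>?N) =
      (\<integral>\<^sup>+v. ennreal (std_normal_density v) * ennreal ((normal_density (\<rho> * u) \<tau> v / std_normal_density v)\<^sup>2) \<partial>lborel)"
      by (rule nn_integral_density) measurable
    also have "\<dots> = (\<integral>\<^sup>+v. ennreal (exp (\<rho>\<^sup>2 * u\<^sup>2 / s\<^sup>2) / (\<tau> * s)) * ennreal (normal_density (2 * \<rho> * u / s\<^sup>2) (\<tau> / s) v) \<partial>lborel)"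
      using \<tau>(1) s(1) by (intro nn_integral_cong) (simp add: ennreal_mult[symmetric] pt)
    also have "\<dots> = ennreal (exp (\<rho>\<^sup>2 * u\<^sup>2 / s\<^sup>2) / (\<tau> * s))"
      using \<tau>(1) s(1) by (subst nn_integral_cmult) (auto simp: nn_integral_normal_density)
    finally show "(\<integral>\<^sup>+v. ennreal ((normal_density (\<rho> * u) \<tau> v / std_normal_density v)\<^sup>2) \<partial>?N) = \<dots>" .
  qed
  also have "\<dots> = (\<integral>\<^sup>+u. ennreal (std_normal_density u) * ennreal (exp (\<rho>\<^sup>2 * u\<^sup>2 / s\<^sup>2) / (\<tau> * s)) \<partial>lborel)"
    by (rule nn_integral_density) measurable
  also have "\<dots> = ennreal (1 / \<tau>\<^sup>2)"
    unfolding pu using \<tau>(1) s(1) by (subst nn_integral_cmult) (auto simp: nn_integral_normal_density)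
  finally show ?thesis by (simp add: \<tau>)
qed

text \<open>Against functions orthogonal to \<open>1\<close> and \<open>x\<close> the density \<open>k\<close> of the pair may be replaced with
  \<open>k - 1 - \<rho> x y\<close>, whose squared norm is \<open>1 / (1 - \<rho>\<^sup>2) - 1 - \<rho>\<^sup>2 = \<rho>\<^sup>4 / (1 - \<rho>\<^sup>2)\<close>. This avoids the
  completeness of the Hermite polynomials. For \<open>\<bar>\<rho>\<bar> > 1 / 2\<close>, where the density may not exist, the
  Cauchy-Schwarz inequality is enough.\<close>

lemma (in prob_space) gaussian_pair_orthogonal_bound:
  fixes \<phi> :: "real \<Rightarrow> real"
  assumes U[measurable]: "U \<in> borel_measurable M" and V[measurable]: "V \<in> borel_measurable M"
    and ch: "\<And>a b. (CLINT \<omega>|M. iexp (a * U \<omega> + b * V \<omega>)) =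
        complex_of_real (exp (- (a\<^sup>2 + b\<^sup>2 + 2 * \<rho> * a * b) / 2))"
    and \<rho>: "expectation (\<lambda>\<omega>. U \<omega> * V \<omega>) = \<rho>"
    and \<phi>[measurable]: "\<phi> \<in> borel_measurable borel"
    and \<phi>2: "integrable std_normal_distribution (\<lambda>x. (\<phi> x)\<^sup>2)"
    and \<phi>0: "(\<integral>x. \<phi> x \<partial>std_normal_distribution) = 0"
    and \<phi>1: "(\<integral>x. x * \<phi> x \<partial>std_normal_distribution) = 0"
  shows "\<bar>expectation (\<lambda>\<omega>. \<phi> (U \<omega>) * \<phi> (V \<omega>))\<bar> \<le> 4 * \<rho>\<^sup>2 * (\<integral>x. (\<phi> x)\<^sup>2 \<partial>std_normal_distribution)"
proof -
  let ?N = "std_normal_distribution"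
  interpret N: real_distribution ?N by (rule real_dist_normal_dist)
  define s where "s = (\<integral>x. (\<phi> x)\<^sup>2 \<partial>?N)"
  have s0: "s \<ge> 0" by (simp add: s_def)
  have law: "distr M borel Y = ?N" if [measurable]: "Y \<in> borel_measurable M"
    and Y: "\<And>t. (CLINT \<omega>|M. iexp (t * Y \<omega>)) = complex_of_real (exp (- (t\<^sup>2) / 2))" for Y
  proof (rule Levy_uniqueness)
    show "real_distribution (distr M borel Y)" by (rule real_distribution_distr) simp
    show "real_distribution ?N" by (rule real_dist_normal_dist)
    show "char (distr M borel Y) = char ?N"
      unfolding char_std_normal_distribution
    proof
      fix t
      have "char (distr M borel Y) t = (CLINT \<omega>|M. iexp (t * Y \<omega>))"
        unfolding char_def by (subst integral_distr) auto
      then show "char (distr M borel Y) t = complex_of_real (exp (- (t\<^sup>2) / 2))" unfolding Y .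
    qed
  qed
  have lU: "distr M borel U = ?N" using ch[of _ 0] by (intro law) auto
  have lV: "distr M borel V = ?N" using ch[of 0] by (intro law) auto
  show ?thesis
  proof (cases "\<rho>\<^sup>2 \<le> 1 / 4")
    case False
    have iU: "integrable M (\<lambda>\<omega>. (\<phi> (U \<omega>))\<^sup>2)" "expectation (\<lambda>\<omega>. (\<phi> (U \<omega>))\<^sup>2) = s"
      using \<phi>2 unfolding s_def lU[symmetric] by (auto simp: integrable_distr_eq integral_distr)
    have iV: "integrable M (\<lambda>\<omega>. (\<phi> (V \<omega>))\<^sup>2)" "expectation (\<lambda>\<omega>. (\<phi> (V \<omega>))\<^sup>2) = s"
      using \<phi>2 unfolding s_def lV[symmetric] by (auto simp: integrable_distr_eq integral_distr)
    have "(expectation (\<lambda>\<omega>. \<phi> (U \<omega>) * \<phi> (V \<omega>)))\<^sup>2 \<le> s * s"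
      using Cauchy_Schwarz_integral[OF _ _ iU(1) iV(1)] iU(2) iV(2) by simp
    then have "\<bar>expectation (\<lambda>\<omega>. \<phi> (U \<omega>) * \<phi> (V \<omega>))\<bar> \<le> s"
      using s0 abs_le_square_iff[of _ s] by (simp add: power2_eq_square)
    \<comment> \<open>This case fixes the constant: \<open>\<rho>\<^sup>2 > 1 / 4\<close> means
      \<open>1 < 4 * \<rho>\<^sup>2\<close>.\<close>
    also have "\<dots> \<le> 4 * \<rho>\<^sup>2 * s" using False s0 mult_right_mono[of 1 "4 * \<rho>\<^sup>2" s] by simp
    finally show ?thesis by (simp add: s_def)
  next
    case True
    let ?G = "?N \<Otimes>\<^sub>M ?N"
    define k where "k z = mehler_kernel \<rho> z" for z
    define p where "p z = \<phi> (fst z) * \<phi> (snd z)" for z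
    have \<rho>1: "\<rho>\<^sup>2 < 1" using True by simp
    have k[measurable]: "k \<in> borel_measurable (borel \<Otimes>\<^sub>M borel)" unfolding k_def by measurable
    have p[measurable]: "p \<in> borel_measurable (borel \<Otimes>\<^sub>M borel)" unfolding p_def by measurable
    have setsG[measurable_cong]: "sets ?G = sets (borel \<Otimes>\<^sub>M borel)" by (simp cong: sets_pair_measure_cong)
    have k0: "k z \<ge> 0" for z by (simp add: k_def)
    have joint: "distr M (borel \<Otimes>\<^sub>M borel) (\<lambda>\<omega>. (U \<omega>, V \<omega>)) = density ?G k"
      using gaussian_pair_density[OF U V \<rho>1 ch] by (simp add: k_def[abs_def])
    have sfN: "sigma_finite_measure ?N" by unfold_locales
    interpret G: pair_prob_space ?N ?N by unfold_locales
    have trans_int: "integrable ?G (\<lambda>z. k z * F z) \<longleftrightarrow> integrable M (\<lambda>\<omega>. F (U \<omega>, V \<omega>))"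
      and trans_eq: "(\<integral>z. k z * F z \<partial>?G) = expectation (\<lambda>\<omega>. F (U \<omega>, V \<omega>))"
      if [measurable]: "F \<in> borel_measurable (borel \<Otimes>\<^sub>M borel)" for F :: "real \<times> real \<Rightarrow> real"
    proof -
      have "integrable ?G (\<lambda>z. k z * F z) \<longleftrightarrow> integrable (density ?G k) F"
        using k0 by (subst integrable_density) auto
      also have "\<dots> \<longleftrightarrow> integrable M (\<lambda>\<omega>. F (U \<omega>, V \<omega>))"
        unfolding joint[symmetric] by (subst integrable_distr_eq) auto
      finally show "integrable ?G (\<lambda>z. k z * F z) \<longleftrightarrow> integrable M (\<lambda>\<omega>. F (U \<omega>, V \<omega>))" .
      have "(\<integral>z. k z * F z \<partial>?G) = (\<integral>z. F z \<partial>density ?G k)"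
        using k0 by (subst integral_density) auto
      also have "\<dots> = expectation (\<lambda>\<omega>. F (U \<omega>, V \<omega>))"
        unfolding joint[symmetric] by (subst integral_distr) auto
      finally show "(\<integral>z. k z * F z \<partial>?G) = expectation (\<lambda>\<omega>. F (U \<omega>, V \<omega>))" .
    qed
    have ix2: "integrable ?N (\<lambda>x. x\<^sup>2)" "(\<integral>x. x\<^sup>2 \<partial>?N) = 1"
      using std_normal_distribution_even_moments[of 1] by simp_all
    have ix: "integrable ?N (\<lambda>x. x)" "(\<integral>x. x \<partial>?N) = 0"
      using integrable_std_normal_distribution_moment[of 1] integral_std_normal_distribution_moment_odd[of 1] by simp_all
    have i\<phi>: "integrable ?N \<phi>" using N.square_integrable_imp_integrable[OF _ \<phi>2] by simp
    have ix\<phi>: "integrable ?N (\<lambda>x. x * \<phi> x)" by (rule integrable_mult_square[OF _ _ ix2(1) \<phi>2]) auto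
    have p2: "integrable ?G (\<lambda>z. (p z)\<^sup>2)" "(\<integral>z. (p z)\<^sup>2 \<partial>?G) = s\<^sup>2"
      unfolding p_def power_mult_distrib
      using integrable_pair_mult[OF sfN sfN \<phi>2 \<phi>2] integral_pair_mult[OF sfN sfN \<phi>2 \<phi>2]
      by (auto simp: s_def power2_eq_square)
    have p1: "integrable ?G p" "(\<integral>z. p z \<partial>?G) = 0"
      unfolding p_def using integrable_pair_mult[OF sfN sfN i\<phi> i\<phi>] integral_pair_mult[OF sfN sfN i\<phi> i\<phi>] \<phi>0 by auto
    define q where "q z = fst z * snd z" for z :: "real \<times> real"
    have q[measurable]: "q \<in> borel_measurable (borel \<Otimes>\<^sub>M borel)" unfolding q_def by measurable
    have qp: "integrable ?G (\<lambda>z. q z * p z)" "(\<integral>z. q z * p z \<partial>?G) = 0"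
    proof -
      have "(\<lambda>z. q z * p z) = (\<lambda>z. (fst z * \<phi> (fst z)) * (snd z * \<phi> (snd z)))"
        by (auto simp: q_def p_def mult_ac)
      then show "integrable ?G (\<lambda>z. q z * p z)" "(\<integral>z. q z * p z \<partial>?G) = 0"
        using integrable_pair_mult[OF sfN sfN ix\<phi> ix\<phi>] integral_pair_mult[OF sfN sfN ix\<phi> ix\<phi>] \<phi>1 by auto
    qed
    have q1: "integrable ?G q" "(\<integral>z. q z \<partial>?G) = 0"
      unfolding q_def using integrable_pair_mult[OF sfN sfN ix(1) ix(1)] integral_pair_mult[OF sfN sfN ix(1) ix(1)] ix(2) by auto
    have q2: "integrable ?G (\<lambda>z. (q z)\<^sup>2)" "(\<integral>z. (q z)\<^sup>2 \<partial>?G) = 1"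
      unfolding q_def power_mult_distrib
      using integrable_pair_mult[OF sfN sfN ix2(1) ix2(1)] integral_pair_mult[OF sfN sfN ix2(1) ix2(1)] ix2(2) by auto
    have k2: "integrable ?G (\<lambda>z. (k z)\<^sup>2)" "(\<integral>z. (k z)\<^sup>2 \<partial>?G) = 1 / (1 - \<rho>\<^sup>2)"
    proof -
      have nn: "(\<integral>\<^sup>+z. ennreal ((k z)\<^sup>2) \<partial>?G) = ennreal (1 / (1 - \<rho>\<^sup>2))"
        using nn_integral_mehler_kernel_sq[OF \<rho>1] by (simp only: k_def)
      show "integrable ?G (\<lambda>z. (k z)\<^sup>2)"
        by (rule integrableI_nn_integral_finite[OF _ _ nn]) (simp_all, measurable)
      show "(\<integral>z. (k z)\<^sup>2 \<partial>?G) = 1 / (1 - \<rho>\<^sup>2)"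
        using \<rho>1 by (subst integral_eq_nn_integral) (simp_all add: nn)
    qed
    have k1: "integrable ?G k" "(\<integral>z. k z \<partial>?G) = 1"
      using trans_int[of "\<lambda>_. 1"] trans_eq[of "\<lambda>_. 1"] by (auto simp: prob_space)
    have kq: "integrable ?G (\<lambda>z. k z * q z)" "(\<integral>z. k z * q z \<partial>?G) = \<rho>"
      using integrable_mult_square[OF _ _ k2(1) q2(1)] trans_eq[OF q] \<rho> by (auto simp: q_def)
    have kp: "integrable ?G (\<lambda>z. k z * p z)" "(\<integral>z. k z * p z \<partial>?G) = expectation (\<lambda>\<omega>. \<phi> (U \<omega>) * \<phi> (V \<omega>))"
      using integrable_mult_square[OF _ _ k2(1) p2(1)] trans_eq[OF p] by (auto simp: p_def)
    define r where "r z = k z - 1 - \<rho> * q z" for z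
    have r[measurable]: "r \<in> borel_measurable (borel \<Otimes>\<^sub>M borel)" unfolding r_def by measurable
    have r2eq: "(r z)\<^sup>2 = (k z)\<^sup>2 + 1 + \<rho>\<^sup>2 * (q z)\<^sup>2 - 2 * k z - 2 * \<rho> * (k z * q z) + 2 * \<rho> * q z" for z
      unfolding r_def by (simp add: power2_eq_square algebra_simps)
    have r2: "integrable ?G (\<lambda>z. (r z)\<^sup>2)" "(\<integral>z. (r z)\<^sup>2 \<partial>?G) = 1 / (1 - \<rho>\<^sup>2) - 1 - \<rho>\<^sup>2"
    proof -
      show "integrable ?G (\<lambda>z. (r z)\<^sup>2)"
        unfolding r2eq using k1(1) k2(1) q1(1) q2(1) kq(1) by simp
      have "(\<integral>z. (r z)\<^sup>2 \<partial>?G) = 1 / (1 - \<rho>\<^sup>2) + 1 + \<rho>\<^sup>2 * 1 - 2 * 1 - 2 * \<rho> * \<rho> + 2 * \<rho> * 0"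
        unfolding r2eq using k1 k2 q1 q2 kq by (simp add: G.prob_space)
      then show "(\<integral>z. (r z)\<^sup>2 \<partial>?G) = 1 / (1 - \<rho>\<^sup>2) - 1 - \<rho>\<^sup>2" by (simp add: power2_eq_square)
    qed
    have "expectation (\<lambda>\<omega>. \<phi> (U \<omega>) * \<phi> (V \<omega>)) = (\<integral>z. k z * p z - p z - \<rho> * (q z * p z) \<partial>?G)"
      using kp p1 qp by simp
    also have "\<dots> = (\<integral>z. r z * p z \<partial>?G)"
      by (intro Bochner_Integration.integral_cong) (auto simp: r_def algebra_simps)
    finally have E: "expectation (\<lambda>\<omega>. \<phi> (U \<omega>) * \<phi> (V \<omega>)) = (\<integral>z. r z * p z \<partial>?G)" .
    have "(\<integral>z. r z * p z \<partial>?G)\<^sup>2 \<le> (1 / (1 - \<rho>\<^sup>2) - 1 - \<rho>\<^sup>2) * s\<^sup>2"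
      using Cauchy_Schwarz_integral[OF _ _ r2(1) p2(1)] r2(2) p2(2) by simp
    also have "1 / (1 - \<rho>\<^sup>2) - 1 - \<rho>\<^sup>2 = \<rho>\<^sup>2 * \<rho>\<^sup>2 / (1 - \<rho>\<^sup>2)"
      using \<rho>1 by (simp add: field_simps)
    also have "\<rho>\<^sup>2 * \<rho>\<^sup>2 / (1 - \<rho>\<^sup>2) * s\<^sup>2 \<le> (4 * \<rho>\<^sup>2)\<^sup>2 * s\<^sup>2"
    proof (rule mult_right_mono)
      \<comment> \<open>Deliberately crude: \<open>1 - \<rho>\<^sup>2 \<ge> 3 / 4\<close> here, and
        1/16 is taken so that the result is the square of \<open>4 * \<rho>\<^sup>2\<close>, the
        bound of the other case.\<close>
      have "\<rho>\<^sup>2 * \<rho>\<^sup>2 / (1 - \<rho>\<^sup>2) \<le> \<rho>\<^sup>2 * \<rho>\<^sup>2 / (1 / 16)" using True by (intro divide_left_mono) auto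
      then show "\<rho>\<^sup>2 * \<rho>\<^sup>2 / (1 - \<rho>\<^sup>2) \<le> (4 * \<rho>\<^sup>2)\<^sup>2" by (simp add: power2_eq_square)
    qed simp
    also have "(4 * \<rho>\<^sup>2)\<^sup>2 * s\<^sup>2 = (4 * \<rho>\<^sup>2 * s)\<^sup>2" by (simp add: power_mult_distrib)
    finally have "\<bar>\<integral>z. r z * p z \<partial>?G\<bar> \<le> 4 * \<rho>\<^sup>2 * s"
      using s0 abs_le_square_iff[of _ "4 * \<rho>\<^sup>2 * s"] by simp
    then show ?thesis unfolding E s_def .
  qed
qed


section \<open>The empirical process of a subordinated Gaussian sequence\<close>

text \<open>Halving the index is the induction step: \<open>j\<close> and
  \<open>2 * (j div 2)\<close> differ by at most one cell of the finest level, and the even indices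
  form a grid with one level fewer. Hence each level is charged only once.\<close>

lemma dyadic_chaining:
  fixes D m :: "nat \<Rightarrow> real"
  assumes "\<And>k i. k \<le> K \<Longrightarrow> (i + 1) * 2 ^ k \<le> 2 ^ K \<Longrightarrow> \<bar>D ((i + 1) * 2 ^ k) - D (i * 2 ^ k)\<bar> \<le> m k"
    and "j \<le> 2 ^ K"
  shows "\<bar>D j - D 0\<bar> \<le> (\<Sum>k\<le>K. m k)"
  using assms
proof (induction K arbitrary: D m j)
  case 0
  have "m 0 \<ge> 0" using "0.prems"(1)[of 0 0] by (auto intro: order_trans[OF abs_ge_zero])
  moreover have "j = 0 \<or> j = 1" using "0.prems"(2) by auto
  ultimately show ?case using "0.prems"(1)[of 0 0] by auto
next
  case (Suc K)
  define j' where "j' = j div 2"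
  have "\<bar>(D \<circ> (*) 2) j' - (D \<circ> (*) 2) 0\<bar> \<le> (\<Sum>k\<le>K. (m \<circ> Suc) k)"
  proof (rule Suc.IH)
    fix k i assume k: "k \<le> K" "(i + 1) * 2 ^ k \<le> (2::nat) ^ K"
    then have "\<bar>D ((i + 1) * 2 ^ Suc k) - D (i * 2 ^ Suc k)\<bar> \<le> m (Suc k)"
      by (intro Suc.prems(1)) auto
    then show "\<bar>(D \<circ> (*) 2) ((i + 1) * 2 ^ k) - (D \<circ> (*) 2) (i * 2 ^ k)\<bar> \<le> (m \<circ> Suc) k"
      by (simp add: mult_ac)
  qed (use Suc.prems(2) in \<open>auto simp: j'_def\<close>)
  then have 1: "\<bar>D (2 * j') - D 0\<bar> \<le> (\<Sum>k\<le>K. m (Suc k))" by simp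
  have "\<bar>D 1 - D 0\<bar> \<le> m 0" using Suc.prems(1)[of 0 0] by simp
  then have m0: "0 \<le> m 0" by (rule order_trans[OF abs_ge_zero])
  have 2: "\<bar>D j - D (2 * j')\<bar> \<le> m 0"
  proof (cases "even j")
    case True
    then show ?thesis using m0 by (simp add: j'_def)
  next
    case False
    then have j: "j = 2 * j' + 1" by (auto simp: j'_def elim: oddE)
    then show ?thesis using Suc.prems(1)[of 0 "2 * j'"] Suc.prems(2) by simp
  qed
  have "(\<Sum>k\<le>Suc K. m k) = m 0 + (\<Sum>k\<le>K. m (Suc k))" by (rule sum.atMost_Suc_shift)
  with 1 2 show ?case by linarith
qed

text \<open>Maxima over the cells of a level are replaced with sums of squares, whose expectation
  can be computed term by term. The factor \<open>Suc K\<close> is the price of the Cauchy-Schwarz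
  inequality over the levels.\<close>

definition dyadic_variation :: "nat \<Rightarrow> (nat \<Rightarrow> real) \<Rightarrow> real" where
  "dyadic_variation K D = real (Suc K) *
     (\<Sum>k\<le>K. \<Sum>i<2 ^ (K - k). (D ((i + 1) * 2 ^ k) - D (i * 2 ^ k))\<^sup>2)"

lemma dyadic_variation_bound:
  assumes "j \<le> 2 ^ K"
  shows "\<bar>D j - D 0\<bar> \<le> sqrt (dyadic_variation K D)"
proof -
  define m where "m k = sqrt (\<Sum>i<2 ^ (K - k). (D ((i + 1) * 2 ^ k) - D (i * 2 ^ k))\<^sup>2)" for k
  have m2: "(m k)\<^sup>2 = (\<Sum>i<2 ^ (K - k). (D ((i + 1) * 2 ^ k) - D (i * 2 ^ k))\<^sup>2)" for k
    by (simp add: m_def sum_nonneg)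
  have "\<bar>D j - D 0\<bar> \<le> (\<Sum>k\<le>K. m k)"
  proof (rule dyadic_chaining[OF _ assms])
    fix k i assume k: "k \<le> K" "(i + 1) * 2 ^ k \<le> (2::nat) ^ K"
    have "(2::nat) ^ K = 2 ^ (K - k) * 2 ^ k" using k(1) by (simp add: power_add[symmetric])
    with k(2) have "(i + 1) * 2 ^ k \<le> (2::nat) ^ (K - k) * 2 ^ k" by simp
    then have "i + 1 \<le> (2::nat) ^ (K - k)" by (subst (asm) mult_le_cancel2) simp
    then have "i < 2 ^ (K - k)" by simp
    then have "(D ((i + 1) * 2 ^ k) - D (i * 2 ^ k))\<^sup>2 \<le> (m k)\<^sup>2"
      unfolding m2 by (intro member_le_sum) auto
    then have "\<bar>D ((i + 1) * 2 ^ k) - D (i * 2 ^ k)\<bar> \<le> \<bar>m k\<bar>"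
      by (simp only: abs_le_square_iff)
    moreover have "m k \<ge> 0" by (simp add: m_def sum_nonneg)
    ultimately show "\<bar>D ((i + 1) * 2 ^ k) - D (i * 2 ^ k)\<bar> \<le> m k" by linarith
  qed
  moreover have "(\<Sum>k\<le>K. m k)\<^sup>2 \<le> dyadic_variation K D"
    using sum_squared_le_sum_of_squares[of m "{..K}"]
    by (simp add: dyadic_variation_def m2 mult.commute)
  ultimately show ?thesis
    by (rule order_trans[OF _ real_le_rsqrt])
qed

section \<open>The remainder and its second moments\<close>

locale lrd_gaussian = prob_space M for M :: "'a measure" +
  fixes \<xi> X :: "nat \<Rightarrow> 'a \<Rightarrow> real" and g l f :: "real \<Rightarrow> real" and d :: real
  assumes gaussian: "gaussian_process M {1..} \<xi>"
    and mean_zero: "\<And>i. 1 \<le> i \<Longrightarrow> expectation (\<xi> i) = 0"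
    and variance_one: "\<And>i. 1 \<le> i \<Longrightarrow> variance (\<xi> i) = 1"
    and covariance: "\<And>i k. 1 \<le> i \<Longrightarrow> 1 \<le> k \<Longrightarrow>
          expectation (\<lambda>\<omega>. \<xi> i \<omega> * \<xi> (i + k) \<omega>) = real k powr (- d) * l (real k)"
    and l: "slowly_varying l" and d: "0 < d" "d < 1 / 2"
    and g[measurable]: "g \<in> borel_measurable borel"
    and X: "\<And>i. 1 \<le> i \<Longrightarrow> X i = (\<lambda>\<omega>. g (\<xi> i \<omega>))"
    and f_nonneg: "\<And>x. 0 \<le> f x"
    and f_density: "distributed M lborel (X 1) f"
    and f_mono: "mono_on {..0} f"
begin

abbreviation "N \<equiv> std_normal_distribution"

sublocale N: real_distribution N by (rule real_dist_normal_dist)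

text \<open>Lag 0 is separate because \<open>0 powr (- d)\<close> is 0, whereas the variance is
  1.\<close>

definition \<rho> :: "nat \<Rightarrow> real" where
  "\<rho> k = (if k = 0 then 1 else real k powr (- d) * l (real k))"

definition F :: "real \<Rightarrow> real" where "F t = measure N {x. g x \<le> t}"

definition \<eta> :: "real \<Rightarrow> real" where "\<eta> t = (\<integral>x. indicator {x. g x \<le> t} x * x \<partial>N)"

definition avg :: "nat \<Rightarrow> 'a \<Rightarrow> real" where "avg n \<omega> = (\<Sum>i=1..n. \<xi> i \<omega>) / real n"

text \<open>What is left of the empirical distribution function after each indicator is projected
  onto the constants and \<open>\<xi> i\<close>: the part of Hermite order at least 2.\<close>

definition R :: "nat \<Rightarrow> 'a \<Rightarrow> real \<Rightarrow> real" where
  "R n \<omega> t = empirical_cdf X n \<omega> t - F t - \<eta> t * avg n \<omega>"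

text \<open>Bounds the second moment of an increment of \<open>R n\<close> per unit of mass of
  \<open>F\<close>; the 4 is the constant of \<open>gaussian_pair_orthogonal_bound\<close>.\<close>

definition v :: "nat \<Rightarrow> real" where
  "v n = 4 * (\<Sum>i=1..n. \<Sum>j=1..n. (\<rho> (nat_dist i j))\<^sup>2) / (real n)\<^sup>2"

lemma gaussian_sum: "finite J \<Longrightarrow> J \<subseteq> {1..} \<Longrightarrow> gaussian_rv M (\<lambda>\<omega>. \<Sum>j\<in>J. c j * \<xi> j \<omega>)"
  using gaussian unfolding gaussian_process_def by blast

lemma gaussian_single: "1 \<le> i \<Longrightarrow> gaussian_rv M (\<xi> i)"
  using gaussian_sum[of "{i}" "\<lambda>_. 1"] by simp

lemma xi_measurable: "1 \<le> i \<Longrightarrow> \<xi> i \<in> borel_measurable M"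
  using gaussian_single unfolding gaussian_rv_def by blast

lemma xi_normal: "1 \<le> i \<Longrightarrow> distributed M lborel (\<xi> i) std_normal_density"
  using gaussian_rv_centered_cases(2)[OF gaussian_single mean_zero, of i] variance_one[of i] by simp

lemma xi_square_integrable: "1 \<le> i \<Longrightarrow> integrable M (\<lambda>\<omega>. (\<xi> i \<omega>)\<^sup>2)"
  by (rule gaussian_rv_centered_cases(1)[OF gaussian_single mean_zero])

lemma xi_integrable: "1 \<le> i \<Longrightarrow> integrable M (\<xi> i)"
  using square_integrable_imp_integrable[OF xi_measurable xi_square_integrable] .

lemma xi_mult_integrable: "1 \<le> i \<Longrightarrow> 1 \<le> j \<Longrightarrow> integrable M (\<lambda>\<omega>. \<xi> i \<omega> * \<xi> j \<omega>)"
  by (intro integrable_mult_square xi_measurable xi_square_integrable)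

lemma distr_xi: "1 \<le> i \<Longrightarrow> distr M borel (\<xi> i) = N"
  using xi_normal[of i] by (auto simp: distributed_def cong: distr_cong)

lemma expectation_xi_mult:
  assumes "1 \<le> i" "1 \<le> j"
  shows "expectation (\<lambda>\<omega>. \<xi> i \<omega> * \<xi> j \<omega>) = \<rho> (nat_dist i j)"
proof -
  consider "i = j" | "i < j" | "j < i" by linarith
  then show ?thesis
  proof cases
    case 1
    then show ?thesis using variance_one[of i] mean_zero[of i] assms
      by (simp add: \<rho>_def nat_dist_def power2_eq_square)
  next
    case 2
    then show ?thesis using covariance[of i "j - i"] assms by (simp add: \<rho>_def nat_dist_def)
  next
    case 3
    then show ?thesis using covariance[of j "i - j"] assms by (simp add: \<rho>_def nat_dist_def mult.commute)
  qed
qed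

lemma expectation_linear_combination:
  assumes "finite J" "J \<subseteq> {1..}"
  shows "expectation (\<lambda>\<omega>. \<Sum>j\<in>J. c j * \<xi> j \<omega>) = 0"
    and "variance (\<lambda>\<omega>. \<Sum>j\<in>J. c j * \<xi> j \<omega>) = (\<Sum>i\<in>J. \<Sum>j\<in>J. c i * c j * \<rho> (nat_dist i j))"
proof -
  have J: "1 \<le> j" if "j \<in> J" for j using that assms(2) by auto
  show 0: "expectation (\<lambda>\<omega>. \<Sum>j\<in>J. c j * \<xi> j \<omega>) = 0"
    using J by (subst Bochner_Integration.integral_sum) (auto intro: xi_integrable simp: mean_zero)
  have "variance (\<lambda>\<omega>. \<Sum>j\<in>J. c j * \<xi> j \<omega>) = expectation (\<lambda>\<omega>. (\<Sum>j\<in>J. c j * \<xi> j \<omega>)\<^sup>2)"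
    using 0 by simp
  also have "\<dots> = expectation (\<lambda>\<omega>. \<Sum>i\<in>J. \<Sum>j\<in>J. c i * c j * (\<xi> i \<omega> * \<xi> j \<omega>))"
    by (simp add: power2_eq_square sum_product mult_ac)
  also have "\<dots> = (\<Sum>i\<in>J. \<Sum>j\<in>J. c i * c j * expectation (\<lambda>\<omega>. \<xi> i \<omega> * \<xi> j \<omega>))"
    using J by (simp add: Bochner_Integration.integral_sum xi_mult_integrable)
  also have "\<dots> = (\<Sum>i\<in>J. \<Sum>j\<in>J. c i * c j * \<rho> (nat_dist i j))"
    using J by (simp add: expectation_xi_mult)
  finally show "variance (\<lambda>\<omega>. \<Sum>j\<in>J. c j * \<xi> j \<omega>) = (\<Sum>i\<in>J. \<Sum>j\<in>J. c i * c j * \<rho> (nat_dist i j))" .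
qed

text \<open>Joint normality is given only through linear combinations. The one with weights
  \<open>a\<close> and \<open>b\<close> is centred Gaussian, and its characteristic function at
  frequency 1 depends on its variance alone.\<close>

lemma char_pair:
  assumes "1 \<le> i" "1 \<le> j" "i \<noteq> j"
  shows "(CLINT \<omega>|M. iexp (a * \<xi> i \<omega> + b * \<xi> j \<omega>)) =
    complex_of_real (exp (- (a\<^sup>2 + b\<^sup>2 + 2 * \<rho> (nat_dist i j) * a * b) / 2))"
proof -
  define c where "c k = (if k = i then a else b)" for k
  let ?Y = "\<lambda>\<omega>. \<Sum>k\<in>{i,j}. c k * \<xi> k \<omega>"
  have J: "finite {i,j}" "{i,j} \<subseteq> {1..}" using assms by auto
  have sym: "nat_dist j i = nat_dist i j" by (auto simp: nat_dist_def)
  have "nat_dist k k = 0" for k by (simp add: nat_dist_def)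
  then have "variance ?Y = a\<^sup>2 + b\<^sup>2 + 2 * \<rho> (nat_dist i j) * a * b"
    unfolding expectation_linear_combination(2)[OF J] using assms
    by (simp add: c_def sym \<rho>_def power2_eq_square algebra_simps)
  then show ?thesis
    using gaussian_rv_centered_cases(3)[OF gaussian_sum[OF J, of c] expectation_linear_combination(1)[OF J], of 1] assms
    by (simp add: c_def)
qed

text \<open>Expanding the square leaves pair expectations, each of order
  \<open>\<rho>\<^sup>2\<close> by orthogonality to \<open>1\<close> and \<open>x\<close>. The
  diagonal is treated apart, since \<open>char_pair\<close> asks for distinct indices; there
  \<open>\<rho> 0 = 1\<close> makes the same bound valid.\<close>

lemma second_moment_orthogonal_sum:
  fixes \<phi> :: "real \<Rightarrow> real"
  assumes [measurable]: "\<phi> \<in> borel_measurable borel"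
    and \<phi>2: "integrable N (\<lambda>x. (\<phi> x)\<^sup>2)"
    and \<phi>0: "(\<integral>x. \<phi> x \<partial>N) = 0" and \<phi>1: "(\<integral>x. x * \<phi> x \<partial>N) = 0"
  shows "integrable M (\<lambda>\<omega>. (\<Sum>i=1..n. \<phi> (\<xi> i \<omega>))\<^sup>2)"
    and "expectation (\<lambda>\<omega>. (\<Sum>i=1..n. \<phi> (\<xi> i \<omega>))\<^sup>2) \<le>
        4 * (\<Sum>i=1..n. \<Sum>j=1..n. (\<rho> (nat_dist i j))\<^sup>2) * (\<integral>x. (\<phi> x)\<^sup>2 \<partial>N)"
proof -
  let ?s = "\<integral>x. (\<phi> x)\<^sup>2 \<partial>N"
  have s0: "?s \<ge> 0" by simp
  have sq: "integrable M (\<lambda>\<omega>. (\<phi> (\<xi> i \<omega>))\<^sup>2)" "expectation (\<lambda>\<omega>. (\<phi> (\<xi> i \<omega>))\<^sup>2) = ?s" if i: "1 \<le> i" for i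
  proof -
    note xi_measurable[OF i, measurable]
    show "integrable M (\<lambda>\<omega>. (\<phi> (\<xi> i \<omega>))\<^sup>2)"
      using \<phi>2 unfolding distr_xi[OF i, symmetric] by (subst (asm) integrable_distr_eq) auto
    show "expectation (\<lambda>\<omega>. (\<phi> (\<xi> i \<omega>))\<^sup>2) = ?s"
      unfolding distr_xi[OF i, symmetric] by (subst integral_distr) auto
  qed
  have prod: "integrable M (\<lambda>\<omega>. \<phi> (\<xi> i \<omega>) * \<phi> (\<xi> j \<omega>))" if "1 \<le> i" "1 \<le> j" for i j
    using that by (intro integrable_mult_square sq) (auto intro!: measurable_compose[OF xi_measurable])
  have cov: "expectation (\<lambda>\<omega>. \<phi> (\<xi> i \<omega>) * \<phi> (\<xi> j \<omega>)) \<le> 4 * (\<rho> (nat_dist i j))\<^sup>2 * ?s"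
    if ij: "1 \<le> i" "1 \<le> j" for i j
  proof (cases "i = j")
    case True
    then show ?thesis using sq(2)[OF ij(1)] s0 by (simp add: nat_dist_def \<rho>_def power2_eq_square)
  next
    case False
    show ?thesis
      by (rule abs_le_D1, rule gaussian_pair_orthogonal_bound[OF xi_measurable[OF ij(1)] xi_measurable[OF ij(2)]
          char_pair[OF ij False] expectation_xi_mult[OF ij] _ \<phi>2 \<phi>0 \<phi>1]) simp
  qed
  have sumsq: "(\<Sum>i=1..n. \<phi> (\<xi> i \<omega>))\<^sup>2 = (\<Sum>i=1..n. \<Sum>j=1..n. \<phi> (\<xi> i \<omega>) * \<phi> (\<xi> j \<omega>))" for \<omega>
    by (simp add: power2_eq_square sum_product)
  show "integrable M (\<lambda>\<omega>. (\<Sum>i=1..n. \<phi> (\<xi> i \<omega>))\<^sup>2)"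
    unfolding sumsq by (intro Bochner_Integration.integrable_sum prod) auto
  have "expectation (\<lambda>\<omega>. (\<Sum>i=1..n. \<phi> (\<xi> i \<omega>))\<^sup>2) =
      (\<Sum>i=1..n. expectation (\<lambda>\<omega>. \<Sum>j=1..n. \<phi> (\<xi> i \<omega>) * \<phi> (\<xi> j \<omega>)))"
    unfolding sumsq by (intro Bochner_Integration.integral_sum Bochner_Integration.integrable_sum prod) auto
  also have "\<dots> = (\<Sum>i=1..n. \<Sum>j=1..n. expectation (\<lambda>\<omega>. \<phi> (\<xi> i \<omega>) * \<phi> (\<xi> j \<omega>)))"
    by (intro sum.cong refl Bochner_Integration.integral_sum prod) auto
  also have "\<dots> \<le> (\<Sum>i=1..n. \<Sum>j=1..n. 4 * (\<rho> (nat_dist i j))\<^sup>2 * ?s)"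
    by (intro sum_mono cov) auto
  also have "\<dots> = 4 * (\<Sum>i=1..n. \<Sum>j=1..n. (\<rho> (nat_dist i j))\<^sup>2) * ?s"
    by (simp add: sum_distrib_left sum_distrib_right)
  finally show "expectation (\<lambda>\<omega>. (\<Sum>i=1..n. \<phi> (\<xi> i \<omega>))\<^sup>2) \<le>
        4 * (\<Sum>i=1..n. \<Sum>j=1..n. (\<rho> (nat_dist i j))\<^sup>2) * ?s" .
qed

lemma std_normal_moments:
  shows "integrable N (\<lambda>x. x\<^sup>2)" "(\<integral>x. x\<^sup>2 \<partial>N) = 1" "integrable N (\<lambda>x. x)" "(\<integral>x. x \<partial>N) = 0"
  using std_normal_distribution_even_moments[of 1]
    integrable_std_normal_distribution_moment[of 1] integral_std_normal_distribution_moment_odd[of 1]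
  by simp_all

lemma indicator_mult_integrable:
  assumes [measurable]: "A \<in> sets borel"
  shows "integrable N (\<lambda>x. indicator A x * x)"
  using integrable_mult_indicator[OF _ std_normal_moments(3), of A] by simp

lemma F_diff: "s \<le> t \<Longrightarrow> F t - F s = measure N {x. s < g x \<and> g x \<le> t}"
proof -
  assume "s \<le> t"
  then have "{x. g x \<le> t} = {x. g x \<le> s} \<union> {x. s < g x \<and> g x \<le> t}" by auto
  then have "F t = F s + measure N {x. s < g x \<and> g x \<le> t}"
    unfolding F_def by (simp only:) (rule N.finite_measure_Union, auto)
  then show ?thesis by simp
qed

lemma \<eta>_diff:
  assumes "s \<le> t"
  shows "\<eta> t - \<eta> s = (\<integral>x. indicator {x. s < g x \<and> g x \<le> t} x * x \<partial>N)"
proof -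
  have "\<eta> t - \<eta> s = (\<integral>x. indicator {x. g x \<le> t} x * x - indicator {x. g x \<le> s} x * x \<partial>N)"
    unfolding \<eta>_def
    by (rule Bochner_Integration.integral_diff[symmetric]; rule indicator_mult_integrable; measurable)
  also have "\<dots> = (\<integral>x. indicator {x. s < g x \<and> g x \<le> t} x * x \<partial>N)"
    using assms by (intro Bochner_Integration.integral_cong) (auto simp: indicator_def)
  finally show ?thesis .
qed

text \<open>Cauchy-Schwarz against \<open>x\<close>, which has unit second moment under
  \<open>N\<close>. Together with the Lipschitz bound on \<open>F\<close> this limits the change of
  \<eta> between neighbouring grid points.\<close>

lemma \<eta>_modulus:
  assumes "s \<le> t"
  shows "\<bar>\<eta> t - \<eta> s\<bar> \<le> sqrt (F t - F s)"
proof -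
  let ?A = "{x. s < g x \<and> g x \<le> t}"
  have "(\<integral>x. indicator ?A x * x \<partial>N)\<^sup>2 \<le> (\<integral>x. (indicator ?A x :: real)\<^sup>2 \<partial>N) * (\<integral>x. x\<^sup>2 \<partial>N)"
    by (rule Cauchy_Schwarz_integral) (auto simp: power2_eq_square std_normal_moments[unfolded power2_eq_square] indicator_times_eq_if intro!: N.integrable_const_bound[where B=1])
  also have "(\<integral>x. (indicator ?A x :: real)\<^sup>2 \<partial>N) = (\<integral>x. (indicator ?A x :: real) \<partial>N)"
    by (intro Bochner_Integration.integral_cong) (auto simp: indicator_def)
  also have "\<dots> = F t - F s" using F_diff[OF assms] by simp
  finally show ?thesis unfolding \<eta>_diff[OF assms, symmetric] std_normal_moments
    by (simp add: real_le_rsqrt abs_le_square_iff[symmetric])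
qed

text \<open>\<open>\<phi>\<close> is the indicator of the increment minus its projection onto
  \<open>1\<close> and \<open>x\<close>, hence orthogonal to both, with squared norm
  \<open>p - p\<^sup>2 - e\<^sup>2 \<le> p\<close>. That the bound is linear in
  \<open>F t - F s\<close> is what makes short windows profitable in the chaining.\<close>

lemma R_increment:
  assumes "s \<le> t" "n \<ge> 1"
  shows "integrable M (\<lambda>\<omega>. (R n \<omega> t - R n \<omega> s)\<^sup>2)"
    and "expectation (\<lambda>\<omega>. (R n \<omega> t - R n \<omega> s)\<^sup>2) \<le> (F t - F s) * v n"
proof -
  let ?A = "{x. s < g x \<and> g x \<le> t}"
  define p e where "p = F t - F s" and "e = \<eta> t - \<eta> s"
  define \<phi> where "\<phi> x = indicator ?A x - p - e * x" for x :: real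
  have A[measurable]: "?A \<in> sets borel" by measurable
  have \<phi>m[measurable]: "\<phi> \<in> borel_measurable borel" unfolding \<phi>_def by measurable
  have p: "(\<integral>x. indicator ?A x \<partial>N) = p" by (simp add: p_def F_diff[OF assms(1)])
  have e: "(\<integral>x. indicator ?A x * x \<partial>N) = e" by (simp add: e_def \<eta>_diff[OF assms(1)])
  have iA: "integrable N (indicator ?A :: real \<Rightarrow> real)" by (rule integrable_real_indicator) (auto simp: less_top[symmetric])
  note iAx = indicator_mult_integrable[OF A]
  have const: "(\<integral>x. c \<partial>N) = c" for c :: real using N.prob_space by simp
  note ints = Bochner_Integration.integral_diff Bochner_Integration.integral_add integral_mult_right_zero
    Bochner_Integration.integrable_diff Bochner_Integration.integrable_add integrable_mult_right N.integrable_const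
  have \<phi>0: "(\<integral>x. \<phi> x \<partial>N) = 0"
    unfolding \<phi>_def using iA std_normal_moments(3,4)
    by (simp only: ints p const)
  have "(\<integral>x. x * \<phi> x \<partial>N) = (\<integral>x. indicator ?A x * x - p * x - e * x\<^sup>2 \<partial>N)"
    by (intro Bochner_Integration.integral_cong) (auto simp: \<phi>_def power2_eq_square algebra_simps)
  also have "\<dots> = e - p * 0 - e * 1"
    using iAx std_normal_moments by (simp only: ints e)
  also have "\<dots> = 0" by simp
  finally have \<phi>1: "(\<integral>x. x * \<phi> x \<partial>N) = 0" .
  have \<phi>sq: "(\<phi> x)\<^sup>2 = (1 - 2 * p) * indicator ?A x - 2 * e * (indicator ?A x * x) + p\<^sup>2 + 2 * p * e * x + e\<^sup>2 * x\<^sup>2" for x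
  proof -
    define a where "a = (indicator ?A x :: real)"
    have a: "a\<^sup>2 = a" by (simp add: a_def indicator_def)
    have "(\<phi> x)\<^sup>2 = a\<^sup>2 - 2 * p * a - 2 * e * (a * x) + p\<^sup>2 + 2 * p * e * x + e\<^sup>2 * x\<^sup>2"
      unfolding \<phi>_def a_def[symmetric] by (simp add: power2_eq_square algebra_simps)
    then show ?thesis unfolding a unfolding a_def by (simp add: left_diff_distrib)
  qed
  have \<phi>2: "integrable N (\<lambda>x. (\<phi> x)\<^sup>2)"
    unfolding \<phi>sq using iA iAx std_normal_moments by (simp only: ints)
  have "(\<integral>x. (\<phi> x)\<^sup>2 \<partial>N) = (1 - 2 * p) * p - 2 * e * e + p\<^sup>2 + 2 * p * e * 0 + e\<^sup>2 * 1"
    unfolding \<phi>sq using iA iAx std_normal_moments by (simp only: ints p e const)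
  then have "(\<integral>x. (\<phi> x)\<^sup>2 \<partial>N) = p - p\<^sup>2 - e\<^sup>2" by (simp add: power2_eq_square algebra_simps)
  then have \<phi>le: "(\<integral>x. (\<phi> x)\<^sup>2 \<partial>N) \<le> p" by simp
  have ind: "indicator {..t} (g x) - indicator {..s} (g x) = (indicator ?A x :: real)" for x
    using assms(1) by (auto simp: indicator_def)
  have Rd: "R n \<omega> t - R n \<omega> s = (\<Sum>i=1..n. \<phi> (\<xi> i \<omega>)) / real n" for \<omega>
  proof -
    have "(\<Sum>i=1..n. \<phi> (\<xi> i \<omega>)) = (\<Sum>i=1..n. indicator {..t} (X i \<omega>)) - (\<Sum>i=1..n. indicator {..s} (X i \<omega>)) - real n * p - e * (\<Sum>i=1..n. \<xi> i \<omega>)"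
      unfolding \<phi>_def ind[symmetric] by (simp add: sum_subtractf X sum_distrib_left)
    moreover have "real n \<noteq> 0" using assms(2) by simp
    ultimately show ?thesis
      by (simp add: R_def empirical_cdf_def avg_def p_def e_def diff_divide_distrib left_diff_distrib)
  qed
  note m = second_moment_orthogonal_sum[OF \<phi>m \<phi>2 \<phi>0 \<phi>1, of n]
  show "integrable M (\<lambda>\<omega>. (R n \<omega> t - R n \<omega> s)\<^sup>2)"
    unfolding Rd power_divide using m(1) by simp
  have "expectation (\<lambda>\<omega>. (R n \<omega> t - R n \<omega> s)\<^sup>2) = expectation (\<lambda>\<omega>. (\<Sum>i=1..n. \<phi> (\<xi> i \<omega>))\<^sup>2) / (real n)\<^sup>2"
    unfolding Rd power_divide by simp
  also have "\<dots> \<le> 4 * (\<Sum>i=1..n. \<Sum>j=1..n. (\<rho> (nat_dist i j))\<^sup>2) * p / (real n)\<^sup>2"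
    by (rule divide_right_mono, rule order_trans[OF m(2)], rule mult_left_mono[OF \<phi>le])
       (auto intro!: sum_nonneg)
  also have "\<dots> = (F t - F s) * v n" by (simp add: v_def p_def)
  finally show "expectation (\<lambda>\<omega>. (R n \<omega> t - R n \<omega> s)\<^sup>2) \<le> (F t - F s) * v n" .
qed


text \<open>Monotonicity bounds the density on \<open>{s<..t}\<close> by its values at the ends. The
  Lipschitz bound on \<open>F\<close> and its curvature are both drawn from these inequalities,
  without differentiating \<open>F\<close>.\<close>

lemma F_increment_bounds:
  assumes "s \<le> t" "t \<le> 0"
  shows "f s * (t - s) \<le> F t - F s" and "F t - F s \<le> f t * (t - s)"
proof -
  have X1[measurable]: "X 1 \<in> borel_measurable M" using f_density by (simp add: distributed_def)
  note xi_measurable[of 1, simplified, measurable]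
  have "ennreal (F t - F s) = emeasure N {x. s < g x \<and> g x \<le> t}"
    by (simp add: F_diff[OF assms(1)] N.emeasure_eq_measure)
  also have "\<dots> = emeasure (distr M borel (\<xi> 1)) {x. s < g x \<and> g x \<le> t}" by (simp add: distr_xi)
  also have "\<dots> = emeasure M (X 1 -` {s<..t} \<inter> space M)"
    by (subst emeasure_distr) (auto simp: X intro!: arg_cong[where f="emeasure M"])
  also have "\<dots> = (\<integral>\<^sup>+x. ennreal (f x) * indicator {s<..t} x \<partial>lborel)"
    by (rule distributed_emeasure[OF f_density]) simp
  finally have eq: "ennreal (F t - F s) = (\<integral>\<^sup>+x. ennreal (f x) * indicator {s<..t} x \<partial>lborel)" .
  have const: "(\<integral>\<^sup>+x. ennreal c * indicator {s<..t} x \<partial>lborel) = ennreal (c * (t - s))" if "0 \<le> c" for c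
    using assms(1) that by (subst nn_integral_cmult_indicator) (auto simp: ennreal_mult)
  have F0: "0 \<le> F t - F s" using F_diff[OF assms(1)] by simp
  have "(\<integral>\<^sup>+x. ennreal (f s) * indicator {s<..t} x \<partial>lborel) \<le> ennreal (F t - F s)"
    unfolding eq using assms f_mono
    by (intro nn_integral_mono) (auto simp: indicator_def mono_on_def intro!: ennreal_leI)
  then show "f s * (t - s) \<le> F t - F s"
    unfolding const[OF f_nonneg] using F0 by (simp add: ennreal_le_iff)
  have "ennreal (F t - F s) \<le> (\<integral>\<^sup>+x. ennreal (f t) * indicator {s<..t} x \<partial>lborel)"
    unfolding eq using assms f_mono
    by (intro nn_integral_mono) (auto simp: indicator_def mono_on_def intro!: ennreal_leI)
  then show "F t - F s \<le> f t * (t - s)"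
    unfolding const[OF f_nonneg] using assms f_nonneg by (simp add: ennreal_le_iff)
qed

lemma F_lipschitz:
  assumes "s \<le> t" "t \<le> 0"
  shows "F t - F s \<le> f 0 * (t - s)"
  by (rule order_trans[OF F_increment_bounds(2)[OF assms] mult_right_mono])
     (use assms f_mono in \<open>auto simp: mono_on_def\<close>)

lemma v_nonneg: "0 \<le> v n"
  by (simp add: v_def sum_nonneg)

section \<open>Chaining for the remainder\<close>

definition Q :: "nat \<Rightarrow> nat \<Rightarrow> real \<Rightarrow> real \<Rightarrow> 'a \<Rightarrow> real" where
  "Q n K \<alpha> h \<omega> = dyadic_variation K (\<lambda>j. R n \<omega> (\<alpha> + real j * h))"

lemma X_measurable: "1 \<le> i \<Longrightarrow> X i \<in> borel_measurable M"
  using xi_measurable[of i] by (simp add: X)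

lemma avg_measurable[measurable]: "avg n \<in> borel_measurable M"
  unfolding avg_def[abs_def] by (intro borel_measurable_divide borel_measurable_sum xi_measurable) auto

lemma Q_measurable[measurable]: "Q n K \<alpha> h \<in> borel_measurable M"
proof -
  have [measurable]: "(\<lambda>\<omega>. R n \<omega> t) \<in> borel_measurable M" for t
    unfolding R_def using borel_measurable_empirical_cdf[OF X_measurable] by measurable
  show ?thesis unfolding Q_def[abs_def] dyadic_variation_def by measurable
qed

lemma Q_nonneg: "0 \<le> Q n K \<alpha> h \<omega>"
  unfolding Q_def dyadic_variation_def by (intro mult_nonneg_nonneg sum_nonneg) auto

text \<open>On level \<open>k\<close> there are \<open>2 ^ (K - k)\<close> cells of length
  \<open>2 ^ k * h\<close>, so every level contributes the same bound, proportional to the total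
  length. One factor \<open>Suc K\<close> counts the levels, the other comes from the definition of
  \<open>dyadic_variation\<close>.\<close>

lemma
  assumes n: "n \<ge> 1" and h: "0 \<le> h" "\<alpha> + 2 ^ K * h \<le> 0"
  shows integrable_Q: "integrable M (Q n K \<alpha> h)"
    and expectation_Q: "expectation (Q n K \<alpha> h) \<le> (real (Suc K))\<^sup>2 * (f 0 * (2 ^ K * h)) * v n"
proof -
  let ?t = "\<lambda>j::nat. \<alpha> + real j * h"
  let ?I = "\<lambda>k i \<omega>. (R n \<omega> (?t ((i + 1) * 2 ^ k)) - R n \<omega> (?t (i * 2 ^ k)))\<^sup>2"
  have le: "?t (i * 2 ^ k) \<le> ?t ((i + 1) * 2 ^ k)" for i k
    using h by (intro add_left_mono mult_right_mono of_nat_mono) auto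
  have int: "integrable M (?I k i)" for k i
    by (rule R_increment(1)[OF le n])
  have Qeq: "Q n K \<alpha> h \<omega> = real (Suc K) * (\<Sum>k\<le>K. \<Sum>i<2 ^ (K - k). ?I k i \<omega>)" for \<omega>
    by (simp only: Q_def dyadic_variation_def)
  show "integrable M (Q n K \<alpha> h)"
    unfolding Qeq[abs_def] by (intro integrable_mult_right Bochner_Integration.integrable_sum int)
  have bound: "expectation (?I k i) \<le> f 0 * (2 ^ k * h) * v n" if ki: "k \<le> K" "i < 2 ^ (K - k)" for k i
  proof -
    have "(i + 1) * 2 ^ k \<le> 2 ^ (K - k) * 2 ^ k" using ki(2) by (intro mult_right_mono) auto
    also have "(2::nat) ^ (K - k) * 2 ^ k = 2 ^ K" using ki(1) by (simp add: power_add[symmetric])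
    finally have "real ((i + 1) * 2 ^ k) \<le> real (2 ^ K)" by (rule of_nat_mono)
    then have "?t ((i + 1) * 2 ^ k) \<le> \<alpha> + real (2 ^ K) * h" using h(1) by (intro add_left_mono mult_right_mono)
    also have "\<dots> \<le> 0" using h(2) by simp
    finally have t0: "?t ((i + 1) * 2 ^ k) \<le> 0" .
    have "expectation (?I k i) \<le> (F (?t ((i + 1) * 2 ^ k)) - F (?t (i * 2 ^ k))) * v n"
      by (rule R_increment(2)[OF le n])
    also have "\<dots> \<le> (f 0 * (?t ((i + 1) * 2 ^ k) - ?t (i * 2 ^ k))) * v n"
      by (intro mult_right_mono F_lipschitz le t0 v_nonneg)
    also have "?t ((i + 1) * 2 ^ k) - ?t (i * 2 ^ k) = 2 ^ k * h" by (simp add: algebra_simps)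
    finally show ?thesis .
  qed
  have "expectation (\<lambda>\<omega>. \<Sum>k\<le>K. \<Sum>i<2 ^ (K - k). ?I k i \<omega>) =
      (\<Sum>k\<le>K. expectation (\<lambda>\<omega>. \<Sum>i<2 ^ (K - k). ?I k i \<omega>))"
    by (intro Bochner_Integration.integral_sum Bochner_Integration.integrable_sum int)
  also have "\<dots> = (\<Sum>k\<le>K. \<Sum>i<2 ^ (K - k). expectation (?I k i))"
    by (intro sum.cong refl Bochner_Integration.integral_sum int)
  also have "\<dots> \<le> (\<Sum>k\<le>K. \<Sum>i<(2::nat) ^ (K - k). f 0 * (2 ^ k * h) * v n)"
    by (intro sum_mono bound) auto
  also have "\<dots> = (\<Sum>k\<le>K. f 0 * (2 ^ K * h) * v n)"
  proof (rule sum.cong[OF refl])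
    fix k assume "k \<in> {..K}"
    then have "(2::real) ^ K = 2 ^ (K - k) * 2 ^ k" by (simp add: power_add[symmetric])
    then show "(\<Sum>i<(2::nat) ^ (K - k). f 0 * (2 ^ k * h) * v n) = f 0 * (2 ^ K * h) * v n" by simp
  qed
  also have "\<dots> = real (Suc K) * (f 0 * (2 ^ K * h) * v n)" by simp
  finally have "real (Suc K) * expectation (\<lambda>\<omega>. \<Sum>k\<le>K. \<Sum>i<2 ^ (K - k). ?I k i \<omega>)
      \<le> real (Suc K) * (real (Suc K) * (f 0 * (2 ^ K * h) * v n))"
    by (rule mult_left_mono) simp
  moreover have "expectation (Q n K \<alpha> h) = real (Suc K) * expectation (\<lambda>\<omega>. \<Sum>k\<le>K. \<Sum>i<2 ^ (K - k). ?I k i \<omega>)"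
    unfolding Qeq[abs_def] by (rule integral_mult_right_zero)
  ultimately have "expectation (Q n K \<alpha> h) \<le> real (Suc K) * (real (Suc K) * (f 0 * (2 ^ K * h) * v n))"
    by (simp only:)
  then show "expectation (Q n K \<alpha> h) \<le> (real (Suc K))\<^sup>2 * (f 0 * (2 ^ K * h)) * v n"
    by (simp only: power2_eq_square mult.assoc)
qed

text \<open>Off the grid the empirical distribution function is controlled by its monotonicity
  between neighbouring grid points; what \<open>R n\<close> loses in this comparison is the change
  of \<open>F\<close> and of \<open>\<eta> t * avg n \<omega>\<close> over one cell.\<close>

lemma R_modulus:
  assumes n: "n \<ge> 1" and h: "0 < h" "\<alpha> + 2 ^ K * h \<le> 0" and t: "\<alpha> \<le> t" "t \<le> \<alpha> + 2 ^ K * h"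
  shows "\<bar>R n \<omega> t - R n \<omega> \<alpha>\<bar> \<le> sqrt (Q n K \<alpha> h \<omega>) + f 0 * h + sqrt (f 0 * h) * \<bar>avg n \<omega>\<bar>"
proof -
  \<comment> \<open>At the right end of the interval the floor would give the index
    \<open>2 ^ K\<close>, one cell too far; that point is assigned to the last cell.\<close>
  define j where "j = (if t = \<alpha> + 2 ^ K * h then 2 ^ K - 1 else nat \<lfloor>(t - \<alpha>) / h\<rfloor>)"
  define a b where "a = \<alpha> + real j * h" and "b = \<alpha> + real (Suc j) * h"
  have j: "Suc j \<le> 2 ^ K \<and> a \<le> t \<and> t \<le> b"
  proof (cases "t = \<alpha> + 2 ^ K * h")
    case True
    then have "real (Suc j) = 2 ^ K" by (simp add: j_def of_nat_diff)
    with True h show ?thesis by (auto simp: a_def b_def j_def)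
  next
    case False
    with t have t': "t < \<alpha> + 2 ^ K * h" by simp
    define r where "r = (t - \<alpha>) / h"
    have r: "0 \<le> r" "r < 2 ^ K" "t = \<alpha> + r * h" using t t' h by (auto simp: r_def field_simps)
    have jr: "j = nat \<lfloor>r\<rfloor>" using False by (simp add: j_def r_def)
    have jj: "real j \<le> r" "r \<le> real (Suc j)" using r(1) unfolding jr by linarith+
    moreover have "(2::real) ^ K = real (2 ^ K)" by simp
    ultimately have "real j < real (2 ^ K)" using r(2) by linarith
    then have "Suc j \<le> 2 ^ K" by (simp only: of_nat_less_iff Suc_le_eq)
    then show ?thesis using jj h by (auto simp: a_def b_def r(3))
  qed
  have ba: "b - a = h" by (simp add: a_def b_def algebra_simps)
  have b0: "b \<le> 0"
  proof -
    have "real (Suc j) \<le> real (2 ^ K)" using j by (intro of_nat_mono) auto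
    then have "b \<le> \<alpha> + real (2 ^ K) * h" unfolding b_def using h(1) by (intro add_left_mono mult_right_mono) auto
    then show ?thesis using h(2) by simp
  qed
  define m where "m = avg n \<omega>"
  have grid: "\<bar>R n \<omega> (\<alpha> + real i * h) - R n \<omega> \<alpha>\<bar> \<le> sqrt (Q n K \<alpha> h \<omega>)" if "i \<le> 2 ^ K" for i
    using dyadic_variation_bound[OF that, of "\<lambda>j. R n \<omega> (\<alpha> + real j * h)"] by (simp add: Q_def)
  have Ra: "\<bar>R n \<omega> a - R n \<omega> \<alpha>\<bar> \<le> sqrt (Q n K \<alpha> h \<omega>)" unfolding a_def using j by (intro grid) auto
  have Rb: "\<bar>R n \<omega> b - R n \<omega> \<alpha>\<bar> \<le> sqrt (Q n K \<alpha> h \<omega>)" unfolding b_def using j by (intro grid) auto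
  have Fineq: "F s' - F s \<le> f 0 * h" if "s \<le> s'" "a \<le> s" "s' \<le> b" for s s'
  proof -
    have "F s' - F s \<le> f 0 * (s' - s)" using that b0 by (intro F_lipschitz) auto
    also have "\<dots> \<le> f 0 * h" using that ba f_nonneg by (intro mult_left_mono) auto
    finally show ?thesis .
  qed
  have \<eta>ineq: "\<bar>(\<eta> s' - \<eta> s) * m\<bar> \<le> sqrt (f 0 * h) * \<bar>m\<bar>" if "s \<le> s'" "a \<le> s" "s' \<le> b" for s s'
    unfolding abs_mult
    by (rule mult_right_mono[OF order_trans[OF \<eta>_modulus[OF that(1)] real_sqrt_le_mono[OF Fineq[OF that]]] abs_ge_zero])
  have up: "R n \<omega> t \<le> R n \<omega> b + (F b - F t) + (\<eta> b - \<eta> t) * m"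
    using empirical_cdf_mono[of t b X n \<omega>] j by (simp add: R_def m_def algebra_simps)
  have lo: "R n \<omega> a - (F t - F a) - (\<eta> t - \<eta> a) * m \<le> R n \<omega> t"
    using empirical_cdf_mono[of a t X n \<omega>] j by (simp add: R_def m_def algebra_simps)
  have "F b - F t \<le> f 0 * h" "F t - F a \<le> f 0 * h"
    "\<bar>(\<eta> b - \<eta> t) * m\<bar> \<le> sqrt (f 0 * h) * \<bar>m\<bar>" "\<bar>(\<eta> t - \<eta> a) * m\<bar> \<le> sqrt (f 0 * h) * \<bar>m\<bar>"
    using j by (auto intro!: Fineq \<eta>ineq)
  with up lo Ra Rb show ?thesis unfolding m_def[symmetric] by linarith
qed

end

lemma powr_square: "(x powr a)\<^sup>2 = x powr (2 * a)" for x a :: real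
  by (simp only: power2_eq_square powr_add[symmetric] mult_2)

text \<open>Twice the binary logarithm, so that a grid with \<open>2 ^ K\<close> cells has a mesh of
  order \<open>1 / n\<^sup>2\<close>. The interpolation error in \<open>R_modulus\<close> is then
  negligible against \<open>B n\<close>, while \<open>K\<close> itself stays logarithmic.\<close>

definition dyadic_level :: "nat \<Rightarrow> nat" where
  "dyadic_level n = nat (2 * \<lceil>log 2 (real n)\<rceil>)"

lemma dyadic_level_ge:
  assumes n: "n \<ge> 1"
  shows "(real n)\<^sup>2 \<le> 2 ^ dyadic_level n"
proof -
  have l0: "log 2 (real n) \<ge> 0" using n by simp
  have K1: "2 * log 2 (real n) \<le> real (dyadic_level n)" unfolding dyadic_level_def using l0 by linarith
  have "(real n)\<^sup>2 = (2 powr (log 2 (real n)))\<^sup>2" using n by simp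
  also have "\<dots> = 2 powr (2 * log 2 (real n))" by (rule powr_square)
  also have "\<dots> \<le> 2 powr (real (dyadic_level n))" using K1 by (intro powr_mono) auto
  also have "\<dots> = 2 ^ dyadic_level n" by (simp add: powr_realpow)
  finally show ?thesis .
qed

lemma dyadic_level_le:
  assumes \<tau>: "\<tau> > 0"
  obtains C where "C > 0"
    "\<And>n. n \<ge> 1 \<Longrightarrow> (real (Suc (dyadic_level n)))\<^sup>2 \<le> C * real n powr (2 * \<tau>)"
proof -
  define C where "C = 2 / (\<tau> * ln 2) + 3"
  have C: "C > 0" using \<tau> by (simp add: C_def add_pos_pos)
  have bound: "(real (Suc (dyadic_level n)))\<^sup>2 \<le> C\<^sup>2 * real n powr (2 * \<tau>)" if n: "n \<ge> 1" for n :: nat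
  proof -
    have l0: "log 2 (real n) \<ge> 0" using n by simp
    have "ln (real n) \<le> real n powr \<tau> / \<tau>" using n \<tau> by (intro ln_powr_bound) auto
    then have "log 2 (real n) \<le> real n powr \<tau> / \<tau> / ln 2"
      unfolding log_def by (intro divide_right_mono) auto
    moreover have "1 \<le> real n powr \<tau>" using n \<tau> by (intro ge_one_powr_ge_zero) auto
    moreover have "real (Suc (dyadic_level n)) \<le> 2 * log 2 (real n) + 3"
      unfolding dyadic_level_def using l0 by linarith
    moreover have "C * real n powr \<tau> = 2 * (real n powr \<tau> / \<tau> / ln 2) + 3 * real n powr \<tau>"
      by (simp add: C_def algebra_simps)
    ultimately have "real (Suc (dyadic_level n)) \<le> C * real n powr \<tau>" by linarith
    then have "(real (Suc (dyadic_level n)))\<^sup>2 \<le> (C * real n powr \<tau>)\<^sup>2" by (intro power_mono) auto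
    also have "\<dots> = C\<^sup>2 * real n powr (2 * \<tau>)" by (simp add: power_mult_distrib powr_square)
    finally show ?thesis .
  qed
  show ?thesis by (rule that[of "C\<^sup>2"]) (use C bound in auto)
qed

section \<open>The variance of the sample mean\<close>

context lrd_gaussian begin

definition l1 :: "real \<Rightarrow> real" where "l1 x = 2 / ((1 - d) * (2 - d)) * l x"

text \<open>The asymptotic variance of the sample mean. Its power \<open>- 1 / 2\<close> is the
  normalisation in the theorem, apart from the derivative of \<eta>. Its sign is known only for
  large \<open>n\<close>.\<close>

definition B :: "nat \<Rightarrow> real" where "B n = l1 (real n) * real n powr (- d)"

definition V :: "nat \<Rightarrow> real" where
  "V n = (\<Sum>i=1..n. \<Sum>j=1..n. \<rho> (nat_dist i j)) / (real n)\<^sup>2"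

lemma slowly_varying_l1: "slowly_varying l1"
  unfolding l1_def[abs_def] using d by (intro slowly_varying_cmult l) auto

lemma avg_eq: "avg n \<omega> = (\<Sum>i=1..n. (1 / real n) * \<xi> i \<omega>)"
  by (simp add: avg_def sum_divide_distrib)

lemma gaussian_avg: "gaussian_rv M (avg n)"
  and expectation_avg: "expectation (avg n) = 0"
  and variance_avg: "variance (avg n) = V n"
proof -
  have J: "finite {1..n}" "{1..n} \<subseteq> {1..}" by auto
  show "gaussian_rv M (avg n)" unfolding avg_eq[abs_def] by (rule gaussian_sum[OF J])
  show "expectation (avg n) = 0" unfolding avg_eq[abs_def] by (rule expectation_linear_combination(1)[OF J])
  show "variance (avg n) = V n"
    unfolding avg_eq[abs_def] expectation_linear_combination(2)[OF J]
    by (simp add: V_def power2_eq_square sum_divide_distrib)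
qed

lemma expectation_avg_square:
  "integrable M (\<lambda>\<omega>. (avg n \<omega>)\<^sup>2)" "expectation (\<lambda>\<omega>. (avg n \<omega>)\<^sup>2) = V n"
  using gaussian_rv_centered_cases(1)[OF gaussian_avg expectation_avg] variance_avg[of n] expectation_avg[of n]
  by simp_all

lemma V_div_B: "(\<lambda>n. V n / B n) \<longlonglongrightarrow> 1"
proof -
  define c where "c = 2 / ((1 - d) * (2 - d))"
  have c: "c > 0" using d by (simp add: c_def)
  have "(\<lambda>n. (\<Sum>i=1..n. \<Sum>j=1..n. \<rho> (nat_dist i j)) / (real n powr (2 - d) * l (real n)) / c) \<longlonglongrightarrow> c / c"
    unfolding c_def
    by (intro tendsto_divide tendsto_const lrd_covariance_sum l) (use d in \<open>auto simp: \<rho>_def\<close>)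
  moreover have "\<forall>\<^sub>F n in sequentially. (\<Sum>i=1..n. \<Sum>j=1..n. \<rho> (nat_dist i j)) / (real n powr (2 - d) * l (real n)) / c = V n / B n"
    using eventually_ge_at_top[of 1]
  proof eventually_elim
    case (elim n)
    have "real n powr (2 - d) = (real n)\<^sup>2 * real n powr (- d)"
      using elim powr_add[of "real n" 2 "-d"] by simp
    then show ?case by (simp add: V_def B_def l1_def c_def mult_ac)
  qed
  ultimately show ?thesis using c by (simp add: Lim_transform_eventually)
qed

text \<open>A lower bound by a pure power, at the cost of \<tau>, lets Markov's inequality with
  thresholds proportional to \<open>B n\<close> be evaluated in powers of \<open>n\<close>.\<close>

lemma B_lower:
  assumes "\<tau> > 0"
  obtains c where "c > 0" "\<forall>\<^sub>F n in sequentially. c * real n powr (- d - \<tau>) \<le> B n"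
proof -
  obtain C where C: "C > 0" "\<And>k::nat. k \<ge> 1 \<Longrightarrow> \<bar>l1 (real k)\<bar> \<le> C * real k powr \<tau>"
    "\<forall>\<^sub>F n in sequentially. real n powr (- \<tau>) / C \<le> l1 (real n)"
    using slowly_varying_nat_bounds[OF slowly_varying_l1 assms] by blast
  show ?thesis
  proof (rule that[of "1 / C"])
    show "1 / C > 0" using C by simp
    show "\<forall>\<^sub>F n in sequentially. 1 / C * real n powr (- d - \<tau>) \<le> B n"
      using C(3) eventually_ge_at_top[of 1]
    proof eventually_elim
      case (elim n)
      have "1 / C * real n powr (- d - \<tau>) = real n powr (- \<tau>) / C * real n powr (- d)"
        using powr_add[of "real n" "- d" "- \<tau>"] by simp
      also have "\<dots> \<le> l1 (real n) * real n powr (- d)" using elim by (intro mult_right_mono) auto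
      finally show ?case by (simp add: B_def)
    qed
  qed
qed

lemma B_pos: "\<forall>\<^sub>F n in sequentially. 0 < B n"
proof -
  obtain c where c: "c > 0" "\<forall>\<^sub>F n in sequentially. c * real n powr (- d - 1) \<le> B n"
    using B_lower[of 1] by auto
  show ?thesis using c(2) eventually_ge_at_top[of 1]
  proof eventually_elim
    case (elim n)
    then have "0 < c * real n powr (- d - 1)" using c(1) by simp
    then show ?case using elim by linarith
  qed
qed

lemma B_tendsto_0: "B \<longlonglongrightarrow> 0"
proof -
  obtain C where C: "C > 0" "\<And>k::nat. k \<ge> 1 \<Longrightarrow> \<bar>l1 (real k)\<bar> \<le> C * real k powr (d/2)"
    using slowly_varying_nat_bounds[OF slowly_varying_l1, of "d/2"] d by auto
  show ?thesis
  proof (rule Lim_null_comparison)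
    show "\<forall>\<^sub>F n in sequentially. norm (B n) \<le> C * real n powr (- (d / 2))"
      using eventually_ge_at_top[of 1]
    proof eventually_elim
      case (elim n)
      have "norm (B n) \<le> C * real n powr (d / 2) * real n powr (- d)"
        using C(2)[OF elim] by (simp add: B_def abs_mult mult_right_mono)
      also have "\<dots> = C * real n powr (- (d / 2))" by (simp add: mult.assoc powr_add[symmetric])
      finally show ?case .
    qed
    have "(\<lambda>n. C * real n powr (- (d / 2))) \<longlonglongrightarrow> C * 0"
      by (intro tendsto_intros tendsto_neg_powr filterlim_real_sequentially) (use d in auto)
    then show "(\<lambda>n. C * real n powr (- (d / 2))) \<longlonglongrightarrow> 0" by simp
  qed
qed

text \<open>Near \<open>t\<^sub>0\<close>, on a window of width \<open>n powr (- d / 8)\<close>, the fluctuations of \<open>R n\<close> are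
  smaller than \<open>B n\<close>; outside it they are smaller than the squared width of the window.\<close>

lemma R_uniform:
  assumes t0: "T < t0" "t0 < 0" and c: "c > 0" and e: "e > 0" and A: "A > 0"
  shows "\<exists>G. (\<forall>n. G n \<in> events) \<and> (\<lambda>n. prob (G n)) \<longlonglongrightarrow> 1 \<and>
    (\<forall>\<^sub>F n in sequentially. \<forall>\<omega>\<in>G n. \<bar>avg n \<omega>\<bar> \<le> A * sqrt (B n) \<longrightarrow>
       (\<forall>t\<in>{T..0}. \<bar>R n \<omega> t - R n \<omega> t0\<bar> \<le> c * (t - t0)\<^sup>2 + e * B n))"
proof -
  \<comment> \<open>Two exponents must come out negative: \<open>6 * \<tau> - \<theta>\<close> for
    the shrinking window, which needs \<theta> large against \<tau>, and
    \<open>4 * \<tau> - 2 * d + 4 * \<theta>\<close> for the long interval, which needs \<theta>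
    below about \<open>d / 2\<close>. These fractions of \<open>d\<close> meet both with room to
    spare.\<close>
  define \<tau> \<theta> where "\<tau> = d / 100" and "\<theta> = d / 8"
  have \<tau>: "0 < \<tau>" "\<tau> < d" "0 < \<theta>" using d by (auto simp: \<tau>_def \<theta>_def)
  define K where "K = dyadic_level"
  obtain CK where CK: "CK > 0" "\<And>n. n \<ge> 1 \<Longrightarrow> (real (Suc (K n)))\<^sup>2 \<le> CK * real n powr (2 * \<tau>)"
    unfolding K_def using dyadic_level_le[OF \<tau>(1)] by blast
  have K: "CK > 0" "\<And>n. n \<ge> 1 \<Longrightarrow> (real n)\<^sup>2 \<le> 2 ^ K n"
    "\<And>n. n \<ge> 1 \<Longrightarrow> (real (Suc (K n)))\<^sup>2 \<le> CK * real n powr (2 * \<tau>)"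
    using CK dyadic_level_ge by (auto simp only: K_def)
  have \<rho>: "\<rho> 0 = 1" "\<And>k. k \<ge> 1 \<Longrightarrow> \<rho> k = real k powr (- d) * l (real k)" by (auto simp: \<rho>_def)
  obtain C where C: "C > 0"
    "\<And>n. n \<ge> 1 \<Longrightarrow> (\<Sum>i=1..n. \<Sum>j=1..n. (\<rho> (nat_dist i j))\<^sup>2) \<le> C * real n powr (2 - 2 * d + 2 * \<tau>)"
    using lrd_covariance_square_sum[OF l d(2) \<tau>(1,2) \<rho>] by blast
  have v: "v n \<le> 4 * C * real n powr (- 2 * d + 2 * \<tau>)" if n: "n \<ge> 1" for n
  proof -
    have "v n \<le> 4 * (C * real n powr (2 - 2 * d + 2 * \<tau>)) / (real n)\<^sup>2"
      unfolding v_def by (intro divide_right_mono mult_left_mono C(2) n) auto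
    also have "real n powr (2 - 2 * d + 2 * \<tau>) = (real n)\<^sup>2 * real n powr (- 2 * d + 2 * \<tau>)"
    proof -
      have eq: "2 - 2 * d + 2 * \<tau> = 2 + (- 2 * d + 2 * \<tau>)" by simp
      show ?thesis unfolding eq powr_add using n by simp
    qed
    finally show ?thesis using n by simp
  qed
  obtain cB where cB: "cB > 0" "\<forall>\<^sub>F n in sequentially. cB * real n powr (- d - \<tau>) \<le> B n"
    using B_lower[OF \<tau>(1)] by blast
  define \<kappa> where "\<kappa> n = real n powr (- \<theta>)" for n
  \<comment> \<open>\<open>h1\<close> divides the window from \<open>t0 - \<kappa> n\<close> to
    \<open>t0 + \<kappa> n\<close>, and \<open>h2\<close> the interval from \<open>T\<close> to 0,
    into \<open>2 ^ K n\<close> cells each.\<close>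
  define h1 h2 where "h1 n = 2 * \<kappa> n / 2 ^ K n" and "h2 n = - T / 2 ^ K n" for n
  define Q1 Q2 where "Q1 n = Q n (K n) (t0 - \<kappa> n) (h1 n)" and "Q2 n = Q n (K n) T (h2 n)" for n
  \<comment> \<open>Thresholds for the square roots of \<open>Q1\<close> and \<open>Q2\<close>. The
    eighths leave room for the interpolation error and for comparing both \<open>t\<close> and
    \<open>t0\<close> with the left end of the grid.\<close>
  define x1 x2 where "x1 n = e / 8 * B n" and "x2 n = c / 8 * (\<kappa> n)\<^sup>2" for n
  have h2: "0 < h2 n" "T + 2 ^ K n * h2 n = 0" for n
  proof -
    have "0 < - T" using t0 by simp
    then show "0 < h2 n" unfolding h2_def by (rule divide_pos_pos) simp
    show "T + 2 ^ K n * h2 n = 0" by (simp add: h2_def)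
  qed
  define G where "G n = {\<omega> \<in> space M. Q1 n \<omega> < (x1 n)\<^sup>2 \<and> Q2 n \<omega> < (x2 n)\<^sup>2}" for n
  have [measurable]: "Q1 n \<in> borel_measurable M" "Q2 n \<in> borel_measurable M" for n
    by (auto simp: Q1_def Q2_def)
  have G_ev: "G n \<in> events" for n unfolding G_def by measurable
  have \<kappa>0: "\<kappa> \<longlonglongrightarrow> 0" unfolding \<kappa>_def by (rule tendsto_neg_powr) (use \<tau> in \<open>auto intro: filterlim_real_sequentially\<close>)
  have ev\<kappa>: "\<forall>\<^sub>F n in sequentially. \<kappa> n < min 1 (- t0)" using t0 by (intro order_tendstoD[OF \<kappa>0]) auto
  have f0: "0 \<le> f 0" by (rule f_nonneg)
  have probG: "\<forall>\<^sub>F n in sequentially. 1 - (CK * f 0 * 2 * (4 * C) / (e / 8 * cB)\<^sup>2 * real n powr (6 * \<tau> - \<theta>)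
       + CK * f 0 * (- T) * (4 * C) / (c / 8)\<^sup>2 * real n powr (4 * \<tau> - 2 * d + 4 * \<theta>)) \<le> prob (G n)"
    using ev\<kappa> cB(2) eventually_ge_at_top[of 1]
  proof eventually_elim
    case (elim n)
    have \<kappa>p: "\<kappa> n > 0" "t0 + \<kappa> n \<le> 0" using elim by (auto simp: \<kappa>_def)
    have Bp: "B n > 0" using elim cB(1) by (intro less_le_trans[OF _ elim(2)]) simp
    have i1: "integrable M (Q1 n)" unfolding Q1_def using elim \<kappa>p by (intro integrable_Q) (auto simp: h1_def)
    have i2: "integrable M (Q2 n)" unfolding Q2_def using elim h2[of n] by (intro integrable_Q) auto
    have xp: "x1 n > 0" "x2 n > 0" using Bp \<kappa>p c e by (auto simp: x1_def x2_def)
    have E1: "expectation (Q1 n) \<le> CK * f 0 * 2 * (4 * C) * real n powr (4 * \<tau> - 2 * d - \<theta>)"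
    proof -
      have "expectation (Q1 n) \<le> (real (Suc (K n)))\<^sup>2 * (f 0 * (2 ^ K n * h1 n)) * v n"
        unfolding Q1_def using elim \<kappa>p by (intro expectation_Q) (auto simp: h1_def)
      also have "2 ^ K n * h1 n = 2 * \<kappa> n" by (simp add: h1_def)
      also have "(real (Suc (K n)))\<^sup>2 * (f 0 * (2 * \<kappa> n)) * v n \<le>
         (CK * real n powr (2 * \<tau>)) * (f 0 * (2 * \<kappa> n)) * (4 * C * real n powr (- 2 * d + 2 * \<tau>))"
        using K(3)[OF elim(3)] v[OF elim(3)] K(1) f0 \<kappa>p v_nonneg[of n] by (intro mult_mono) auto
      also have "\<dots> = CK * f 0 * 2 * (4 * C) * (real n powr (2 * \<tau>) * real n powr (- \<theta>) * real n powr (- 2 * d + 2 * \<tau>))"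
        by (simp add: \<kappa>_def mult_ac)
      also have "real n powr (2 * \<tau>) * real n powr (- \<theta>) * real n powr (- 2 * d + 2 * \<tau>) = real n powr (4 * \<tau> - 2 * d - \<theta>)"
        unfolding powr_add[symmetric] by (rule arg_cong[where f="(powr) (real n)"]) linarith
      finally show ?thesis .
    qed
    have E2: "expectation (Q2 n) \<le> CK * f 0 * (- T) * (4 * C) * real n powr (4 * \<tau> - 2 * d)"
    proof -
      have "expectation (Q2 n) \<le> (real (Suc (K n)))\<^sup>2 * (f 0 * (2 ^ K n * h2 n)) * v n"
        unfolding Q2_def using elim h2[of n] by (intro expectation_Q) auto
      also have "2 ^ K n * h2 n = - T" by (simp add: h2_def)
      also have "(real (Suc (K n)))\<^sup>2 * (f 0 * (- T)) * v n \<le>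
         (CK * real n powr (2 * \<tau>)) * (f 0 * (- T)) * (4 * C * real n powr (- 2 * d + 2 * \<tau>))"
        using K(3)[OF elim(3)] v[OF elim(3)] K(1) f0 t0 v_nonneg[of n]
        by (intro mult_mono mult_right_mono mult_nonneg_nonneg) auto
      also have "\<dots> = CK * f 0 * (- T) * (4 * C) * (real n powr (2 * \<tau>) * real n powr (- 2 * d + 2 * \<tau>))"
        by (simp only: mult_ac)
      also have "real n powr (2 * \<tau>) * real n powr (- 2 * d + 2 * \<tau>) = real n powr (4 * \<tau> - 2 * d)"
        unfolding powr_add[symmetric] by (rule arg_cong[where f="(powr) (real n)"]) linarith
      finally show ?thesis .
    qed
    \<comment> \<open>Dividing by \<open>(B n)\<^sup>2\<close> costs
      \<open>n powr (2 * d + 2 * \<tau>)\<close>, which cancels the \<open>- 2 * d\<close> from the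
      variance; what remains negative is the gain \<open>- \<theta>\<close> from the width of the
      window.\<close>
    have P1: "prob {\<omega> \<in> space M. Q1 n \<omega> \<ge> (x1 n)\<^sup>2} \<le> CK * f 0 * 2 * (4 * C) / (e / 8 * cB)\<^sup>2 * real n powr (6 * \<tau> - \<theta>)"
    proof -
      have "prob {\<omega> \<in> space M. Q1 n \<omega> \<ge> (x1 n)\<^sup>2} \<le> expectation (Q1 n) / (x1 n)\<^sup>2"
        using xp by (intro integral_Markov_inequality_measure[where A="{}"] i1 AE_I2) (auto simp: Q1_def Q_nonneg)
      also have "\<dots> \<le> CK * f 0 * 2 * (4 * C) * real n powr (4 * \<tau> - 2 * d - \<theta>) / (e / 8 * (cB * real n powr (- d - \<tau>)))\<^sup>2"
        unfolding x1_def using E1 elim cB(1) e K(1) C(1) f0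
        by (intro frac_le power_mono mult_left_mono mult_nonneg_nonneg) auto
      also have "\<dots> = CK * f 0 * 2 * (4 * C) / (e / 8 * cB)\<^sup>2 * (real n powr (4 * \<tau> - 2 * d - \<theta>) / (real n powr (- d - \<tau>))\<^sup>2)"
        by (simp only: power_mult_distrib mult.assoc times_divide_times_eq)
      also have "(real n powr (- d - \<tau>))\<^sup>2 = real n powr (- 2 * d - 2 * \<tau>)" unfolding powr_square by (simp add: algebra_simps)
      also have "real n powr (4 * \<tau> - 2 * d - \<theta>) / real n powr (- 2 * d - 2 * \<tau>) = real n powr (6 * \<tau> - \<theta>)"
        unfolding powr_diff[symmetric] by (rule arg_cong[where f="(powr) (real n)"]) linarith
      finally show ?thesis .
    qed
    have P2: "prob {\<omega> \<in> space M. Q2 n \<omega> \<ge> (x2 n)\<^sup>2} \<le> CK * f 0 * (- T) * (4 * C) / (c / 8)\<^sup>2 * real n powr (4 * \<tau> - 2 * d + 4 * \<theta>)"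
    proof -
      have "prob {\<omega> \<in> space M. Q2 n \<omega> \<ge> (x2 n)\<^sup>2} \<le> expectation (Q2 n) / (x2 n)\<^sup>2"
        using xp by (intro integral_Markov_inequality_measure[where A="{}"] i2 AE_I2) (auto simp: Q2_def Q_nonneg)
      also have "\<dots> \<le> CK * f 0 * (- T) * (4 * C) * real n powr (4 * \<tau> - 2 * d) / (x2 n)\<^sup>2"
        using E2 by (intro divide_right_mono) auto
      also have "\<dots> = CK * f 0 * (- T) * (4 * C) / (c / 8)\<^sup>2 * (real n powr (4 * \<tau> - 2 * d) / ((\<kappa> n)\<^sup>2)\<^sup>2)"
        by (simp only: x2_def power_mult_distrib times_divide_times_eq)
      also have "((\<kappa> n)\<^sup>2)\<^sup>2 = real n powr (- 4 * \<theta>)" unfolding \<kappa>_def powr_square by simp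
      also have "real n powr (4 * \<tau> - 2 * d) / real n powr (- 4 * \<theta>) = real n powr (4 * \<tau> - 2 * d + 4 * \<theta>)"
        unfolding powr_diff[symmetric] by (rule arg_cong[where f="(powr) (real n)"]) linarith
      finally show ?thesis .
    qed
    have "space M - G n \<subseteq> {\<omega> \<in> space M. Q1 n \<omega> \<ge> (x1 n)\<^sup>2} \<union> {\<omega> \<in> space M. Q2 n \<omega> \<ge> (x2 n)\<^sup>2}"
      by (auto simp: G_def)
    then have "prob (space M - G n) \<le> prob ({\<omega> \<in> space M. Q1 n \<omega> \<ge> (x1 n)\<^sup>2} \<union> {\<omega> \<in> space M. Q2 n \<omega> \<ge> (x2 n)\<^sup>2})"
      by (intro finite_measure_mono) auto
    also have "\<dots> \<le> prob {\<omega> \<in> space M. Q1 n \<omega> \<ge> (x1 n)\<^sup>2} + prob {\<omega> \<in> space M. Q2 n \<omega> \<ge> (x2 n)\<^sup>2}"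
      by (intro measure_Un_le) auto
    finally show ?case using P1 P2 prob_compl[OF G_ev[of n]] by linarith
  qed
  have exps: "6 * \<tau> - \<theta> < 0" "4 * \<tau> - 2 * d + 4 * \<theta> < 0" using d by (auto simp: \<tau>_def \<theta>_def)
  have lim1: "(\<lambda>n. 1 - (CK * f 0 * 2 * (4 * C) / (e / 8 * cB)\<^sup>2 * real n powr (6 * \<tau> - \<theta>)
       + CK * f 0 * (- T) * (4 * C) / (c / 8)\<^sup>2 * real n powr (4 * \<tau> - 2 * d + 4 * \<theta>))) \<longlonglongrightarrow> 1 - (CK * f 0 * 2 * (4 * C) / (e / 8 * cB)\<^sup>2 * 0
       + CK * f 0 * (- T) * (4 * C) / (c / 8)\<^sup>2 * 0)"
    by (intro tendsto_diff tendsto_const tendsto_add tendsto_mult tendsto_neg_powr exps filterlim_real_sequentially)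
  have lim: "(\<lambda>n. prob (G n)) \<longlonglongrightarrow> 1"
  proof (rule tendsto_sandwich[OF probG])
    show "\<forall>\<^sub>F n in sequentially. prob (G n) \<le> 1" by simp
    show "(\<lambda>n. 1 - (CK * f 0 * 2 * (4 * C) / (e / 8 * cB)\<^sup>2 * real n powr (6 * \<tau> - \<theta>)
       + CK * f 0 * (- T) * (4 * C) / (c / 8)\<^sup>2 * real n powr (4 * \<tau> - 2 * d + 4 * \<theta>))) \<longlonglongrightarrow> 1"
      using lim1 by simp
  qed simp
  \<comment> \<open>\<open>max 2 (- T)\<close> bounds the lengths of both grids, since
    \<open>2 * \<kappa> n < 2\<close> eventually.\<close>
  define H where "H = f 0 * max 2 (- T)"
  have H: "H \<ge> 0" unfolding H_def using f0 by (intro mult_nonneg_nonneg) auto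
  have small: "\<forall>\<^sub>F n in sequentially. H / (real n)\<^sup>2 + sqrt (H / (real n)\<^sup>2) * (A * sqrt (B n)) \<le> e / 8 * B n"
  proof -
    have z: "(\<lambda>n. H / (real n)\<^sup>2 / B n) \<longlonglongrightarrow> 0"
    proof (rule Lim_null_comparison)
      show "\<forall>\<^sub>F n in sequentially. norm (H / (real n)\<^sup>2 / B n) \<le> H / cB * real n powr (d + \<tau> - 2)"
        using cB(2) eventually_ge_at_top[of 1]
      proof eventually_elim
        case (elim n)
        have p: "0 < cB * real n powr (- d - \<tau>)" using cB(1) elim by simp
        have Bp: "B n > 0" using p elim(1) by linarith
        have "norm (H / (real n)\<^sup>2 / B n) = H / (real n)\<^sup>2 / B n" using H Bp by simp
        also have "\<dots> \<le> H / (real n)\<^sup>2 / (cB * real n powr (- d - \<tau>))"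
          by (rule divide_left_mono[OF elim(1) _ mult_pos_pos[OF Bp p]]) (use H in simp)
        also have "\<dots> = H / real n powr 2 / (cB * real n powr (- d - \<tau>))" using elim by simp
        also have "H / real n powr 2 / (cB * real n powr (- d - \<tau>)) = H / cB * (1 / (real n powr 2 * real n powr (- d - \<tau>)))" by simp
        also have "real n powr 2 * real n powr (- d - \<tau>) = real n powr (- (d + \<tau> - 2))" unfolding powr_add[symmetric] by (rule arg_cong[where f="(powr) (real n)"]) linarith
        also have "1 / real n powr (- (d + \<tau> - 2)) = real n powr (d + \<tau> - 2)" by (subst powr_minus_divide) simp
        finally show ?case .
      qed
      have "(\<lambda>n. H / cB * real n powr (d + \<tau> - 2)) \<longlonglongrightarrow> H / cB * 0"
        by (intro tendsto_mult tendsto_const tendsto_neg_powr filterlim_real_sequentially) (use d in \<open>auto simp: \<tau>_def\<close>)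
      then show "(\<lambda>n. H / cB * real n powr (d + \<tau> - 2)) \<longlonglongrightarrow> 0" by simp
    qed
    have "(\<lambda>n. H / (real n)\<^sup>2 / B n + sqrt (H / (real n)\<^sup>2 / B n) * A) \<longlonglongrightarrow> 0 + sqrt 0 * A"
      by (intro tendsto_intros z)
    then have "\<forall>\<^sub>F n in sequentially. H / (real n)\<^sup>2 / B n + sqrt (H / (real n)\<^sup>2 / B n) * A < e / 8"
      using e by (intro order_tendstoD) auto
    then show ?thesis using B_pos
    proof eventually_elim
      case (elim n)
      have "H / (real n)\<^sup>2 + sqrt (H / (real n)\<^sup>2) * (A * sqrt (B n)) = (H / (real n)\<^sup>2 / B n + sqrt (H / (real n)\<^sup>2 / B n) * A) * B n"
      proof -
        define s where "s = sqrt (B n)"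
        have s: "s * s = B n" using elim by (simp add: s_def)
        have "x * A * (s * s) = x * s * (A * s)" for x by (simp only: mult_ac)
        then have "sqrt (H / (real n)\<^sup>2 / B n) * A * B n = sqrt (H / (real n)\<^sup>2 / B n) * sqrt (B n) * (A * sqrt (B n))"
          unfolding s unfolding s_def .
        also have "sqrt (H / (real n)\<^sup>2 / B n) * sqrt (B n) = sqrt (H / (real n)\<^sup>2)"
          using elim by (simp add: real_sqrt_mult[symmetric])
        finally have 1: "sqrt (H / (real n)\<^sup>2 / B n) * A * B n = sqrt (H / (real n)\<^sup>2) * (A * sqrt (B n))" .
        have "H / (real n)\<^sup>2 / B n * B n = H / (real n)\<^sup>2" using elim by simp
        then show ?thesis unfolding distrib_right 1 by (simp only:)
      qed
      also have "\<dots> \<le> e / 8 * B n" using elim by (intro mult_right_mono) auto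
      finally show ?case .
    qed
  qed
  have det: "\<forall>\<^sub>F n in sequentially. \<forall>\<omega>\<in>G n. \<bar>avg n \<omega>\<bar> \<le> A * sqrt (B n) \<longrightarrow>
       (\<forall>t\<in>{T..0}. \<bar>R n \<omega> t - R n \<omega> t0\<bar> \<le> c * (t - t0)\<^sup>2 + e * B n)"
    using ev\<kappa> small B_pos eventually_ge_at_top[of 1]
  proof eventually_elim
    case (elim n)
    show ?case
    proof (intro ballI impI)
      fix \<omega> t assume \<omega>: "\<omega> \<in> G n" and avg: "\<bar>avg n \<omega>\<bar> \<le> A * sqrt (B n)" and t: "t \<in> {T..0}"
      have \<kappa>p: "\<kappa> n > 0" "\<kappa> n < 1" "t0 + \<kappa> n \<le> 0" using elim by (auto simp: \<kappa>_def)
      have hp: "h1 n > 0" "h2 n > 0" using \<kappa>p h2 by (auto simp: h1_def)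
      have Qs: "sqrt (Q1 n \<omega>) \<le> x1 n" "sqrt (Q2 n \<omega>) \<le> x2 n"
      proof -
        have "0 \<le> x1 n" "0 \<le> x2 n" using elim e c by (auto simp: x1_def x2_def)
        moreover have "Q1 n \<omega> < (x1 n)\<^sup>2" "Q2 n \<omega> < (x2 n)\<^sup>2" using \<omega> by (auto simp: G_def)
        ultimately show "sqrt (Q1 n \<omega>) \<le> x1 n" "sqrt (Q2 n \<omega>) \<le> x2 n"
          by (simp_all add: real_le_lsqrt less_imp_le)
      qed
      have err: "f 0 * h + sqrt (f 0 * h) * \<bar>avg n \<omega>\<bar> \<le> e / 8 * B n" if "h = a / 2 ^ K n" "0 \<le> a" "a \<le> max 2 (- T)" for h a
      proof -
        have n2: "(real n)\<^sup>2 > 0" using elim by simp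
        have "a / 2 ^ K n \<le> max 2 (- T) / (real n)\<^sup>2"
          using that K(2)[OF elim(4)] n2 by (intro frac_le) auto
        then have fh: "f 0 * h \<le> H / (real n)\<^sup>2"
          unfolding that(1) H_def using f0 mult_left_mono[of "a / 2 ^ K n" "max 2 (- T) / (real n)\<^sup>2" "f 0"] by simp
        have "sqrt (f 0 * h) * \<bar>avg n \<omega>\<bar> \<le> sqrt (H / (real n)\<^sup>2) * (A * sqrt (B n))"
          using fh avg H by (intro mult_mono real_sqrt_le_mono) auto
        then show ?thesis using fh elim(2) by linarith
      qed
      show "\<bar>R n \<omega> t - R n \<omega> t0\<bar> \<le> c * (t - t0)\<^sup>2 + e * B n"
      proof (cases "\<bar>t - t0\<bar> \<le> \<kappa> n")
        case True
        have "\<bar>R n \<omega> s - R n \<omega> (t0 - \<kappa> n)\<bar> \<le> x1 n + e / 8 * B n" if "\<bar>s - t0\<bar> \<le> \<kappa> n" for s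
        proof -
          have "2 ^ K n * h1 n = 2 * \<kappa> n" by (simp add: h1_def)
          then have "\<bar>R n \<omega> s - R n \<omega> (t0 - \<kappa> n)\<bar> \<le> sqrt (Q1 n \<omega>) + f 0 * h1 n + sqrt (f 0 * h1 n) * \<bar>avg n \<omega>\<bar>"
            unfolding Q1_def using that hp \<kappa>p elim by (intro R_modulus) (auto simp: abs_le_iff)
          moreover have "f 0 * h1 n + sqrt (f 0 * h1 n) * \<bar>avg n \<omega>\<bar> \<le> e / 8 * B n"
            using \<kappa>p by (intro err[OF h1_def[of n]]) auto
          ultimately show ?thesis using Qs(1) by linarith
        qed
        from this[OF True] this[of t0] \<kappa>p have "\<bar>R n \<omega> t - R n \<omega> t0\<bar> \<le> 2 * (x1 n + e / 8 * B n)" by auto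
        also have "\<dots> \<le> e * B n" using elim e by (simp add: x1_def)
        also have "\<dots> \<le> c * (t - t0)\<^sup>2 + e * B n" using c by simp
        finally show ?thesis .
      next
        case False
        have "\<bar>R n \<omega> s - R n \<omega> T\<bar> \<le> x2 n + e / 8 * B n" if "T \<le> s" "s \<le> 0" for s
        proof -
          have "2 ^ K n * h2 n = - T" by (simp add: h2_def)
          then have "\<bar>R n \<omega> s - R n \<omega> T\<bar> \<le> sqrt (Q2 n \<omega>) + f 0 * h2 n + sqrt (f 0 * h2 n) * \<bar>avg n \<omega>\<bar>"
            unfolding Q2_def using that hp elim by (intro R_modulus) auto
          moreover have "f 0 * h2 n + sqrt (f 0 * h2 n) * \<bar>avg n \<omega>\<bar> \<le> e / 8 * B n"
            using t0 by (intro err[OF h2_def[of n]]) auto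
          ultimately show ?thesis using Qs(2) by linarith
        qed
        from this[of t] this[of t0] t t0 have "\<bar>R n \<omega> t - R n \<omega> t0\<bar> \<le> 2 * (x2 n + e / 8 * B n)" by auto
        also have "\<dots> \<le> c * (\<kappa> n)\<^sup>2 + e * B n"
        proof -
          have "0 \<le> c * (\<kappa> n)\<^sup>2" "0 \<le> e * B n" using elim e c by simp_all
          then show ?thesis unfolding x2_def by simp
        qed
        also have "(\<kappa> n)\<^sup>2 \<le> (t - t0)\<^sup>2" using False \<kappa>p by (subst abs_le_square_iff[symmetric]) auto
        finally show ?thesis using c by simp
      qed
    qed
  qed
  show ?thesis by (intro exI[of _ G] conjI allI G_ev lim det)
qed

end


section \<open>Asymptotic normality\<close>

context lrd_gaussian begin

text \<open>The centring constant multiplies the first Hermite polynomial \<open>x\<close>, which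
  has mean 0, and drops out; transport to the law of \<open>\<xi> 1\<close> leaves the integral that
  defines \<eta>.\<close>

lemma hermite_coeff_eq_\<eta>: "hermite_coeff M (\<xi> 1) g 1 = \<eta>"
proof
  fix t
  have [measurable]: "\<xi> 1 \<in> borel_measurable M" "\<xi> (Suc 0) \<in> borel_measurable M"
    by (simp_all add: xi_measurable)
  let ?A = "{x. g x \<le> t}" and ?c = "cdf (distr M borel (\<lambda>\<omega>. g (\<xi> 1 \<omega>))) t"
  have A[measurable]: "?A \<in> sets borel" by measurable
  have i1: "integrable M (\<lambda>\<omega>. indicator ?A (\<xi> 1 \<omega>) * \<xi> 1 \<omega>)"
    using indicator_mult_integrable[OF A] unfolding distr_xi[OF order_refl, symmetric]
    by (subst (asm) integrable_distr_eq) auto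
  have "hermite_coeff M (\<xi> 1) g 1 t = expectation (\<lambda>\<omega>. indicator ?A (\<xi> 1 \<omega>) * \<xi> 1 \<omega> - ?c * \<xi> 1 \<omega>)"
    unfolding hermite_coeff_def
    by (intro Bochner_Integration.integral_cong) (auto simp: indicator_def left_diff_distrib)
  also have "\<dots> = expectation (\<lambda>\<omega>. indicator ?A (\<xi> 1 \<omega>) * \<xi> 1 \<omega>) - ?c * expectation (\<xi> 1)"
    using i1 xi_integrable[of 1] by simp
  also have "\<dots> = expectation (\<lambda>\<omega>. indicator ?A (\<xi> 1 \<omega>) * \<xi> 1 \<omega>)" using mean_zero[of 1] by simp
  also have "\<dots> = \<eta> t"
    unfolding \<eta>_def distr_xi[OF order_refl, symmetric] by (subst integral_distr) auto
  finally show "hermite_coeff M (\<xi> 1) g 1 t = \<eta> t" .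
qed

lemma \<eta>_increment_le_1: "\<bar>\<eta> t - \<eta> s\<bar> \<le> 1"
proof -
  have *: "\<bar>\<eta> t - \<eta> s\<bar> \<le> 1" if "s \<le> t" for s t
  proof -
    have "F t - F s \<le> 1" unfolding F_diff[OF that] by simp
    then have "sqrt (F t - F s) \<le> 1" by (simp only: real_sqrt_le_1_iff)
    with \<eta>_modulus[OF that] show ?thesis by linarith
  qed
  show ?thesis using *[of s t] *[of t s] by (cases "s \<le> t") (auto simp: abs_minus_commute)
qed

section \<open>Curvature of the distribution function\<close>

text \<open>The derivative at one point traps the increments of \<open>f\<close> from that point
  between slopes \<open>D / 2\<close> and \<open>2 * D\<close>. The lower slope yields the curvature
  of \<open>F\<close>; the upper one limits the bias over the comparison distance.\<close>

lemma density_slope: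
  assumes f': "DERIV f t0 :> D" "D > 0"
  obtains r where "r > 0" "\<And>u. t0 \<le> u \<Longrightarrow> u < t0 + r \<Longrightarrow> D / 2 * (u - t0) \<le> f u - f t0 \<and> f u - f t0 \<le> 2 * D * (u - t0)"
    "\<And>u. t0 - r < u \<Longrightarrow> u \<le> t0 \<Longrightarrow> D / 2 * (t0 - u) \<le> f t0 - f u \<and> f t0 - f u \<le> 2 * D * (t0 - u)"
proof -
  have "(f has_derivative (*) D) (at t0)" using f'(1) by (simp add: has_field_derivative_def)
  then obtain r where r: "r > 0" "\<And>y. norm (y - t0) < r \<Longrightarrow> norm (f y - f t0 - D * (y - t0)) \<le> D / 2 * norm (y - t0)"
    using f'(2) unfolding has_derivative_at_alt by (meson half_gt_zero)
  have aux: "w / 2 \<le> p \<and> p \<le> 2 * w" if "\<bar>p - w\<bar> \<le> w / 2" "0 \<le> w" for p w :: real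
    using that unfolding abs_le_iff by linarith
  show ?thesis
  proof (rule that[OF r(1)])
    fix u assume u: "t0 \<le> u" "u < t0 + r"
    have "\<bar>(f u - f t0) - D * (u - t0)\<bar> \<le> D * (u - t0) / 2" using r(2)[of u] u by simp
    from aux[OF this] show "D / 2 * (u - t0) \<le> f u - f t0 \<and> f u - f t0 \<le> 2 * D * (u - t0)"
      using u f'(2) by simp
  next
    fix u assume u: "t0 - r < u" "u \<le> t0"
    have "(f t0 - f u) - D * (t0 - u) = - (f u - f t0 - D * (u - t0))" by (simp add: algebra_simps)
    then have "\<bar>(f t0 - f u) - D * (t0 - u)\<bar> \<le> D * (t0 - u) / 2"
      using r(2)[of u] u by (simp only: abs_minus_cancel) simp
    from aux[OF this] show "D / 2 * (t0 - u) \<le> f t0 - f u \<and> f t0 - f u \<le> 2 * D * (t0 - u)"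
      using u f'(2) by simp
  qed
qed

lemma f_le: "s \<le> t \<Longrightarrow> t \<le> 0 \<Longrightarrow> f s \<le> f t"
  using f_mono by (auto simp: mono_on_def)

text \<open>Just to the left of \<open>t0\<close> the density is strictly smaller and still
  non-negative. Positivity is what makes lines of slope near \<open>f t0\<close> fall below 0 on the
  far left.\<close>

lemma density_pos:
  assumes f': "DERIV f t0 :> D" "D > 0" and t0: "t0 < 0"
  shows "f t0 > 0"
proof -
  obtain r where r: "r > 0"
    "\<And>u. t0 \<le> u \<Longrightarrow> u < t0 + r \<Longrightarrow> D / 2 * (u - t0) \<le> f u - f t0 \<and> f u - f t0 \<le> 2 * D * (u - t0)"
    "\<And>u. t0 - r < u \<Longrightarrow> u \<le> t0 \<Longrightarrow> D / 2 * (t0 - u) \<le> f t0 - f u \<and> f t0 - f u \<le> 2 * D * (t0 - u)"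
    using density_slope[OF f'] by blast
  have "0 < D / 2 * (r / 2)" using r(1) f'(2) by simp
  also have "\<dots> \<le> f t0 - f (t0 - r / 2)" using r(3)[of "t0 - r / 2"] r(1) by simp
  also have "\<dots> \<le> f t0" using f_nonneg[of "t0 - r / 2"] by simp
  finally show ?thesis .
qed

text \<open>Near \<open>t0\<close> the density moves at least linearly, and by monotonicity it never
  moves back, so a smaller slope \<open>k\<close> works on all of \<open>{T..0}\<close>. To pass to
  \<open>F\<close> it is enough to bound \<open>f\<close> by a constant on each half of the interval
  between \<open>t0\<close> and \<open>t\<close>.\<close>

lemma F_above_tangent:
  assumes f': "DERIV f t0 :> D" "D > 0" and t0: "T < t0" "t0 < 0"
  obtains c where "c > 0" "\<And>t. T \<le> t \<Longrightarrow> t \<le> 0 \<Longrightarrow> f t0 * (t - t0) + c * (t - t0)\<^sup>2 \<le> F t - F t0"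
proof -
  obtain r where r: "r > 0" "\<And>u. t0 \<le> u \<Longrightarrow> u < t0 + r \<Longrightarrow> D / 2 * (u - t0) \<le> f u - f t0 \<and> f u - f t0 \<le> 2 * D * (u - t0)"
    "\<And>u. t0 - r < u \<Longrightarrow> u \<le> t0 \<Longrightarrow> D / 2 * (t0 - u) \<le> f t0 - f u \<and> f t0 - f u \<le> 2 * D * (t0 - u)"
    using density_slope[OF f'] by blast
  \<comment> \<open>At distance \<open>r / 2\<close> the density has moved by at least
    \<open>D / 2 * (r / 2)\<close>; the second entry spreads this gain over the largest distance
    that occurs, which is at most \<open>- T\<close>.\<close>
  define k where "k = min (D / 2) (D / 4 * r / (- T))"
  have k: "k > 0" "k \<le> D / 2" "k * (- T) \<le> D / 4 * r"
  proof -
    have "D / 4 * r / (- T) > 0" using f'(2) r(1) t0 by (intro divide_pos_pos) auto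
    then show "k > 0" using f'(2) by (simp add: k_def)
    show "k \<le> D / 2" by (simp add: k_def)
    have "k * (- T) \<le> (D / 4 * r / (- T)) * (- T)" using t0 by (intro mult_right_mono) (auto simp: k_def)
    then show "k * (- T) \<le> D / 4 * r" using t0 by simp
  qed
  have up: "k * (u - t0) \<le> f u - f t0" if u: "t0 \<le> u" "u \<le> 0" for u
  proof (cases "u < t0 + r")
    case True
    have "k * (u - t0) \<le> D / 2 * (u - t0)" using k u by (intro mult_right_mono) auto
    with r(2)[of u] u True show ?thesis by linarith
  next
    case False
    have "k * (u - t0) \<le> k * (- T)" using k u t0 by (intro mult_left_mono) auto
    also have "\<dots> \<le> D / 4 * r" by (rule k)
    also have "\<dots> \<le> f (t0 + r / 2) - f t0" using r(2)[of "t0 + r / 2"] r(1) by simp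
    also have "\<dots> \<le> f u - f t0" using False u r(1) f_le[of "t0 + r / 2" u] by simp
    finally show ?thesis .
  qed
  have down: "k * (t0 - u) \<le> f t0 - f u" if u: "T \<le> u" "u \<le> t0" for u
  proof (cases "t0 - r < u")
    case True
    have "k * (t0 - u) \<le> D / 2 * (t0 - u)" using k u by (intro mult_right_mono) auto
    with r(3)[of u] u True show ?thesis by linarith
  next
    case False
    have "k * (t0 - u) \<le> k * (- T)" using k u t0 by (intro mult_left_mono) auto
    also have "\<dots> \<le> D / 4 * r" by (rule k)
    also have "\<dots> \<le> f t0 - f (t0 - r / 2)" using r(3)[of "t0 - r / 2"] r(1) by simp
    also have "\<dots> \<le> f t0 - f u" using False u r(1) t0 f_le[of u "t0 - r / 2"] by simp
    finally show ?thesis .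
  qed
  show ?thesis
  proof (rule that[of "k / 4"])
    show "k / 4 > 0" using k by simp
    fix t assume t: "T \<le> t" "t \<le> 0"
    \<comment> \<open>On the half beyond the midpoint the density differs from \<open>f t0\<close>
      by at least \<open>k * \<bar>m - t0\<bar>\<close>; the two halvings produce the constant
      \<open>k / 4\<close>.\<close>
    define m where "m = (t + t0) / 2"
    show "f t0 * (t - t0) + k / 4 * (t - t0)\<^sup>2 \<le> F t - F t0"
    proof (cases "t0 \<le> t")
      case True
      have m: "t0 \<le> m" "m \<le> t" "m \<le> 0" using True t by (auto simp: m_def)
      have "f m * (t - m) \<le> F t - F m" "f t0 * (m - t0) \<le> F m - F t0"
        using m t by (auto intro!: F_increment_bounds(1))
      moreover have "(f t0 + k * (m - t0)) * (t - m) \<le> f m * (t - m)"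
        using up[OF m(1,3)] m by (intro mult_right_mono) auto
      moreover have "(f t0 + k * (m - t0)) * (t - m) + f t0 * (m - t0) = f t0 * (t - t0) + k / 4 * (t - t0)\<^sup>2"
        by (simp add: m_def power2_eq_square field_simps)
      ultimately show ?thesis by linarith
    next
      case False
      have m: "t \<le> m" "m \<le> t0" "T \<le> m" using False t t0 by (auto simp: m_def)
      have "F t0 - F m \<le> f t0 * (t0 - m)" "F m - F t \<le> f m * (m - t)"
        using m t t0 by (auto intro!: F_increment_bounds(2))
      moreover have "f m * (m - t) \<le> (f t0 - k * (t0 - m)) * (m - t)"
        using down[OF m(3,2)] m by (intro mult_right_mono) auto
      moreover have "(f t0 - k * (t0 - m)) * (m - t) + f t0 * (t0 - m) = - (f t0 * (t - t0) + k / 4 * (t - t0)\<^sup>2)"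
        by (simp add: m_def power2_eq_square field_simps)
      ultimately show ?thesis by linarith
    qed
  qed
qed

text \<open>If the empirical distribution function stays within \<open>c (t - t\<^sub>0)\<^sup>2 + \<epsilon>\<close> of a randomly tilted
  copy of \<open>F\<close>, then the tangent at \<open>t\<^sub>0\<close> of slope \<open>f t\<^sub>0 + a\<close>, lowered by \<open>\<epsilon>\<close>, is a minorant.\<close>

lemma density_estimator_bounds:
  assumes t0: "T < t0" "t0 < 0" and T: "T \<le> t0 - 2 / f t0" and ft0: "f t0 > 0"
    and tangent: "\<And>t. T \<le> t \<Longrightarrow> t \<le> 0 \<Longrightarrow> f t0 * (t - t0) + c * (t - t0)\<^sup>2 \<le> F t - F t0"
    and a: "\<bar>a\<bar> \<le> f t0 / 2" and \<epsilon>: "0 \<le> \<epsilon>"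
    and E: "\<And>t. T \<le> t \<Longrightarrow> t \<le> 0 \<Longrightarrow>
      \<bar>empirical_cdf X n \<omega> t - empirical_cdf X n \<omega> t0 - (F t - F t0) - a * (t - t0)\<bar> \<le> c * (t - t0)\<^sup>2 + \<epsilon>"
    and \<delta>: "0 < \<delta>" "t0 + \<delta> \<le> 0" "T \<le> t0 - \<delta>"
    and slope: "f (t0 + \<delta>) - f t0 \<le> C * \<delta>" "f t0 - f (t0 - \<delta>) \<le> C * \<delta>"
  shows "\<bar>density_estimator X n t0 \<omega> - f t0 - a\<bar> \<le> (C + c) * \<delta> + 2 * \<epsilon> / \<delta>"
proof -
  let ?Fn = "empirical_cdf X n \<omega>"
  have line: "(?Fn t0 - \<epsilon>) + (f t0 + a) * (u - t0) \<le> ?Fn u" if u: "u \<le> 0" for u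
  proof (cases "T \<le> u")
    case True
    have "(f t0 + a) * (u - t0) = f t0 * (u - t0) + a * (u - t0)" by (rule distrib_right)
    then show ?thesis using tangent[OF True u] E[OF True u] unfolding abs_le_iff by linarith
  next
    case False
    have "(f t0 + a) * (u - t0) \<le> f t0 / 2 * (u - t0)"
      using a False t0 by (intro mult_right_mono_neg) (auto simp: abs_le_iff)
    also have "\<dots> \<le> f t0 / 2 * (- 2 / f t0)"
      using False T ft0 by (intro mult_left_mono) auto
    also have "\<dots> = - 1" using ft0 by simp
    finally show ?thesis using empirical_cdf_le_1[of X n \<omega> t0] empirical_cdf_nonneg[of X n \<omega> u] \<epsilon> by linarith
  qed
  have up: "density_estimator X n t0 \<omega> \<le> (?Fn (t0 + \<delta>) - (?Fn t0 - \<epsilon>)) / \<delta>"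
    unfolding density_estimator_def by (rule right_deriv_gcm_bounds(1)[OF line t0(2) \<delta>(1,2)])
  have lo: "((?Fn t0 - \<epsilon>) - ?Fn (t0 - \<delta>)) / \<delta> \<le> density_estimator X n t0 \<omega>"
    unfolding density_estimator_def by (rule right_deriv_gcm_bounds(2)[OF line t0(2) \<delta>(1,2)])
  \<comment> \<open>Of the two terms \<epsilon>, one is the error \<open>E\<close> at
    \<open>t0 + \<delta>\<close> and one the lowering of the line; the terms in
    \<open>\<delta>\<^sup>2\<close> are the variation of \<open>f\<close> over the step and the
    quadratic part of \<open>E\<close>.\<close>
  have "?Fn (t0 + \<delta>) - (?Fn t0 - \<epsilon>) \<le> (f t0 + a + (C + c) * \<delta> + 2 * \<epsilon> / \<delta>) * \<delta>"
  proof -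
    have "F (t0 + \<delta>) - F t0 \<le> f (t0 + \<delta>) * \<delta>" using F_increment_bounds(2)[of t0 "t0 + \<delta>"] \<delta> by simp
    also have "\<dots> \<le> (f t0 + C * \<delta>) * \<delta>" using slope(1) \<delta> by (intro mult_right_mono) auto
    finally have 1: "F (t0 + \<delta>) - F t0 \<le> f t0 * \<delta> + C * \<delta> * \<delta>" by (simp add: distrib_right)
    have 2: "?Fn (t0 + \<delta>) - ?Fn t0 - (F (t0 + \<delta>) - F t0) - a * \<delta> \<le> c * \<delta> * \<delta> + \<epsilon>"
      using E[of "t0 + \<delta>"] \<delta> t0 by (simp add: abs_le_iff power2_eq_square mult.assoc)
    have 3: "(f t0 + a + (C + c) * \<delta> + 2 * \<epsilon> / \<delta>) * \<delta> = f t0 * \<delta> + a * \<delta> + C * \<delta> * \<delta> + c * \<delta> * \<delta> + 2 * \<epsilon>"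
      using \<delta>(1) by (simp add: distrib_right)
    show ?thesis using 1 2 unfolding 3 by linarith
  qed
  with up have up': "density_estimator X n t0 \<omega> \<le> f t0 + a + (C + c) * \<delta> + 2 * \<epsilon> / \<delta>"
    using \<delta>(1) by (meson order_trans pos_divide_le_eq)
  have "(f t0 + a - (C + c) * \<delta> - 2 * \<epsilon> / \<delta>) * \<delta> \<le> (?Fn t0 - \<epsilon>) - ?Fn (t0 - \<delta>)"
  proof -
    have "(f t0 - C * \<delta>) * \<delta> \<le> f (t0 - \<delta>) * \<delta>" using slope(2) \<delta> by (intro mult_right_mono) auto
    also have "\<dots> \<le> F t0 - F (t0 - \<delta>)" using F_increment_bounds(1)[of "t0 - \<delta>" t0] \<delta> t0 by simp
    finally have 1: "f t0 * \<delta> - C * \<delta> * \<delta> \<le> F t0 - F (t0 - \<delta>)" by (simp add: left_diff_distrib)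
    have 2: "?Fn (t0 - \<delta>) - ?Fn t0 - (F (t0 - \<delta>) - F t0) + a * \<delta> \<le> c * \<delta> * \<delta> + \<epsilon>"
      using E[of "t0 - \<delta>"] \<delta> t0 by (simp add: abs_le_iff power2_eq_square mult.assoc)
    have 3: "(f t0 + a - (C + c) * \<delta> - 2 * \<epsilon> / \<delta>) * \<delta> = f t0 * \<delta> + a * \<delta> - C * \<delta> * \<delta> - c * \<delta> * \<delta> - 2 * \<epsilon>"
      using \<delta>(1) by (simp add: distrib_right left_diff_distrib)
    show ?thesis using 1 2 unfolding 3 by linarith
  qed
  with lo have lo': "f t0 + a - (C + c) * \<delta> - 2 * \<epsilon> / \<delta> \<le> density_estimator X n t0 \<omega>"
    using \<delta>(1) by (meson order_trans pos_le_divide_eq)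
  from up' lo' show ?thesis by (auto simp: abs_le_iff)
qed

end

section \<open>Passage to the limit law\<close>

text \<open>Slutsky's argument on distribution functions: an event for \<open>Y\<close> is trapped
  between events for \<open>Z\<close> at levels shifted by \<delta>. Continuity of the limit makes a
  small shift harmless at every \<open>x\<close>.\<close>

lemma (in prob_space) weak_conv_m_close:
  assumes Y: "\<And>n. Y n \<in> borel_measurable M" and Z: "\<And>n. Z n \<in> borel_measurable M"
    and close: "\<And>\<epsilon>. \<epsilon> > 0 \<Longrightarrow> (\<lambda>n. prob {\<omega> \<in> space M. \<bar>Y n \<omega> - Z n \<omega>\<bar> > \<epsilon>}) \<longlonglongrightarrow> 0"
    and conv: "weak_conv_m (\<lambda>n. distr M borel (Z n)) \<mu>"
    and cont: "\<And>x. isCont (cdf \<mu>) x"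
  shows "weak_conv_m (\<lambda>n. distr M borel (Y n)) \<mu>"
  unfolding weak_conv_m_def weak_conv_def
proof (intro allI impI)
  note Y[measurable] Z[measurable]
  have cdfY: "cdf (distr M borel (Y n)) x = prob {\<omega> \<in> space M. Y n \<omega> \<le> x}" for n x
    unfolding cdf_def by (subst measure_distr) (auto intro!: arg_cong[where f=prob])
  have cdfZ: "cdf (distr M borel (Z n)) x = prob {\<omega> \<in> space M. Z n \<omega> \<le> x}" for n x
    unfolding cdf_def by (subst measure_distr) (auto intro!: arg_cong[where f=prob])
  have lim: "(\<lambda>n. prob {\<omega> \<in> space M. Z n \<omega> \<le> x}) \<longlonglongrightarrow> cdf \<mu> x" for x
    using conv cont unfolding weak_conv_m_def weak_conv_def cdfZ by blast
  fix x
  show "(\<lambda>n. cdf (distr M borel (Y n)) x) \<longlonglongrightarrow> cdf \<mu> x"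
    unfolding cdfY
  proof (rule LIMSEQ_I)
    fix r :: real assume r: "r > 0"
    obtain s where s: "s > 0" "\<And>y. \<bar>y - x\<bar> < s \<Longrightarrow> \<bar>cdf \<mu> y - cdf \<mu> x\<bar> < r / 3"
      using cont[of x, unfolded continuous_at_eps_delta, rule_format, of "r / 3"] r by (auto simp: dist_real_def)
    define \<delta> where "\<delta> = s / 2"
    have \<delta>: "\<delta> > 0" "\<bar>cdf \<mu> (x + \<delta>) - cdf \<mu> x\<bar> < r / 3" "\<bar>cdf \<mu> (x - \<delta>) - cdf \<mu> x\<bar> < r / 3"
      using s(1) s(2)[of "x + \<delta>"] s(2)[of "x - \<delta>"] by (auto simp: \<delta>_def)
    let ?P = "\<lambda>n. prob {\<omega> \<in> space M. \<bar>Y n \<omega> - Z n \<omega>\<bar> > \<delta>}"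
    have up: "prob {\<omega> \<in> space M. Y n \<omega> \<le> x} \<le> prob {\<omega> \<in> space M. Z n \<omega> \<le> x + \<delta>} + ?P n" for n
    proof -
      have "prob {\<omega> \<in> space M. Y n \<omega> \<le> x} \<le> prob ({\<omega> \<in> space M. Z n \<omega> \<le> x + \<delta>} \<union> {\<omega> \<in> space M. \<bar>Y n \<omega> - Z n \<omega>\<bar> > \<delta>})"
        by (intro finite_measure_mono) (auto simp: abs_if split: if_splits)
      also have "\<dots> \<le> prob {\<omega> \<in> space M. Z n \<omega> \<le> x + \<delta>} + ?P n"
        by (intro measure_Un_le) auto
      finally show ?thesis .
    qed
    have lo: "prob {\<omega> \<in> space M. Z n \<omega> \<le> x - \<delta>} \<le> prob {\<omega> \<in> space M. Y n \<omega> \<le> x} + ?P n" for n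
    proof -
      have "prob {\<omega> \<in> space M. Z n \<omega> \<le> x - \<delta>} \<le> prob ({\<omega> \<in> space M. Y n \<omega> \<le> x} \<union> {\<omega> \<in> space M. \<bar>Y n \<omega> - Z n \<omega>\<bar> > \<delta>})"
        by (intro finite_measure_mono) (auto simp: abs_if split: if_splits)
      also have "\<dots> \<le> prob {\<omega> \<in> space M. Y n \<omega> \<le> x} + ?P n"
        by (intro measure_Un_le) auto
      finally show ?thesis .
    qed
    have "\<forall>\<^sub>F n in sequentially. ?P n < r / 3" using r by (intro order_tendstoD(2)[OF close[OF \<delta>(1)]]) auto
    moreover have "\<forall>\<^sub>F n in sequentially. prob {\<omega> \<in> space M. Z n \<omega> \<le> x + \<delta>} < cdf \<mu> (x + \<delta>) + r / 3"
      using r by (intro order_tendstoD(2)[OF lim]) auto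
    moreover have "\<forall>\<^sub>F n in sequentially. cdf \<mu> (x - \<delta>) - r / 3 < prob {\<omega> \<in> space M. Z n \<omega> \<le> x - \<delta>}"
      using r by (intro order_tendstoD(1)[OF lim]) auto
    ultimately have "\<forall>\<^sub>F n in sequentially. norm (prob {\<omega> \<in> space M. Y n \<omega> \<le> x} - cdf \<mu> x) < r"
    proof eventually_elim
      case (elim n)
      with up[of n] lo[of n] \<delta>(2,3) show ?case unfolding real_norm_def abs_less_iff by linarith
    qed
    then show "\<exists>no. \<forall>n\<ge>no. norm (prob {\<omega> \<in> space M. Y n \<omega> \<le> x} - cdf \<mu> x) < r"
      by (simp add: eventually_sequentially)
  qed
qed

lemma isCont_cdf_std_normal: "isCont (cdf std_normal_distribution) x"
proof -
  interpret real_distribution std_normal_distribution by (rule real_dist_normal_dist)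
  have "{x} \<in> null_sets std_normal_distribution"
    by (intro absolutely_continuousI_density[unfolded absolutely_continuous_def, THEN subsetD]) auto
  then have "measure std_normal_distribution {x} = 0" by (simp add: null_sets_def measure_def)
  then show ?thesis by (simp add: isCont_cdf)
qed

context lrd_gaussian begin

text \<open>For each precision the comparison step is \<open>sqrt e * sqrt (B n)\<close> with
  \<open>e\<close> small but fixed. The bias is proportional to this step, and so is the stochastic
  error \<open>e * B n\<close> divided by it. The exceptional events are the complement of
  \<open>G n\<close> and large values of the mean.\<close>

lemma density_estimator_linearization:
  assumes t0: "t0 < 0" and f': "DERIV f t0 :> D" "D > 0" and \<eta>': "DERIV \<eta> t0 :> b" and \<epsilon>: "\<epsilon> > 0"
  shows "(\<lambda>n. prob {\<omega> \<in> space M. \<bar>density_estimator X n t0 \<omega> - f t0 - b * avg n \<omega>\<bar> > \<epsilon> * sqrt (B n)}) \<longlonglongrightarrow> 0"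
proof (rule tendstoI)
  fix \<gamma> :: real assume \<gamma>: "\<gamma> > 0"
  note [measurable] = borel_measurable_density_estimator[OF X_measurable t0]
  have ft0: "f t0 > 0" by (rule density_pos[OF f' t0])
  \<comment> \<open>\<open>2 / f t0\<close> is what the far-left part of
    \<open>density_estimator_bounds\<close> asks for; the extra 1 makes room for
    \<open>t0 - \<delta>\<close>.\<close>
  define T where "T = t0 - 2 / f t0 - 1"
  have "2 / f t0 > 0" using ft0 by simp
  then have T: "T < t0" "T \<le> t0 - 2 / f t0" "T \<le> t0 - 1" unfolding T_def by linarith+
  obtain c where c: "c > 0" "\<And>t. T \<le> t \<Longrightarrow> t \<le> 0 \<Longrightarrow> f t0 * (t - t0) + c * (t - t0)\<^sup>2 \<le> F t - F t0"
    using F_above_tangent[OF f' T(1) t0] by blast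
  obtain r where r: "r > 0" "\<And>u. t0 \<le> u \<Longrightarrow> u < t0 + r \<Longrightarrow> D / 2 * (u - t0) \<le> f u - f t0 \<and> f u - f t0 \<le> 2 * D * (u - t0)"
    "\<And>u. t0 - r < u \<Longrightarrow> u \<le> t0 \<Longrightarrow> D / 2 * (t0 - u) \<le> f t0 - f u \<and> f t0 - f u \<le> 2 * D * (t0 - u)"
    using density_slope[OF f'] by blast
  \<comment> \<open>Collects the final error \<open>(2 * D + c) * \<delta> + 2 * \<delta>\<close>;
    with \<open>sqrt e = \<epsilon> / L\<close> it becomes exactly
    \<open>\<epsilon> * sqrt (B n)\<close>.\<close>
  define L where "L = 2 * D + c + 2"
  have L: "L > 0" using f'(2) c(1) by (simp add: L_def)
  define e where "e = (\<epsilon> / L)\<^sup>2"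
  have e: "e > 0" "sqrt e = \<epsilon> / L" using \<epsilon> L by (auto simp: e_def)
  \<comment> \<open>Chebyshev's inequality with \<open>V n < 2 * B n\<close> bounds the probability
    of a mean beyond \<open>A * sqrt (B n)\<close> by
    \<open>2 / A\<^sup>2 = \<gamma> / 4\<close>.\<close>
  define A where "A = sqrt (8 / \<gamma>)"
  have A: "A > 0" "A\<^sup>2 = 8 / \<gamma>" using \<gamma> by (auto simp: A_def)
  \<comment> \<open>One half of the budget \<open>c * (t - t0)\<^sup>2 + e * B n\<close> is for the
    remainder, the other for the deviation of \<eta> from its tangent.\<close>
  have c2: "c / 2 > 0" and e2: "e / 2 > 0" using c(1) e(1) by auto
  obtain G where G: "\<forall>n. G n \<in> events" "(\<lambda>n. prob (G n)) \<longlonglongrightarrow> 1"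
    "\<forall>\<^sub>F n in sequentially. \<forall>\<omega>\<in>G n. \<bar>avg n \<omega>\<bar> \<le> A * sqrt (B n) \<longrightarrow>
       (\<forall>t\<in>{T..0}. \<bar>R n \<omega> t - R n \<omega> t0\<bar> \<le> c / 2 * (t - t0)\<^sup>2 + e / 2 * B n)"
    using R_uniform[OF T(1) t0 c2 e2 A(1)] by (elim exE conjE) (rule that)
  \<comment> \<open>Chosen so that \<open>\<kappa> * \<bar>t - t0\<bar> * (A * s n)\<close> is the
    product of \<open>sqrt c * \<bar>t - t0\<bar>\<close> and \<open>sqrt e * s n\<close>, to which
    the inequality of means applies.\<close>
  define \<kappa> where "\<kappa> = sqrt (c * e) / A"
  have \<kappa>: "\<kappa> > 0" using A(1) c(1) e(1) by (simp add: \<kappa>_def)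
  have "(\<eta> has_derivative (*) b) (at t0)" using \<eta>' by (simp add: has_field_derivative_def)
  from this[unfolded has_derivative_at_alt, THEN conjunct2, rule_format, OF \<kappa>]
  obtain r2 where r2: "r2 > 0" "\<And>y. norm (y - t0) < r2 \<Longrightarrow> norm (\<eta> y - \<eta> t0 - b * (y - t0)) \<le> \<kappa> * norm (y - t0)"
    by blast
  \<comment> \<open>Beyond distance \<open>r2\<close> differentiability is silent. Increments of
    \<eta> are at most 1 and the tangent grows linearly, so both are dominated by the squared
    distance; multiplication by the mean, of order \<open>sqrt (B n)\<close>, then makes the factor
    smaller than \<open>c / 2\<close>.\<close>
  define H where "H = 1 / r2\<^sup>2 + \<bar>b\<bar> / r2"
  have H: "H \<ge> 0" using r2(1) by (simp add: H_def)
  have far: "\<bar>\<eta> t - \<eta> t0 - b * (t - t0)\<bar> \<le> H * (t - t0)\<^sup>2" if t: "r2 \<le> \<bar>t - t0\<bar>" for t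
  proof -
    define x where "x = \<bar>t - t0\<bar>"
    have x: "r2 \<le> x" "0 \<le> x" "x\<^sup>2 = (t - t0)\<^sup>2" using t by (auto simp: x_def)
    have "\<bar>\<eta> t - \<eta> t0 - b * (t - t0)\<bar> \<le> 1 + \<bar>b\<bar> * x"
      unfolding x_def abs_mult[symmetric] using \<eta>_increment_le_1[of t t0] by linarith
    also have "1 \<le> 1 / r2\<^sup>2 * x\<^sup>2"
      using x r2(1) power_mono[of r2 x 2] by simp
    also have "\<bar>b\<bar> * x \<le> \<bar>b\<bar> / r2 * x\<^sup>2"
    proof -
      have "x * r2 \<le> x * x" using x by (intro mult_left_mono)
      then have "x \<le> x\<^sup>2 / r2" using r2(1) by (simp add: pos_le_divide_eq power2_eq_square)
      then have "\<bar>b\<bar> * x \<le> \<bar>b\<bar> * (x\<^sup>2 / r2)" by (intro mult_left_mono) auto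
      then show ?thesis by simp
    qed
    finally show ?thesis by (simp add: H_def x(3)[symmetric] distrib_right)
  qed
  define s where "s n = sqrt (B n)" for n
  have s0: "s \<longlonglongrightarrow> 0" unfolding s_def[abs_def] using tendsto_real_sqrt[OF B_tendsto_0] by simp
  have small: "\<forall>\<^sub>F n in sequentially. k * s n < x" if "x > 0" for k x :: real
  proof -
    have "(\<lambda>n. k * s n) \<longlonglongrightarrow> k * 0" by (intro tendsto_intros s0)
    then show ?thesis using that by (intro order_tendstoD) auto
  qed
  have pos: "c / 2 > 0" "f t0 / 2 > 0" "min (min r 1) (- t0) > 0" using c(1) ft0 r(1) t0 by auto
  have "\<forall>\<^sub>F n in sequentially. space M - G n \<in> events \<and>
     {\<omega> \<in> space M. \<bar>density_estimator X n t0 \<omega> - f t0 - b * avg n \<omega>\<bar> > \<epsilon> * sqrt (B n)} \<subseteq>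
     (space M - G n) \<union> {\<omega> \<in> space M. A * s n \<le> \<bar>avg n \<omega>\<bar>}"
    using B_pos G(3) small[OF pos(1), of "H * A"] small[OF pos(2), of "\<bar>b\<bar> * A"] small[OF pos(3), of "sqrt e"]
  proof eventually_elim
    case (elim n)
    have sn: "s n > 0" "(s n)\<^sup>2 = B n" using elim(1) by (auto simp: s_def)
    define \<delta> where "\<delta> = sqrt e * s n"
    have \<delta>: "\<delta> > 0" "\<delta> < r" "\<delta> < 1" "\<delta> < - t0" using elim(5) sn e(1) by (auto simp: \<delta>_def)
    have "\<bar>density_estimator X n t0 \<omega> - f t0 - b * avg n \<omega>\<bar> \<le> \<epsilon> * sqrt (B n)"
      if \<omega>: "\<omega> \<in> G n" and avg: "\<bar>avg n \<omega>\<bar> \<le> A * s n" for \<omega>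
    proof -
      define m where "m = avg n \<omega>"
      have m: "\<bar>m\<bar> \<le> A * s n" using avg by (simp add: m_def)
      have Rb: "\<bar>R n \<omega> t - R n \<omega> t0\<bar> \<le> c / 2 * (t - t0)\<^sup>2 + e / 2 * B n" if "T \<le> t" "t \<le> 0" for t
        using elim(2) \<omega> avg that by (auto simp: s_def)
      have lin: "\<bar>(\<eta> t - \<eta> t0 - b * (t - t0)) * m\<bar> \<le> c / 2 * (t - t0)\<^sup>2 + e / 2 * B n" for t
      proof (cases "\<bar>t - t0\<bar> < r2")
        case True
        have "\<bar>(\<eta> t - \<eta> t0 - b * (t - t0)) * m\<bar> \<le> (\<kappa> * \<bar>t - t0\<bar>) * (A * s n)"
          unfolding abs_mult using r2(2)[of t] True m \<kappa> by (intro mult_mono) auto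
        also have "\<dots> = (sqrt c * \<bar>t - t0\<bar>) * (sqrt e * s n)"
          using A(1) by (simp add: \<kappa>_def real_sqrt_mult)
        also have "\<dots> \<le> ((sqrt c * \<bar>t - t0\<bar>)\<^sup>2 + (sqrt e * s n)\<^sup>2) / 2"
          using sum_squares_bound[of "sqrt c * \<bar>t - t0\<bar>" "sqrt e * s n"] by (simp add: mult.assoc)
        also have "(sqrt c * \<bar>t - t0\<bar>)\<^sup>2 = c * (t - t0)\<^sup>2" using c(1) by (simp add: power_mult_distrib)
        also have "(sqrt e * s n)\<^sup>2 = e * B n" using e(1) sn by (simp only: power_mult_distrib) simp
        finally show ?thesis by simp
      next
        case False
        have "\<bar>(\<eta> t - \<eta> t0 - b * (t - t0)) * m\<bar> \<le> (H * (t - t0)\<^sup>2) * (A * s n)"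
          unfolding abs_mult using far[of t] False m H by (intro mult_mono) auto
        also have "\<dots> = (H * A * s n) * (t - t0)\<^sup>2" by (simp only: mult_ac)
        also have "\<dots> \<le> c / 2 * (t - t0)\<^sup>2" using elim(3) by (intro mult_right_mono) auto
        also have "\<dots> \<le> c / 2 * (t - t0)\<^sup>2 + e / 2 * B n" using elim(1) e(1) by simp
        finally show ?thesis .
      qed
      have "\<bar>density_estimator X n t0 \<omega> - f t0 - b * m\<bar> \<le> (2 * D + c) * \<delta> + 2 * (e * B n) / \<delta>"
      proof (rule density_estimator_bounds[OF T(1) t0 T(2) ft0 c(2)])
        show "\<bar>b * m\<bar> \<le> f t0 / 2"
        proof -
          have "\<bar>b * m\<bar> \<le> \<bar>b\<bar> * (A * s n)" unfolding abs_mult using m by (intro mult_left_mono) auto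
          then show ?thesis using elim(4) by (simp add: mult.assoc)
        qed
        show "0 \<le> e * B n" using e(1) elim(1) by simp
        show "\<bar>empirical_cdf X n \<omega> t - empirical_cdf X n \<omega> t0 - (F t - F t0) - b * m * (t - t0)\<bar>
            \<le> c * (t - t0)\<^sup>2 + e * B n" if t: "T \<le> t" "t \<le> 0" for t
        proof -
          have "empirical_cdf X n \<omega> t - empirical_cdf X n \<omega> t0 - (F t - F t0) - b * m * (t - t0) =
            (\<eta> t - \<eta> t0 - b * (t - t0)) * m + (R n \<omega> t - R n \<omega> t0)"
            by (simp add: R_def m_def algebra_simps)
          then show ?thesis using lin[of t] Rb[OF t] by linarith
        qed
        show "f (t0 + \<delta>) - f t0 \<le> 2 * D * \<delta>" using r(2)[of "t0 + \<delta>"] \<delta> by simp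
        show "f t0 - f (t0 - \<delta>) \<le> 2 * D * \<delta>" using r(3)[of "t0 - \<delta>"] \<delta> by simp
        show "0 < \<delta>" "t0 + \<delta> \<le> 0" "T \<le> t0 - \<delta>" using \<delta> T by auto
      qed
      also have "2 * (e * B n) / \<delta> = 2 * \<delta>"
      proof -
        have "\<delta> * \<delta> = (sqrt e * sqrt e) * (s n)\<^sup>2" by (simp only: \<delta>_def power2_eq_square mult_ac)
        then have "e * B n = \<delta> * \<delta>" using e(1) unfolding sn(2) by simp
        then show ?thesis using \<delta>(1) by simp
      qed
      also have "(2 * D + c) * \<delta> + 2 * \<delta> = L * \<delta>" by (simp add: L_def algebra_simps)
      also have "L * \<delta> = \<epsilon> * sqrt (B n)" using L by (simp add: \<delta>_def e(2) s_def)
      finally show ?thesis by (simp add: m_def)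
    qed
    then have "\<omega> \<notin> G n \<or> A * s n \<le> \<bar>avg n \<omega>\<bar>"
      if "\<epsilon> * sqrt (B n) < \<bar>density_estimator X n t0 \<omega> - f t0 - b * avg n \<omega>\<bar>" for \<omega>
      using that by (metis linorder_not_le order_less_imp_le)
    moreover have "space M - G n \<in> events" using G(1) by blast
    ultimately show ?case by blast
  qed
  moreover have "\<forall>\<^sub>F n in sequentially. 1 - \<gamma> / 4 < prob (G n)"
    using \<gamma> by (intro order_tendstoD(1)[OF G(2)]) auto
  moreover have "\<forall>\<^sub>F n in sequentially. V n / B n < 2"
    by (intro order_tendstoD(2)[OF V_div_B]) auto
  ultimately show "\<forall>\<^sub>F n in sequentially.
      dist (prob {\<omega> \<in> space M. \<bar>density_estimator X n t0 \<omega> - f t0 - b * avg n \<omega>\<bar> > \<epsilon> * sqrt (B n)}) 0 < \<gamma>"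
    using B_pos
  proof eventually_elim
    case (elim n)
    have sn: "s n > 0" "(s n)\<^sup>2 = B n" using elim(4) by (auto simp: s_def)
    have As: "A * s n > 0" using A sn by simp
    have "prob {\<omega> \<in> space M. A * s n \<le> \<bar>avg n \<omega>\<bar>} \<le> expectation (\<lambda>\<omega>. (avg n \<omega>)\<^sup>2) / (A * s n)\<^sup>2"
      by (rule second_moment_method[OF avg_measurable expectation_avg_square(1) As])
    also have "\<dots> = V n / B n / A\<^sup>2" by (simp add: expectation_avg_square power_mult_distrib sn)
    also have "\<dots> \<le> 2 / A\<^sup>2" using elim(3) by (intro divide_right_mono) auto
    also have "\<dots> = \<gamma> / 4" using \<gamma> by (simp add: A)
    finally have P1: "prob {\<omega> \<in> space M. A * s n \<le> \<bar>avg n \<omega>\<bar>} \<le> \<gamma> / 4" .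
    have "prob {\<omega> \<in> space M. \<bar>density_estimator X n t0 \<omega> - f t0 - b * avg n \<omega>\<bar> > \<epsilon> * sqrt (B n)} \<le>
      prob ((space M - G n) \<union> {\<omega> \<in> space M. A * s n \<le> \<bar>avg n \<omega>\<bar>})"
      using elim(1) by (intro finite_measure_mono sets.Un) auto
    also have "\<dots> \<le> prob (space M - G n) + prob {\<omega> \<in> space M. A * s n \<le> \<bar>avg n \<omega>\<bar>}"
      using elim(1) by (intro measure_Un_le) auto
    also have "\<dots> < \<gamma>" using P1 elim(2) prob_compl[OF G(1)[rule_format, of n]] \<gamma> by linarith
    finally show ?case by simp
  qed
qed

text \<open>By the linearisation the normalised error is close in probability to
  \<open>sgn b / sqrt (B n) * avg n\<close>. This is exactly Gaussian with variance
  \<open>V n / B n\<close> for large \<open>n\<close>, so its characteristic function is explicit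
  and Levy's continuity theorem applies; the sign is squared away.\<close>

lemma density_estimator_weak_conv:
  assumes t0: "t0 < 0" and f': "DERIV f t0 :> D" "D > 0" and \<eta>': "DERIV \<eta> t0 :> b" "b \<noteq> 0"
  shows "weak_conv_m
     (\<lambda>n. distr M borel (\<lambda>\<omega>. inverse \<bar>b\<bar> * l1 (real n) powr (- 1 / 2) * real n powr (d / 2)
         * (density_estimator X n t0 \<omega> - f t0)))
     std_normal_distribution"
proof (rule weak_conv_m_close[where Z="\<lambda>n \<omega>. sgn b / sqrt (B n) * avg n \<omega>"])
  note [measurable] = borel_measurable_density_estimator[OF X_measurable t0]
  let ?Y = "\<lambda>n \<omega>. inverse \<bar>b\<bar> * l1 (real n) powr (- 1 / 2) * real n powr (d / 2) * (density_estimator X n t0 \<omega> - f t0)"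
  let ?Z = "\<lambda>n \<omega>. sgn b / sqrt (B n) * avg n \<omega>"
  show "?Y n \<in> borel_measurable M" for n
    by (intro borel_measurable_times borel_measurable_diff borel_measurable_const
        borel_measurable_density_estimator X_measurable t0)
  show Zm: "?Z n \<in> borel_measurable M" for n
    by (intro borel_measurable_times borel_measurable_const avg_measurable)
  show "isCont (cdf std_normal_distribution) x" for x by (rule isCont_cdf_std_normal)
  show "weak_conv_m (\<lambda>n. distr M borel (?Z n)) std_normal_distribution"
  proof (rule levy_continuity)
    show "real_distribution (distr M borel (?Z n))" for n by (rule real_distribution_distr[OF Zm])
    show "real_distribution std_normal_distribution" by (rule real_dist_normal_dist)
    fix t
    have "(\<lambda>n. complex_of_real (exp (- (t\<^sup>2 * (V n / B n)) / 2))) \<longlonglongrightarrow> complex_of_real (exp (- (t\<^sup>2 * 1) / 2))"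
      by (intro tendsto_intros V_div_B) auto
    moreover have "\<forall>\<^sub>F n in sequentially. complex_of_real (exp (- (t\<^sup>2 * (V n / B n)) / 2)) = char (distr M borel (?Z n)) t"
      using B_pos
    proof eventually_elim
      case (elim n)
      have "char (distr M borel (?Z n)) t = (CLINT \<omega>|M. iexp ((t * (sgn b / sqrt (B n))) * avg n \<omega>))"
        unfolding char_def by (subst integral_distr) (auto simp: mult.assoc)
      also have "\<dots> = complex_of_real (exp (- ((t * (sgn b / sqrt (B n)))\<^sup>2 * V n) / 2))"
        using gaussian_rv_centered_cases(3)[OF gaussian_avg expectation_avg] unfolding variance_avg .
      also have "(t * (sgn b / sqrt (B n)))\<^sup>2 * V n = t\<^sup>2 * (V n / B n)"
        using elim \<eta>'(2) by (simp add: power_mult_distrib power_divide sgn_if)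
      finally show ?case ..
    qed
    ultimately have "(\<lambda>n. char (distr M borel (?Z n)) t) \<longlonglongrightarrow> complex_of_real (exp (- (t\<^sup>2 * 1) / 2))"
      by (rule Lim_transform_eventually)
    then show "(\<lambda>n. char (distr M borel (?Z n)) t) \<longlonglongrightarrow> char std_normal_distribution t"
      by (simp add: char_std_normal_distribution)
  qed
  fix \<epsilon> :: real assume \<epsilon>: "\<epsilon> > 0"
  have \<epsilon>b: "\<epsilon> * \<bar>b\<bar> > 0" using \<epsilon> \<eta>'(2) by simp
  show "(\<lambda>n. prob {\<omega> \<in> space M. \<bar>?Y n \<omega> - ?Z n \<omega>\<bar> > \<epsilon>}) \<longlonglongrightarrow> 0"
  proof (rule Lim_transform_eventually[OF density_estimator_linearization[OF t0 f' \<eta>'(1) \<epsilon>b]])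
    show "\<forall>\<^sub>F n in sequentially.
       prob {\<omega> \<in> space M. \<bar>density_estimator X n t0 \<omega> - f t0 - b * avg n \<omega>\<bar> > \<epsilon> * \<bar>b\<bar> * sqrt (B n)} =
       prob {\<omega> \<in> space M. \<bar>?Y n \<omega> - ?Z n \<omega>\<bar> > \<epsilon>}"
      using B_pos eventually_ge_at_top[of 1]
    proof eventually_elim
      case (elim n)
      define s where "s = sqrt (B n)"
      have s: "s > 0" using elim(1) by (simp add: s_def)
      have nd: "real n powr (- d) > 0" using elim(2) by simp
      have l1p: "l1 (real n) > 0" using elim(1) nd unfolding B_def by (simp add: zero_less_mult_iff)
      have "s = (l1 (real n) * real n powr (- d)) powr (1 / 2)"
        using elim(1) by (simp add: s_def B_def powr_half_sqrt)
      also have "\<dots> = l1 (real n) powr (1 / 2) * real n powr (- d / 2)"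
        using l1p by (simp add: powr_mult powr_powr)
      finally have inv_s: "inverse s = l1 (real n) powr (- 1 / 2) * real n powr (d / 2)"
        by (simp add: powr_minus)
      have sg: "sgn b = inverse \<bar>b\<bar> * b" using \<eta>'(2) by (simp add: sgn_if)
      have bs: "\<bar>b\<bar> * s > 0" using s \<eta>'(2) by simp
      have YZ: "?Y n \<omega> - ?Z n \<omega> = (density_estimator X n t0 \<omega> - f t0 - b * avg n \<omega>) / (\<bar>b\<bar> * s)" for \<omega>
      proof -
        have "?Y n \<omega> = inverse \<bar>b\<bar> * inverse s * (density_estimator X n t0 \<omega> - f t0)"
          unfolding inv_s by (simp only: mult.assoc)
        moreover have "?Z n \<omega> = inverse \<bar>b\<bar> * inverse s * (b * avg n \<omega>)"
          unfolding sg divide_inverse s_def[symmetric] by (simp only: mult_ac)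
        ultimately have "?Y n \<omega> - ?Z n \<omega> =
            inverse \<bar>b\<bar> * inverse s * (density_estimator X n t0 \<omega> - f t0 - b * avg n \<omega>)"
          by (simp only: right_diff_distrib)
        then show ?thesis by (simp only: divide_inverse inverse_mult_distrib mult_ac)
      qed
      have "\<bar>?Y n \<omega> - ?Z n \<omega>\<bar> > \<epsilon> \<longleftrightarrow> \<bar>density_estimator X n t0 \<omega> - f t0 - b * avg n \<omega>\<bar> > \<epsilon> * \<bar>b\<bar> * s" for \<omega>
        unfolding YZ abs_divide abs_of_pos[OF bs] pos_less_divide_eq[OF bs] by (simp only: mult.assoc)
      then show ?case by (simp only: s_def)
    qed
  qed
qed

end

theorem theorem11:
  fixes M :: "'a measure" and \<xi> X :: "nat \<Rightarrow> 'a \<Rightarrow> real"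
    and g f l\<^sub>0 l\<^sub>1 \<eta>\<^sub>1 :: "real \<Rightarrow> real" and d t\<^sub>0 :: real
  assumes lrd: "lrd_subordinated_gaussian M \<xi> g X l\<^sub>0 d 1"
    and d: "0 < d" "d < 1 / 2"
    and density: "\<And>x. 0 \<le> f x" "\<And>x. 0 < x \<Longrightarrow> f x = 0" "distributed M lborel (X 1) f"
    and mono: "mono_on {..0} f"
    and t0: "t\<^sub>0 < 0"
    and f': "f differentiable (at t\<^sub>0)" "deriv f t\<^sub>0 > 0"
  defines "\<eta>\<^sub>1 \<equiv> hermite_coeff M (\<xi> 1) g 1"
  assumes eta': "\<eta>\<^sub>1 differentiable (at t\<^sub>0)" "deriv \<eta>\<^sub>1 t\<^sub>0 \<noteq> 0"
  defines "l\<^sub>1 \<equiv> (\<lambda>x. 2 / ((1 - d) * (2 - d)) * l\<^sub>0 x)"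
  shows "slowly_varying l\<^sub>1 \<and>
    weak_conv_m
      (\<lambda>n. distr M borel (\<lambda>\<omega>. inverse \<bar>deriv \<eta>\<^sub>1 t\<^sub>0\<bar> * l\<^sub>1 (real n) powr (- 1 / 2)
             * real n powr (d / 2) * (density_estimator X n t\<^sub>0 \<omega> - f t\<^sub>0)))
      std_normal_distribution"
proof -
  have "lrd_gaussian M \<xi> X g l\<^sub>0 f d"
  proof (intro lrd_gaussian.intro lrd_gaussian_axioms.intro)
    note * = lrd[unfolded lrd_subordinated_gaussian_def]
    show "prob_space M" using * by (elim conjE)
    show "gaussian_process M {1..} \<xi>" using * by (elim conjE)
    show "slowly_varying l\<^sub>0" using * by (elim conjE)
    show "g \<in> borel_measurable borel" using * by (elim conjE)
    show "0 < d" "d < 1 / 2" "distributed M lborel (X 1) f" "mono_on {..0} f" by fact+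
    show "0 \<le> f x" for x by fact
    have moments: "\<forall>i\<ge>1. prob_space.expectation M (\<xi> i) = 0 \<and> prob_space.variance M (\<xi> i) = 1"
      using * by (elim conjE)
    have X: "\<forall>i\<ge>1. X i = (\<lambda>\<omega>. g (\<xi> i \<omega>))" using * by (elim conjE)
    have cov: "\<forall>i\<ge>1. \<forall>k\<ge>1. prob_space.expectation M (\<lambda>\<omega>. \<xi> i \<omega> * \<xi> (i + k) \<omega>)
                      = real k powr (- d) * l\<^sub>0 (real k)" using * by (elim conjE)
    fix i :: nat assume i: "1 \<le> i"
    show "prob_space.expectation M (\<xi> i) = 0" by (rule moments[rule_format, OF i, THEN conjunct1])
    show "prob_space.variance M (\<xi> i) = 1" by (rule moments[rule_format, OF i, THEN conjunct2])
    show "X i = (\<lambda>\<omega>. g (\<xi> i \<omega>))" by (rule X[rule_format, OF i])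
    show "prob_space.expectation M (\<lambda>\<omega>. \<xi> i \<omega> * \<xi> (i + k) \<omega>) = real k powr (- d) * l\<^sub>0 (real k)"
      if "1 \<le> k" for k
      by (rule cov[rule_format, OF i that])
  qed
  then interpret lrd_gaussian M \<xi> X g l\<^sub>0 f d .
  have l1_eq: "l\<^sub>1 = l1" unfolding l\<^sub>1_def l1_def[abs_def] ..
  have \<eta>_eq: "\<eta>\<^sub>1 = \<eta>" unfolding \<eta>\<^sub>1_def by (rule hermite_coeff_eq_\<eta>)
  have Df: "DERIV f t\<^sub>0 :> deriv f t\<^sub>0"
    using f'(1) by (simp only: DERIV_deriv_iff_real_differentiable)
  have D\<eta>: "DERIV \<eta> t\<^sub>0 :> deriv \<eta> t\<^sub>0"
    using eta'(1) by (simp only: \<eta>_eq DERIV_deriv_iff_real_differentiable)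
  show ?thesis
    unfolding l1_eq \<eta>_eq
    by (rule conjI[OF slowly_varying_l1 density_estimator_weak_conv[OF t0 Df f'(2) D\<eta> eta'(2)[unfolded \<eta>_eq]]])
qed

end
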